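(* Let $q$ be a real-valued, $1$-periodic function with $q\in L_1[0,1]$ and $\int_0^1 q(x)\,dx=0$. For the lengths of the gaps $\Delta_n=(\lambda_{n,1},\lambda_{n,2})$ and $\Omega_n=(\mu_{n,1},\mu_{n,2})$ in the spectrum of $L(q)$ the following formulas hold as $n\to\infty$: $$|\Delta_n|=2|q_{2n}|+o(n^{-1}),\qquad |\Delta_n|=2|q_{2n}-S_{2n}+2Q_0Q_{2n}|+o(n^{-2}),$$ and $$|\Omega_n|=2|q_{2n+1}|+o(n^{-1}),\qquad |\Omega_n|=2|q_{2n+1}-S_{2n+1}+2Q_0Q_{2n+1}|+o(n^{-2}).$$
   Context: $L(q)$ is the operator in $L_2(-\infty,\infty)$ generated by $-y''+qy$. $L_0(q)$ and $L_\pi(q)$ are the operators in $L_2[0,1]$ generated by $-y''+qy$ with, respectively, periodic conditions $y(1)=y(0)$, $y'(1)=y'(0)$ and antiperiodic conditions $y(1)=-y(0)$, $y'(1)=-y'(0)$. Their large eigenvalues, counted with multiplicity, form sequences $\lambda_{n,1}\le\lambda_{n,2}$ (for $L_0(q)$) and $\mu_{n,1}\le\mu_{n,2}$ (for $L_\pi(q)$), $n\ge N$ with $N$ sufficiently large, such that $\lambda_{n,j}=(2\pi n)^2+O(n^{1/2})$ and $\mu_{n,j}=(2\pi n+\pi)^2+O(n^{1/2})$. The high-energy gaps in the spectrum of $L(q)$ are the (possibly empty) intervals $\Delta_n,\Omega_n$; $|\Delta|$ denotes the length of an interval $\Delta$, so $|\Delta_n|=\lambda_{n,2}-\lambda_{n,1}$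 and $|\Omega_n|=\mu_{n,2}-\mu_{n,1}$. For a function $f$ put $f_k=\int_0^1f(x)e^{-2\pi ikx}dx$; this gives $q_k,Q_k,S_k$, where $Q(x)=\int_0^xq(t)\,dt$ and $S(x)=Q(x)^2$. *)

theory Defs
  imports
    "HOL-Analysis.Analysis"
    "HOL-Library.Landau_Symbols"
    "HOL-Library.Function_Algebras"
begin

(* Elements of L_2[0,1] are represented by functions on the real line vanishing outside [0,1];
   without this normalisation an eigenspace would contain arbitrary functions living outside
   [0,1] and would not be finite-dimensional.  Functions equal almost everywhere are not
   identified. *)
definition L2_unit :: "(real \<Rightarrow> complex) set" where
  "L2_unit = {f. (\<forall>x. x \<notin> {0..1} \<longrightarrow> f x = 0) \<and> f \<in> borel_measurable lebesgue \<and>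
                 integrable lebesgue (\<lambda>x. (cmod (f x))\<^sup>2)}"

(* Graph of the operator generated by -y'' + q y in L_2[0,1] with the boundary conditions
   y(1) = s y(0), y'(1) = s y'(0).  The domain consists of those y in L_2[0,1] for which y and
   y' are absolutely continuous on [0,1] and -y'' + q y belongs to L_2[0,1].  Absolute
   continuity of y' is expressed by y' being the indefinite integral of a Lebesgue integrable
   function, which is then y'' almost everywhere; y itself is continuously differentiable.
   Since q is only integrable, y'' need not be in L_2 by itself. *)
definition hill_operator :: "(real \<Rightarrow> real) \<Rightarrow> complex \<Rightarrow> ((real \<Rightarrow> complex) \<times> (real \<Rightarrow> complex)) set" where
  "hill_operator q s = {(y, f). y \<in> L2_unit \<and> f \<in> L2_unit \<and>
     (\<exists>y' y''.
        (\<forall>x\<in>{0..1}. (y has_vector_derivative y' x) (at x within {0..1})) \<and>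
        y'' absolutely_integrable_on {0..1} \<and>
        (\<forall>x\<in>{0..1}. y' x = y' 0 + integral {0..x} y'') \<and>
        y 1 = s * y 0 \<and> y' 1 = s * y' 0 \<and>
        (AE x in lebesgue. x \<in> {0..1} \<longrightarrow> f x = - y'' x + complex_of_real (q x) * y x))}"

abbreviation periodic_operator :: "(real \<Rightarrow> real) \<Rightarrow> ((real \<Rightarrow> complex) \<times> (real \<Rightarrow> complex)) set" where
  "periodic_operator q \<equiv> hill_operator q 1"

abbreviation antiperiodic_operator :: "(real \<Rightarrow> real) \<Rightarrow> ((real \<Rightarrow> complex) \<times> (real \<Rightarrow> complex)) set" where
  "antiperiodic_operator q \<equiv> hill_operator q (-1)"

definition eigenspace ::
    "((real \<Rightarrow> complex) \<times> (real \<Rightarrow> complex)) set \<Rightarrow> complex \<Rightarrow> (real \<Rightarrow> complex) set" where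
  "eigenspace T z = {y. (y, \<lambda>x. z * y x) \<in> T}"

lemma vector_space_complex_functions:
  "vector_space (\<lambda>(c::complex) (f::real \<Rightarrow> complex) x. c * f x)"
  by standard (auto simp: fun_eq_iff algebra_simps)

(* The operators are self-adjoint, so the multiplicity of an eigenvalue is the complex dimension
   of its eigenspace; it is 0 exactly when z is not an eigenvalue. *)
definition multiplicity_of_eigenvalue ::
    "((real \<Rightarrow> complex) \<times> (real \<Rightarrow> complex)) set \<Rightarrow> complex \<Rightarrow> nat" where
  "multiplicity_of_eigenvalue T z =
     vector_space.dim (\<lambda>(c::complex) (f::real \<Rightarrow> complex) x. c * f x) (eigenspace T z)"

(* lam n 1 <= lam n 2, n >= N, are the eigenvalues of T outside some disc, each listed as often
   as its multiplicity, and lam n j = c n + O(n^(1/2)).  This fixes lam n j for all large n. *)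
definition large_eigenvalues ::
    "((real \<Rightarrow> complex) \<times> (real \<Rightarrow> complex)) set \<Rightarrow> (nat \<Rightarrow> real) \<Rightarrow> (nat \<Rightarrow> nat \<Rightarrow> real) \<Rightarrow> bool" where
  "large_eigenvalues T c lam \<longleftrightarrow>
     (\<exists>N R. (\<forall>n\<ge>N. R < lam n 1 \<and> lam n 1 \<le> lam n 2) \<and>
            (\<forall>z. R < cmod z \<longrightarrow>
               multiplicity_of_eigenvalue T z =
                 card {(n, j). N \<le> n \<and> j \<in> {1, 2} \<and> complex_of_real (lam n j) = z})) \<and>
     (\<forall>j\<in>{1, 2}. (\<lambda>n. lam n j - c n) \<in> O(\<lambda>n. sqrt (real n)))"

definition gap :: "(nat \<Rightarrow> nat \<Rightarrow> real) \<Rightarrow> nat \<Rightarrow> real set" where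
  "gap lam n = {lam n 1<..<lam n 2}"

definition fourier_coeff :: "(real \<Rightarrow> real) \<Rightarrow> int \<Rightarrow> complex" where
  "fourier_coeff f k =
     integral {0..1} (\<lambda>x. complex_of_real (f x) * exp (- 2 * pi * \<i> * of_int k * complex_of_real x))"

definition primitive :: "(real \<Rightarrow> real) \<Rightarrow> real \<Rightarrow> real" where
  "primitive q x = integral {0..x} q"

definition primitive_sq :: "(real \<Rightarrow> real) \<Rightarrow> real \<Rightarrow> real" where
  "primitive_sq q x = (primitive q x)\<^sup>2"

end

theory Submission
  imports Defs
begin

text \<open>
Write an eigenvalue near \<open>k\<^sup>2\<close>, \<open>k = \<pi> m\<close>, as \<open>k\<^sup>2 + \<epsilon>\<close> and an eigenfunction as
\<open>y = a e\<^sup>i\<^sup>k\<^sup>x + b e\<^sup>-\<^sup>i\<^sup>k\<^sup>x\<close> by variation of constants.  With \<open>h = 1/(2ik)\<close> and \<open>e = e\<^sup>-\<^sup>2\<^sup>i\<^sup>k\<^sup>x\<close> the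
amplitudes satisfy \<open>a' = h (q - \<epsilon>) (a + e b)\<close> and a similar equation for \<open>b\<close>.  For even \<open>m\<close> the
periodic and for odd \<open>m\<close> the antiperiodic boundary conditions say that \<open>a\<close> and \<open>b\<close> are periodic,
so both operators are treated by one argument.

Since \<open>h\<close> is small, the amplitudes are almost constant, and averaging their equations over the period
gives linear equations for the means \<open>A\<close> and \<open>B\<close> of \<open>a\<close> and \<open>b\<close>.  To first order these say that
\<open>(A, B)\<close> is an eigenvector for \<open>\<epsilon>\<close> of the Hermitian matrix with zero diagonal and off-diagonal entries
\<open>q\<^sub>m\<close> and its conjugate.  Integrating by parts once more, with the mean-zero primitives \<open>P\<close> of \<open>q\<close> and \<open>w\<close> of
\<open>q e - q\<^sub>m\<close>, shows that to second order the off-diagonal entry becomes \<open>D = q\<^sub>m - (P\<^sup>2)\<^sub>m\<close>, while the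
diagonal receives a real multiple of the identity that does not depend on \<open>\<epsilon>\<close>; the error
is \<open>o(m\<^sup>-\<^sup>2)\<close> because \<open>w\<close> tends to zero uniformly, by the Riemann--Lebesgue lemma.  This is
\<open>second_order\<close>.  As \<open>P = Q - Q\<^sub>0\<close>, the number \<open>D\<close> is \<open>q\<^sub>m - S\<^sub>m + 2 Q\<^sub>0 Q\<^sub>m\<close>, and \<open>(P\<^sup>2)\<^sub>m = o(m\<^sup>-\<^sup>1)\<close>.

So every eigenvalue in question is, up to \<open>o(m\<^sup>-\<^sup>2)\<close> and a common shift, one of \<open>\<plusminus>|D|\<close>.  The two
eigenvalues of a pair have orthogonal eigenfunctions, their vectors \<open>(A, B)\<close> are then almost
orthogonal, and consequently they belong to different signs (\<open>two_level_splitting\<close>,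
\<open>pair_splitting\<close>).  Hence the gap has length \<open>2|D| + o(m\<^sup>-\<^sup>2)\<close>.
\<close>

section \<open>Absolutely continuous functions on the unit interval\<close>

text \<open>
An absolutely continuous function on $[0,1]$ together with a version of its derivative.  The
derivative is only determined almost everywhere and has to be carried along explicitly: the
potential is merely integrable, so the functions that occur need not be differentiable at any
given point.
\<close>
definition antideriv :: "(real \<Rightarrow> complex) \<Rightarrow> (real \<Rightarrow> complex) \<Rightarrow> bool" where
  "antideriv F f \<longleftrightarrow> f absolutely_integrable_on {0..1} \<and>
     (\<forall>x\<in>{0..1}. F x = F 0 + integral {0..x} f)"

definition L1_norm :: "(real \<Rightarrow> complex) \<Rightarrow> real" where
  "L1_norm f = integral {0..1} (\<lambda>x. cmod (f x))"

lemma absint_mult: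
  fixes F f :: "real \<Rightarrow> complex"
  assumes "continuous_on {0..1} F" "f absolutely_integrable_on {0..1}"
  shows "(\<lambda>x. F x * f x) absolutely_integrable_on {0..1}"
proof (rule absolutely_integrable_bounded_measurable_product[where h="(*)"])
  show "F \<in> borel_measurable (lebesgue_on {0..1})"
    by (rule continuous_imp_measurable_on_sets_lebesgue[OF assms(1)]) auto
  show "bounded (F ` {0..1})"
    using compact_continuous_image[OF assms(1)] compact_imp_bounded by blast
qed (use assms bilinear_times in auto)

lemma absint_cong:
  fixes f g :: "real \<Rightarrow> complex"
  assumes "\<And>x. x \<in> {0..1} \<Longrightarrow> f x = g x" "f absolutely_integrable_on {0..1}"
  shows "g absolutely_integrable_on {0..1}"
  using assms set_integrable_cong[of lebesgue lebesgue "{0..1}" "{0..1}" f g] by auto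

lemma absint_add:
  fixes f g :: "real \<Rightarrow> complex"
  assumes "f absolutely_integrable_on {0..1}" "g absolutely_integrable_on {0..1}"
  shows "(\<lambda>x. f x + g x) absolutely_integrable_on {0..1}"
  using assms by (rule set_integral_add)

lemma absint_sub:
  fixes f :: "real \<Rightarrow> 'a::euclidean_space"
  assumes "f absolutely_integrable_on {0..1}" "0 \<le> u" "v \<le> 1"
  shows "f absolutely_integrable_on {u..v}"
  using assms by (auto intro: absolutely_integrable_on_subinterval)

lemma absint_intble:
  fixes f :: "real \<Rightarrow> 'a::euclidean_space"
  shows "f absolutely_integrable_on S \<Longrightarrow> f integrable_on S"
  by (rule set_lebesgue_integral_eq_integral(1))

lemma absint_norm_intble:
  fixes f :: "real \<Rightarrow> 'a::euclidean_space"
  shows "f absolutely_integrable_on S \<Longrightarrow> (\<lambda>x. norm (f x)) integrable_on S"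
  by (simp add: absolutely_integrable_on_def)

lemma absint_sub_intble:
  fixes f :: "real \<Rightarrow> 'a::euclidean_space"
  assumes "f absolutely_integrable_on {0..1}" "0 \<le> u" "v \<le> 1"
  shows "f integrable_on {u..v}" "(\<lambda>x. norm (f x)) integrable_on {u..v}"
  using absint_sub[OF assms] absint_intble absint_norm_intble by auto

lemma antideriv_absint: "antideriv F f \<Longrightarrow> f absolutely_integrable_on {0..1}"
  unfolding antideriv_def by blast

lemma antideriv_eq: "antideriv F f \<Longrightarrow> 0 \<le> x \<Longrightarrow> x \<le> 1 \<Longrightarrow> F x = F 0 + integral {0..x} f"
  unfolding antideriv_def by (meson atLeastAtMost_iff)

lemma antideriv_integral: "antideriv F f \<Longrightarrow> integral {0..1} f = F 1 - F 0"
  using antideriv_eq[of F f 1] by (simp add: algebra_simps)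

lemma antiderivI:
  assumes "f absolutely_integrable_on {0..1}"
    and "\<And>x. 0 \<le> x \<Longrightarrow> x \<le> 1 \<Longrightarrow> integral {0..x} f = F x - F 0"
  shows "antideriv F f"
  unfolding antideriv_def using assms by force

lemma antideriv_diff:
  assumes "antideriv F f" "0 \<le> u" "u \<le> v" "v \<le> 1"
  shows "F v - F u = integral {u..v} f"
proof -
  have "integral {0..u} f + integral {u..v} f = integral {0..v} f"
    using assms antideriv_absint[OF assms(1)]
    by (intro Henstock_Kurzweil_Integration.integral_combine absint_sub_intble) auto
  moreover have "F v = F 0 + integral {0..v} f" "F u = F 0 + integral {0..u} f"
    using assms by (auto intro!: antideriv_eq)
  ultimately show ?thesis by (simp add: algebra_simps)
qed

lemma antideriv_continuous:
  assumes "antideriv F f"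
  shows "continuous_on {0..1} F"
proof -
  have "continuous_on {0..1} (\<lambda>x. F 0 + integral {0..x} f)"
    using antideriv_absint[OF assms]
    by (intro continuous_on_add continuous_on_const indefinite_integral_continuous_1 absint_intble)
  then show ?thesis
    by (rule continuous_on_eq) (simp add: antideriv_eq[OF assms, symmetric])
qed

lemma antideriv_cong:
  assumes "antideriv F f" "\<And>x. x \<in> {0..1} \<Longrightarrow> F x = G x" "\<And>x. x \<in> {0..1} \<Longrightarrow> f x = g x"
  shows "antideriv G g"
proof (rule antiderivI)
  show "g absolutely_integrable_on {0..1}"
    using absint_cong[of f g] assms(3) antideriv_absint[OF assms(1)] by auto
  fix x :: real assume x: "0 \<le> x" "x \<le> 1"
  have "integral {0..x} g = integral {0..x} f"
    using assms(3) x by (intro Henstock_Kurzweil_Integration.integral_cong) auto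
  then show "integral {0..x} g = G x - G 0"
    using antideriv_diff[OF assms(1), of 0 x] x assms(2) by auto
qed

lemma antideriv_const: "antideriv (\<lambda>_. z) (\<lambda>_. 0)"
  by (rule antiderivI) auto

lemma antideriv_C1:
  assumes "\<And>x. x \<in> {0..1} \<Longrightarrow> (F has_vector_derivative f x) (at x within {0..1})" "continuous_on {0..1} f"
  shows "antideriv F f"
proof (rule antiderivI)
  show "f absolutely_integrable_on {0..1}"
    using assms(2) by (rule absolutely_integrable_continuous_real)
  fix x :: real assume x: "0 \<le> x" "x \<le> 1"
  have "(f has_integral (F x - F 0)) {0..x}"
  proof (rule fundamental_theorem_of_calculus)
    fix t assume "t \<in> {0..x}"
    then show "(F has_vector_derivative f t) (at t within {0..x})"
      using x by (intro has_vector_derivative_within_subset[OF assms(1)]) auto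
  qed (use x in auto)
  then show "integral {0..x} f = F x - F 0" by (rule integral_unique)
qed

lemma antideriv_add:
  assumes "antideriv F f" "antideriv G g"
  shows "antideriv (\<lambda>x. F x + G x) (\<lambda>x. f x + g x)"
proof (rule antiderivI)
  note i = antideriv_absint[OF assms(1)] antideriv_absint[OF assms(2)]
  show "(\<lambda>x. f x + g x) absolutely_integrable_on {0..1}"
    by (rule absint_add[OF i])
  fix x :: real assume x: "0 \<le> x" "x \<le> 1"
  have "integral {0..x} (\<lambda>x. f x + g x) = integral {0..x} f + integral {0..x} g"
    using i x by (intro Henstock_Kurzweil_Integration.integral_add absint_sub_intble) auto
  then show "integral {0..x} (\<lambda>x. f x + g x) = F x + G x - (F 0 + G 0)"
    using antideriv_diff[OF assms(1), of 0 x, symmetric] antideriv_diff[OF assms(2), of 0 x, symmetric] x by simp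
qed

lemma antideriv_linear:
  assumes "bounded_linear T" "antideriv F f"
  shows "antideriv (\<lambda>x. T (F x)) (\<lambda>x. T (f x))"
proof (rule antiderivI)
  interpret bounded_linear T by fact
  note i = antideriv_absint[OF assms(2)]
  show "(\<lambda>x. T (f x)) absolutely_integrable_on {0..1}"
    using absolutely_integrable_linear[OF i assms(1)] by (simp add: o_def)
  fix x :: real assume x: "0 \<le> x" "x \<le> 1"
  have "integral {0..x} (\<lambda>x. T (f x)) = T (integral {0..x} f)"
    using integral_linear[OF absint_sub_intble(1)[OF i] assms(1), of 0 x] x by (simp add: o_def)
  then show "integral {0..x} (\<lambda>x. T (f x)) = T (F x) - T (F 0)"
    using antideriv_diff[OF assms(2), of 0 x, symmetric] x by (simp add: diff)
qed

lemma antideriv_cmult: "antideriv F f \<Longrightarrow> antideriv (\<lambda>x. z * F x) (\<lambda>x. z * f x)"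
  by (rule antideriv_linear[OF bounded_linear_mult_right])

lemma antideriv_cnj: "antideriv F f \<Longrightarrow> antideriv (\<lambda>x. cnj (F x)) (\<lambda>x. cnj (f x))"
  by (rule antideriv_linear[OF bounded_linear_cnj])

lemma antideriv_diff_fun:
  assumes "antideriv F f" "antideriv G g"
  shows "antideriv (\<lambda>x. F x - G x) (\<lambda>x. f x - g x)"
  using antideriv_add[OF assms(1) antideriv_cmult[OF assms(2), of "-1"]] by simp

text \<open>
Cutting the interval into short pieces.  This serves to show that a function is constant when its
derivative is known almost everywhere only.
\<close>
lemma local_bound_imp_global:
  fixes H :: "real \<Rightarrow> complex" and \<Phi> :: "real \<Rightarrow> real"
  assumes d: "d > 0"
    and loc: "\<And>u v. 0 \<le> u \<Longrightarrow> u \<le> v \<Longrightarrow> v \<le> 1 \<Longrightarrow> v - u \<le> d \<Longrightarrow> cmod (H v - H u) \<le> \<Phi> v - \<Phi> u"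
    and x: "x \<in> {0..1}"
  shows "cmod (H x - H 0) \<le> \<Phi> x - \<Phi> 0"
proof -
  have *: "0 \<le> x \<Longrightarrow> x \<le> 1 \<Longrightarrow> x \<le> real n * d \<Longrightarrow> cmod (H x - H 0) \<le> \<Phi> x - \<Phi> 0" for n x
  proof (induction n arbitrary: x)
    case 0
    then show ?case by auto
  next
    case (Suc n)
    show ?case
    proof (cases "x \<le> d")
      case True
      then show ?thesis using loc[of 0 x] Suc by auto
    next
      case False
      have "x - d \<le> real n * d" using Suc.prems(3) by (simp add: algebra_simps)
      then have "cmod (H (x - d) - H 0) \<le> \<Phi> (x - d) - \<Phi> 0"
        using False Suc d by auto
      moreover have "cmod (H x - H (x - d)) \<le> \<Phi> x - \<Phi> (x - d)"
        using False Suc d by (intro loc) auto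
      ultimately show ?thesis
        using norm_triangle_ineq[of "H x - H (x-d)" "H (x-d) - H 0"] by simp
    qed
  qed
  obtain n where "x / d < real n" using reals_Archimedean2 by blast
  then have "x \<le> real n * d" using d by (simp add: field_simps)
  then show ?thesis using * x by auto
qed

text \<open>
The product rule for absolutely continuous functions.  The difference of the two sides has
increments over short intervals that are at most \<open>e\<close> times the increments of
\<open>\<integral>|f| + |g|\<close>, because \<^term>\<open>F\<close> and \<^term>\<open>G\<close> are uniformly continuous; since \<open>e\<close> is
arbitrary, the difference is constant.
\<close>
lemma antideriv_mult:
  assumes F: "antideriv F f" and G: "antideriv G g"
  shows "antideriv (\<lambda>x. F x * G x) (\<lambda>x. f x * G x + F x * g x)"
proof -
  define r where "r = (\<lambda>x. f x * G x + F x * g x)"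
  define \<Phi> where "\<Phi> = (\<lambda>x. integral {0..x} (\<lambda>t. cmod (f t) + cmod (g t)))"
  define H where "H = (\<lambda>x. F x * G x - integral {0..x} r)"
  have f: "f absolutely_integrable_on {0..1}" and g: "g absolutely_integrable_on {0..1}"
    using F G antideriv_absint by auto
  have cF: "continuous_on {0..1} F" and cG: "continuous_on {0..1} G"
    using F G antideriv_continuous by auto
  have r: "r absolutely_integrable_on {0..1}"
    unfolding r_def using absint_add[OF absint_mult[OF cG f] absint_mult[OF cF g]]
    by (simp add: mult.commute)
  have fg: "(\<lambda>t. cmod (f t) + cmod (g t)) integrable_on {u..v}" if "0 \<le> u" "v \<le> 1" for u v
    using that f g by (intro Henstock_Kurzweil_Integration.integrable_add absint_sub_intble)
  have main: "cmod (H x - H 0) \<le> e * \<Phi> x" if x: "x \<in> {0..1}" and e: "e > 0" for x e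
  proof -
    obtain d1 where d1: "d1 > 0" "\<And>s t. s \<in> {0..1} \<Longrightarrow> t \<in> {0..1} \<Longrightarrow> dist s t < d1 \<Longrightarrow> dist (F s) (F t) < e"
      using compact_uniformly_continuous[OF cF] e unfolding uniformly_continuous_on_def by (metis compact_Icc)
    obtain d2 where d2: "d2 > 0" "\<And>s t. s \<in> {0..1} \<Longrightarrow> t \<in> {0..1} \<Longrightarrow> dist s t < d2 \<Longrightarrow> dist (G s) (G t) < e"
      using compact_uniformly_continuous[OF cG] e unfolding uniformly_continuous_on_def by (metis compact_Icc)
    define d where "d = min d1 d2 / 2"
    have "cmod (H v - H u) \<le> e * \<Phi> v - e * \<Phi> u" if uv: "0 \<le> u" "u \<le> v" "v \<le> 1" "v - u \<le> d" for u v
    proof -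
      have fi: "f integrable_on {u..v}" "g integrable_on {u..v}" "r integrable_on {u..v}"
        using uv f g r by (auto intro!: absint_sub_intble)
      have 1: "integral {0..v} r = integral {0..u} r + integral {u..v} r"
        using uv r by (intro Henstock_Kurzweil_Integration.integral_combine[symmetric] absint_sub_intble) auto
      have 2: "\<Phi> v = \<Phi> u + integral {u..v} (\<lambda>t. cmod (f t) + cmod (g t))"
        unfolding \<Phi>_def using uv fg[of 0 v]
        by (intro Henstock_Kurzweil_Integration.integral_combine[symmetric]) auto
      \<comment> \<open>Freezing one factor at an end point turns the increment of the product into an integral of
         \<^term>\<open>f\<close> and \<^term>\<open>g\<close> with constant coefficients, off by the oscillation of the factors.\<close>
      have "F v * G v - F u * G u = F v * (G v - G u) + G u * (F v - F u)"
        by (simp add: algebra_simps)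
      also have "\<dots> = integral {u..v} (\<lambda>t. F v * g t + G u * f t)"
        using uv antideriv_diff[OF F, of u v] antideriv_diff[OF G, of u v] fi
        by (simp add: Henstock_Kurzweil_Integration.integral_add integrable_on_mult_right)
      finally have "H v - H u = integral {u..v} (\<lambda>t. F v * g t + G u * f t) - integral {u..v} r"
        by (simp add: H_def 1 algebra_simps)
      also have "\<dots> = integral {u..v} (\<lambda>t. (F v * g t + G u * f t) - r t)"
        using fi by (intro Henstock_Kurzweil_Integration.integral_diff[symmetric] Henstock_Kurzweil_Integration.integrable_add integrable_on_mult_right)
      also have "cmod \<dots> \<le> integral {u..v} (\<lambda>t. e * (cmod (f t) + cmod (g t)))"
      proof (rule integral_norm_bound_integral)
        show "(\<lambda>t. (F v * g t + G u * f t) - r t) integrable_on {u..v}"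
          using fi by (intro Henstock_Kurzweil_Integration.integrable_diff Henstock_Kurzweil_Integration.integrable_add integrable_on_mult_right)
        show "(\<lambda>t. e * (cmod (f t) + cmod (g t))) integrable_on {u..v}"
          using fg uv by (intro integrable_on_mult_right) auto
        fix t assume t: "t \<in> {u..v}"
        have a: "cmod (F v - F t) \<le> e"
          using d1(2)[of v t] d1(1) d2(1) uv t unfolding d_def dist_norm by (auto simp: min_def split: if_splits)
        have b: "cmod (G u - G t) \<le> e"
          using d2(2)[of u t] d1(1) d2(1) uv t unfolding d_def dist_norm by (auto simp: min_def split: if_splits)
        have "(F v * g t + G u * f t) - r t = (F v - F t) * g t + (G u - G t) * f t"
          by (simp add: r_def algebra_simps)
        also have "cmod \<dots> \<le> cmod (F v - F t) * cmod (g t) + cmod (G u - G t) * cmod (f t)"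
          by (metis norm_mult norm_triangle_ineq)
        also have "\<dots> \<le> e * cmod (g t) + e * cmod (f t)"
          using a b by (intro add_mono mult_right_mono) auto
        finally show "cmod (F v * g t + G u * f t - r t) \<le> e * (cmod (f t) + cmod (g t))"
          by (simp add: algebra_simps)
      qed
      also have "\<dots> = e * \<Phi> v - e * \<Phi> u" by (simp only: 2 Henstock_Kurzweil_Integration.integral_mult_right) (simp add: algebra_simps)
      finally show ?thesis .
    qed
    then have "cmod (H x - H 0) \<le> e * \<Phi> x - e * \<Phi> 0"
      using x d1(1) d2(1) by (intro local_bound_imp_global[of d H "\<lambda>x. e * \<Phi> x"]) (auto simp: d_def)
    then show ?thesis by (simp add: \<Phi>_def)
  qed
  have "H x = H 0" if x: "x \<in> {0..1}" for x
  proof -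
    have P0: "\<Phi> x \<ge> 0"
      unfolding \<Phi>_def using x fg[of 0 x] by (intro Henstock_Kurzweil_Integration.integral_nonneg) auto
    have "cmod (H x - H 0) \<le> 0 + e" if "e > 0" for e
    proof -
      have "cmod (H x - H 0) \<le> e / (\<Phi> x + 1) * \<Phi> x"
        using main[OF x, of "e / (\<Phi> x + 1)"] P0 that by auto
      also have "\<dots> \<le> e" using P0 that by (simp add: field_simps)
      finally show ?thesis by simp
    qed
    then have "cmod (H x - H 0) \<le> 0" by (rule field_le_epsilon)
    then show ?thesis by simp
  qed
  then have "F x * G x - integral {0..x} r = F 0 * G 0" if "x \<in> {0..1}" for x
    using that by (simp add: H_def)
  then have "integral {0..x} r = F x * G x - F 0 * G 0" if "x \<in> {0..1}" for x
    using that by (metis add_diff_cancel_left' diff_add_cancel)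
  then show ?thesis
    using r unfolding r_def by (intro antiderivI) auto
qed

text \<open>
The estimates below trade a factor for its periodic antiderivative, which is small if the factor
oscillates.
\<close>
lemma integration_by_parts_periodic:
  assumes "antideriv F f" "antideriv G g" "F 1 * G 1 = F 0 * G 0"
  shows "integral {0..1} (\<lambda>x. f x * G x) = - integral {0..1} (\<lambda>x. F x * g x)"
proof -
  have "integral {0..1} (\<lambda>x. f x * G x + F x * g x) = 0"
    using antideriv_integral[OF antideriv_mult[OF assms(1,2)]] assms(3) by simp
  moreover have "(\<lambda>x. f x * G x) integrable_on {0..1}"
    using absint_mult[OF antideriv_continuous[OF assms(2)] antideriv_absint[OF assms(1)]]
    by (auto intro!: absint_intble simp: mult.commute)
  moreover have "(\<lambda>x. F x * g x) integrable_on {0..1}"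
    using absint_mult[OF antideriv_continuous[OF assms(1)] antideriv_absint[OF assms(2)]]
    by (auto intro!: absint_intble)
  ultimately show ?thesis
    by (simp add: Henstock_Kurzweil_Integration.integral_add eq_neg_iff_add_eq_0)
qed

lemma L1_nonneg: "f absolutely_integrable_on {0..1} \<Longrightarrow> 0 \<le> L1_norm f"
  unfolding L1_norm_def by (intro Henstock_Kurzweil_Integration.integral_nonneg absint_norm_intble) auto

lemma L1_add:
  assumes "f absolutely_integrable_on {0..1}" "g absolutely_integrable_on {0..1}"
  shows "L1_norm (\<lambda>x. f x + g x) \<le> L1_norm f + L1_norm g"
proof -
  have "L1_norm (\<lambda>x. f x + g x) \<le> integral {0..1} (\<lambda>x. cmod (f x) + cmod (g x))"
    unfolding L1_norm_def using assms
    by (intro integral_le absint_norm_intble Henstock_Kurzweil_Integration.integrable_add norm_triangle_ineq)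
       (auto intro: absint_add)
  also have "\<dots> = L1_norm f + L1_norm g"
    unfolding L1_norm_def using assms by (intro Henstock_Kurzweil_Integration.integral_add absint_norm_intble)
  finally show ?thesis .
qed

lemma L1_mult:
  assumes "continuous_on {0..1} F" "f absolutely_integrable_on {0..1}" "\<And>x. x \<in> {0..1} \<Longrightarrow> cmod (F x) \<le> M"
  shows "L1_norm (\<lambda>x. F x * f x) \<le> M * L1_norm f"
proof -
  have "L1_norm (\<lambda>x. F x * f x) \<le> integral {0..1} (\<lambda>x. M * cmod (f x))"
    unfolding L1_norm_def using assms
    by (intro integral_le absint_norm_intble integrable_on_mult_right)
       (auto intro: absint_mult mult_right_mono simp: norm_mult)
  then show ?thesis by (simp add: L1_norm_def)
qed

lemma integral_le_L1:
  assumes "f absolutely_integrable_on {0..1}"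
  shows "cmod (integral {0..1} f) \<le> L1_norm f"
  unfolding L1_norm_def using assms by (intro integral_norm_bound_integral absint_intble absint_norm_intble) auto

lemma antideriv_osc:
  assumes "antideriv F f" "x \<in> {0..1}" "z \<in> {0..1}"
  shows "cmod (F x - F z) \<le> L1_norm f"
proof -
  have *: "cmod (F v - F u) \<le> L1_norm f" if "0 \<le> u" "u \<le> v" "v \<le> 1" for u v
  proof -
    have "cmod (F v - F u) = cmod (integral {u..v} f)"
      using antideriv_diff[OF assms(1) that] by simp
    also have "\<dots> \<le> integral {u..v} (\<lambda>x. cmod (f x))"
      using that antideriv_absint[OF assms(1)]
      by (intro integral_norm_bound_integral absint_intble absint_sub_intble) auto
    also have "\<dots> \<le> L1_norm f"
      unfolding L1_norm_def using that antideriv_absint[OF assms(1)]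
      by (intro integral_subset_le absint_sub_intble) auto
    finally show ?thesis .
  qed
  show ?thesis
    using *[of x z] *[of z x] assms(2,3) by (cases "x \<le> z") (auto simp: norm_minus_commute)
qed

lemma antideriv_minus_mean:
  assumes "antideriv F f" "x \<in> {0..1}"
  shows "cmod (F x - integral {0..1} F) \<le> L1_norm f"
proof -
  have i: "F integrable_on {0..1}" using antideriv_continuous[OF assms(1)] by (rule integrable_continuous_real)
  have "F x - integral {0..1} F = integral {0..1} (\<lambda>t. F x - F t)"
    using i by (subst Henstock_Kurzweil_Integration.integral_diff) auto
  also have "cmod \<dots> \<le> integral {0..1} (\<lambda>t::real. L1_norm f)"
    using antideriv_osc[OF assms] i by (intro integral_norm_bound_integral Henstock_Kurzweil_Integration.integrable_diff) auto
  finally show ?thesis by simp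
qed

section \<open>The Riemann--Lebesgue lemma\<close>

text \<open>
Density of smooth functions in $L_1$, by truncation, continuous approximation of the truncated
function and uniform approximation by a polynomial.
\<close>
lemma L1_approx_C1:
  fixes q :: "real \<Rightarrow> real"
  assumes q: "q absolutely_integrable_on {0..1}" and e: "e > 0"
  obtains p p' where "\<And>x. (p has_real_derivative p' x) (at x)" "continuous_on {0..1} p'" "integral {0..1} (\<lambda>x. \<bar>q x - p x\<bar>) < e"
proof -
  define clip where "clip = (\<lambda>(M::real) y. max (- M) (min M y))"
  have clip_cont: "continuous_on UNIV (clip M)" for M
    unfolding clip_def by (intro continuous_intros)
  have clip_le: "\<bar>clip M y\<bar> \<le> M" if "M \<ge> 0" for M y
    using that by (auto simp: clip_def)
  have qm: "q \<in> borel_measurable (lebesgue_on {0..1})"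
    using q absolutely_integrable_measurable[where S="{0..1}" and f=q] by simp
  have qi: "(\<lambda>x. \<bar>q x\<bar>) integrable_on {0..1}"
    using absint_norm_intble[OF q] by simp
  have clipm: "(\<lambda>x. clip M (q x)) absolutely_integrable_on {0..1}" if "M \<ge> 0" for M
  proof (rule measurable_bounded_by_integrable_imp_absolutely_integrable)
    show "(\<lambda>x. clip M (q x)) \<in> borel_measurable (lebesgue_on {0..1})"
      unfolding clip_def using qm by measurable
    show "(\<lambda>x. M) integrable_on {0..1::real}" by auto
  qed (use clip_le that in auto)
  \<comment> \<open>Pointwise limits of continuous functions need not converge in $L_1$; cutting the values off
     at a level that loses little of the integral makes dominated convergence applicable below.\<close>
  have "(\<lambda>n. integral {0..1} (\<lambda>x. \<bar>q x - clip (real n) (q x)\<bar>)) \<longlonglongrightarrow> integral {0..1} (\<lambda>x::real. 0)"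
  proof (rule dominated_convergence)
    show "(\<lambda>x. \<bar>q x - clip (real n) (q x)\<bar>) integrable_on {0..1}" for n
      using absint_norm_intble[OF set_integral_diff(1)[OF q clipm[of "real n"]]] by simp
    show "(\<lambda>x. \<bar>q x\<bar>) integrable_on {0..1}" by fact
    show "norm \<bar>q x - clip (real n) (q x)\<bar> \<le> \<bar>q x\<bar>" for n x
      by (auto simp: clip_def)
    fix x
    obtain N where N: "\<bar>q x\<bar> < real N" using reals_Archimedean2 by blast
    have "\<forall>\<^sub>F n in sequentially. \<bar>q x - clip (real n) (q x)\<bar> = 0"
      using eventually_ge_at_top[of N] by eventually_elim (use N in \<open>auto simp: clip_def\<close>)
    then show "(\<lambda>n. \<bar>q x - clip (real n) (q x)\<bar>) \<longlonglongrightarrow> 0"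
      by (rule tendsto_eventually)
  qed
  then have "\<forall>\<^sub>F n in sequentially. integral {0..1} (\<lambda>x. \<bar>q x - clip (real n) (q x)\<bar>) < e / 3"
    using e by (intro order_tendstoD(2)) auto
  then obtain n where n: "integral {0..1} (\<lambda>x. \<bar>q x - clip (real n) (q x)\<bar>) < e / 3"
    by (auto simp: eventually_sequentially)
  define M where "M = real n"
  have M: "M \<ge> 0" by (simp add: M_def)
  \<comment> \<open>A measurable function is an almost everywhere limit of continuous functions, and clipping
     these at the same level keeps them continuous and gives them a common bound.\<close>
  have "q measurable_on {0..1}"
    using qm by (simp add: measurable_on_iff_borel_measurable)
  then obtain N g where N: "negligible N" and g: "\<And>n. continuous_on UNIV (g n :: real \<Rightarrow> real)"
    and lim: "\<And>x. x \<notin> N \<Longrightarrow> (\<lambda>n. g n x) \<longlonglongrightarrow> (if x \<in> {0..1} then q x else 0)"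
    unfolding measurable_on_def by blast
  have gi: "(\<lambda>x. clip M (g n x)) absolutely_integrable_on {0..1}" for n
    by (intro absolutely_integrable_continuous_real continuous_on_compose2[OF clip_cont] continuous_on_subset[OF g]) auto
  define z where "z = (\<lambda>n x. if x \<in> N then 0 else \<bar>clip M (q x) - clip M (g n x)\<bar>)"
  have zi: "z n integrable_on {0..1}" for n
    unfolding z_def
    by (rule integrable_spike[OF absint_norm_intble[OF set_integral_diff(1)[OF clipm[OF M] gi[of n]]] N]) auto
  have zeq: "integral {0..1} (z n) = integral {0..1} (\<lambda>x. \<bar>clip M (q x) - clip M (g n x)\<bar>)" for n
    by (rule integral_spike[OF N]) (auto simp: z_def)
  have "(\<lambda>n. integral {0..1} (z n)) \<longlonglongrightarrow> integral {0..1} (\<lambda>x::real. 0)"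
  proof (rule dominated_convergence)
    show "z n integrable_on {0..1}" for n by fact
    show "(\<lambda>x. 2 * M) integrable_on {0..1::real}" by auto
    show "norm (z n x) \<le> 2 * M" for n x
      using clip_le[OF M, of "q x"] clip_le[OF M, of "g n x"] M by (auto simp: z_def)
    fix x :: real assume x: "x \<in> {0..1}"
    show "(\<lambda>n. z n x) \<longlonglongrightarrow> 0"
    proof (cases "x \<in> N")
      case False
      have "(\<lambda>n. clip M (g n x)) \<longlonglongrightarrow> clip M (q x)"
        using lim[OF False] x clip_cont by (intro continuous_on_tendsto_compose[OF clip_cont]) auto
      then have "(\<lambda>n. \<bar>clip M (q x) - clip M (g n x)\<bar>) \<longlonglongrightarrow> \<bar>clip M (q x) - clip M (q x)\<bar>"
        by (intro tendsto_intros)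
      then show ?thesis using False by (simp add: z_def)
    qed (simp add: z_def)
  qed
  then have "\<forall>\<^sub>F n in sequentially. integral {0..1} (z n) < e / 3"
    using e by (intro order_tendstoD(2)) auto
  then obtain k where k: "integral {0..1} (z k) < e / 3"
    by (auto simp: eventually_sequentially)
  define h where "h = (\<lambda>x. clip M (g k x))"
  have hc: "continuous_on {0..1} h"
    unfolding h_def by (intro continuous_on_compose2[OF clip_cont] continuous_on_subset[OF g]) auto
  \<comment> \<open>A continuous function has no derivative to integrate by parts with, hence one more step
     to a polynomial.\<close>
  obtain p where p: "real_polynomial_function p" "\<And>x. x \<in> {0..1} \<Longrightarrow> \<bar>h x - p x\<bar> < e / 3"
    using Stone_Weierstrass_real_polynomial_function[OF compact_Icc hc, of "e/3"] e by auto
  obtain p' where p': "real_polynomial_function p'" "\<And>x. (p has_real_derivative p' x) (at x)"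
    using has_real_derivative_polynomial_function[OF p(1)] by blast
  obtain p'' where p'': "\<And>x. (p' has_real_derivative p'' x) (at x)"
    using has_real_derivative_polynomial_function[OF p'(1)] by blast
  have pc: "continuous_on {0..1} p" and p'c: "continuous_on {0..1} p'"
    by (rule DERIV_continuous_on[OF has_field_derivative_at_within[OF p'(2)]],
        rule DERIV_continuous_on[OF has_field_derivative_at_within[OF p'']])
  have i1: "(\<lambda>x. \<bar>q x - clip M (q x)\<bar>) integrable_on {0..1}"
    using absint_norm_intble[OF set_integral_diff(1)[OF q clipm[OF M]]] by simp
  have i2: "(\<lambda>x. \<bar>clip M (q x) - h x\<bar>) integrable_on {0..1}"
    using absint_norm_intble[OF set_integral_diff(1)[OF clipm[OF M] gi[of k]]] by (simp add: h_def)
  have i3: "(\<lambda>x. \<bar>q x - p x\<bar>) integrable_on {0..1}"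
    using absint_norm_intble[OF set_integral_diff(1)[OF q absolutely_integrable_continuous_real[OF pc]]] by simp
  have "integral {0..1} (\<lambda>x. \<bar>q x - p x\<bar>) \<le> integral {0..1} (\<lambda>x. (\<bar>q x - clip M (q x)\<bar> + \<bar>clip M (q x) - h x\<bar>) + e / 3)"
    using p(2) by (intro integral_le i3 Henstock_Kurzweil_Integration.integrable_add i1 i2) (force simp: abs_if split: if_splits)+
  also have "\<dots> = integral {0..1} (\<lambda>x. \<bar>q x - clip M (q x)\<bar>) + integral {0..1} (\<lambda>x. \<bar>clip M (q x) - h x\<bar>) + e / 3"
  proof -
    have "integral {0..1} (\<lambda>x. (\<bar>q x - clip M (q x)\<bar> + \<bar>clip M (q x) - h x\<bar>) + e / 3)
        = integral {0..1} (\<lambda>x. \<bar>q x - clip M (q x)\<bar> + \<bar>clip M (q x) - h x\<bar>) + integral {0..1} (\<lambda>x::real. e / 3)"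
      by (intro Henstock_Kurzweil_Integration.integral_add Henstock_Kurzweil_Integration.integrable_add i1 i2) auto
    then show ?thesis
      by (simp add: Henstock_Kurzweil_Integration.integral_add[OF i1 i2])
  qed
  also have "\<dots> < e / 3 + e / 3 + e / 3"
    using n k unfolding zeq M_def[symmetric] h_def by simp
  finally have "integral {0..1} (\<lambda>x. \<bar>q x - p x\<bar>) < e" by simp
  with p'(2) p'c show ?thesis by (rule that)
qed

text \<open>
The Riemann--Lebesgue lemma for all initial segments at once.  The uniformity in the end point is
what makes the antiderivative of \<open>q e\<^sup>-\<^sup>2\<^sup>i\<^sup>k\<^sup>x\<close> uniformly small.
\<close>
lemma riemann_lebesgue_uniform:
  fixes q :: "real \<Rightarrow> real"
  assumes q: "q absolutely_integrable_on {0..1}" and e: "e > 0"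
  shows "\<exists>K>0. \<forall>k\<ge>K. \<forall>x\<in>{0..1}. cmod (integral {0..x} (\<lambda>t. of_real (q t) * exp (- (2 * \<i> * of_real k * of_real t)))) \<le> e"
proof -
  obtain p p' where p: "\<And>x. (p has_real_derivative p' x) (at x)" and p'c: "continuous_on {0..1} p'"
    and pq: "integral {0..1} (\<lambda>x. \<bar>q x - p x\<bar>) < e / 2"
    using L1_approx_C1[OF q, of "e/2"] e by auto
  have pc: "continuous_on {0..1} p"
    by (rule DERIV_continuous_on[OF has_field_derivative_at_within[OF p]])
  obtain B where B: "\<forall>x\<in>{0..1}. \<bar>p x\<bar> \<le> B"
    using compact_imp_bounded[OF compact_continuous_image[OF pc compact_Icc]] by (auto simp: bounded_iff)
  obtain B' where B': "\<forall>x\<in>{0..1}. \<bar>p' x\<bar> \<le> B'"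
    using compact_imp_bounded[OF compact_continuous_image[OF p'c compact_Icc]] by (auto simp: bounded_iff)
  have Bnn: "0 \<le> B" "0 \<le> B'" using bspec[OF B, of 0] bspec[OF B', of 0] by auto
  define K where "K = (2 * B + B' + 1) / e"
  have K: "K > 0" using Bnn e by (simp add: K_def)
  show ?thesis
  proof (intro exI[of _ K] conjI K allI impI ballI)
    fix k x assume k: "K \<le> k" and x: "x \<in> {0..1::real}"
    have k0: "k > 0" using k K by simp
    define E where "E = (\<lambda>t::real. exp (- (2 * \<i> * of_real k * of_real t)))"
    have E1: "cmod (E t) = 1" for t by (simp add: E_def)
    have dE: "(E has_vector_derivative (- (2 * \<i> * of_real k) * E t)) (at t within S)" for t S
      unfolding E_def
      by (auto intro!: derivative_eq_intros has_vector_derivative_real_field simp: mult_ac)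
    have Ec: "continuous_on S E" for S unfolding E_def by (intro continuous_intros)
    define c where "c = - (1 / (2 * \<i> * of_real k) :: complex)"
    have c: "c * (- (2 * \<i> * of_real k)) = 1" using k0 by (simp add: c_def)
    have nc: "cmod c = 1 / (2 * k)" using k0 by (simp add: c_def norm_divide norm_mult)
    define G where "G = (\<lambda>t. c * (of_real (p t) * E t))"
    have dG: "(G has_vector_derivative (of_real (p t) * E t + c * (of_real (p' t) * E t))) (at t within S)" for t S
    proof -
      have "((\<lambda>t. complex_of_real (p t)) has_vector_derivative of_real (p' t)) (at t within S)"
        by (rule has_vector_derivative_of_real[OF has_field_derivative_at_within[OF p]])
      from has_vector_derivative_mult_right[OF has_vector_derivative_mult[OF this dE], of c]
      have "(G has_vector_derivative (c * (of_real (p t) * (- (2 * \<i> * of_real k) * E t) + of_real (p' t) * E t))) (at t within S)"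
        unfolding G_def .
      also have "c * (of_real (p t) * (- (2 * \<i> * of_real k) * E t) + of_real (p' t) * E t)
          = (c * (- (2 * \<i> * of_real k))) * (of_real (p t) * E t) + c * (of_real (p' t) * E t)"
        by (simp add: algebra_simps)
      finally show ?thesis by (simp only: c mult_1_left)
    qed
    have sub: "{0..x} \<subseteq> {0..1}" using x by auto
    have i1: "(\<lambda>t. of_real (p t) * E t) integrable_on {0..x}"
      by (intro integrable_continuous_real continuous_intros continuous_on_subset[OF pc sub] Ec)
    have i2: "(\<lambda>t. of_real (p' t) * E t) integrable_on {0..x}"
      by (intro integrable_continuous_real continuous_intros continuous_on_subset[OF p'c sub] Ec)
    have "((\<lambda>t. of_real (p t) * E t + c * (of_real (p' t) * E t)) has_integral (G x - G 0)) {0..x}"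
      using x dG by (intro fundamental_theorem_of_calculus) auto
    then have "integral {0..x} (\<lambda>t. of_real (p t) * E t) + c * integral {0..x} (\<lambda>t. of_real (p' t) * E t) = G x - G 0"
      using i1 i2 by (subst (asm) has_integral_iff) (simp add: Henstock_Kurzweil_Integration.integral_add integrable_on_mult_right)
    \<comment> \<open>One integration by parts; the factor \<^term>\<open>c\<close> is of order $1/k$.\<close>
    then have *: "integral {0..x} (\<lambda>t. of_real (p t) * E t) = c * (of_real (p x) * E x - of_real (p 0) * E 0 - integral {0..x} (\<lambda>t. of_real (p' t) * E t))"
      unfolding G_def by (simp add: algebra_simps eq_diff_eq)
    have "cmod (integral {0..x} (\<lambda>t. of_real (p' t) * E t)) \<le> integral {0..x} (\<lambda>t. B')"
      using B' sub by (intro integral_norm_bound_integral i2) (auto simp: norm_mult E1)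
    also have "\<dots> \<le> B'" using x Bnn by (simp add: mult_left_le_one_le)
    finally have b3: "cmod (integral {0..x} (\<lambda>t. of_real (p' t) * E t)) \<le> B'" .
    have "cmod (of_real (p x) * E x - of_real (p 0) * E 0 - integral {0..x} (\<lambda>t. of_real (p' t) * E t)) \<le> B + B + B'"
      using bspec[OF B, of x] bspec[OF B, of 0] x b3
      by (intro order_trans[OF norm_triangle_ineq4] add_mono) (auto simp: norm_mult E1)
    then have "cmod (integral {0..x} (\<lambda>t. of_real (p t) * E t)) \<le> (1 / (2 * k)) * (2 * B + B')"
      unfolding * norm_mult nc using k0 by (intro mult_left_mono) auto
    also have "\<dots> \<le> e / 2"
    proof -
      have "2 * B + B' \<le> e * k" using k e Bnn by (simp add: K_def field_simps)
      then show ?thesis using k0 by (simp add: field_simps)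
    qed
    finally have 1: "cmod (integral {0..x} (\<lambda>t. of_real (p t) * E t)) \<le> e / 2" .
    have d: "(\<lambda>t. q t - p t) absolutely_integrable_on {0..1}"
      by (intro set_integral_diff(1) q absolutely_integrable_continuous_real pc)
    have d': "(\<lambda>t. E t * complex_of_real (q t - p t)) absolutely_integrable_on {0..1}"
      using absolutely_integrable_linear[OF d bounded_linear_of_real]
      by (intro absint_mult Ec) (simp add: o_def)
    have i3: "(\<lambda>t. E t * complex_of_real (q t - p t)) integrable_on {0..x}"
      using absint_sub_intble[OF d', of 0 x] x by auto
    have "cmod (integral {0..x} (\<lambda>t. E t * complex_of_real (q t - p t))) \<le> integral {0..x} (\<lambda>t. \<bar>q t - p t\<bar>)"
      using absint_sub_intble[OF d, of 0 x] x
      by (intro integral_norm_bound_integral i3) (auto simp: norm_mult E1 simp flip: of_real_diff)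
    also have "\<dots> \<le> integral {0..1} (\<lambda>t. \<bar>q t - p t\<bar>)"
      using absint_sub_intble[OF d, of 0 x] absint_sub_intble[OF d, of 0 1] x by (intro integral_subset_le) auto
    finally have 2: "cmod (integral {0..x} (\<lambda>t. E t * complex_of_real (q t - p t))) \<le> e / 2"
      using pq by simp
    have "integral {0..x} (\<lambda>t. of_real (q t) * E t)
        = integral {0..x} (\<lambda>t. E t * complex_of_real (q t - p t) + of_real (p t) * E t)"
      by (intro arg_cong2[where f=integral] refl ext) (simp add: algebra_simps)
    also have "\<dots> = integral {0..x} (\<lambda>t. E t * complex_of_real (q t - p t)) + integral {0..x} (\<lambda>t. of_real (p t) * E t)"
      by (intro Henstock_Kurzweil_Integration.integral_add i1 i3)
    also have "cmod \<dots> \<le> e / 2 + e / 2"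
      using 1 2 by (intro order_trans[OF norm_triangle_ineq] add_mono)
    finally show "cmod (integral {0..x} (\<lambda>t. of_real (q t) * exp (- (2 * \<i> * of_real k * of_real t)))) \<le> e"
      by (simp add: E_def)
  qed
qed

section \<open>Integration by parts with bounds\<close>

text \<open>
Size and total variation are kept together because the variation of a product involves both.
\<close>
definition periodic_bv :: "(real \<Rightarrow> complex) \<Rightarrow> (real \<Rightarrow> complex) \<Rightarrow> real \<Rightarrow> real \<Rightarrow> bool" where
  "periodic_bv F f M V \<longleftrightarrow> antideriv F f \<and> F 1 = F 0 \<and> (\<forall>x\<in>{0..1}. cmod (F x) \<le> M) \<and> L1_norm f \<le> V"

lemma bvD:
  assumes "periodic_bv F f M V"
  shows "antideriv F f" "F 1 = F 0" "\<And>x. x \<in> {0..1} \<Longrightarrow> cmod (F x) \<le> M" "L1_norm f \<le> V"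
    "continuous_on {0..1} F" "f absolutely_integrable_on {0..1}" "0 \<le> M" "0 \<le> V"
proof -
  show *: "antideriv F f" "F 1 = F 0" "\<And>x. x \<in> {0..1} \<Longrightarrow> cmod (F x) \<le> M" "L1_norm f \<le> V"
    using assms by (auto simp: periodic_bv_def)
  show "continuous_on {0..1} F" "f absolutely_integrable_on {0..1}"
    using *(1) antideriv_continuous antideriv_absint by auto
  then show "0 \<le> V" using L1_nonneg[of f] *(4) by linarith
  show "0 \<le> M" using order_trans[OF norm_ge_zero *(3)[of 0]] by simp
qed

lemma bv_mult:
  assumes F: "periodic_bv F f M V" and G: "periodic_bv G g M' V'"
  shows "periodic_bv (\<lambda>x. F x * G x) (\<lambda>x. f x * G x + F x * g x) (M * M') (V * M' + M * V')"
  unfolding periodic_bv_def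
proof (intro conjI ballI)
  note f = bvD[OF F] and g = bvD[OF G]
  show "antideriv (\<lambda>x. F x * G x) (\<lambda>x. f x * G x + F x * g x)"
    by (rule antideriv_mult[OF f(1) g(1)])
  show "F 1 * G 1 = F 0 * G 0" using f g by simp
  show "cmod (F x * G x) \<le> M * M'" if "x \<in> {0..1}" for x
    using f(3)[OF that] g(3)[OF that] by (auto simp: norm_mult intro!: mult_mono f g)
  have "L1_norm (\<lambda>x. f x * G x + F x * g x) \<le> L1_norm (\<lambda>x. G x * f x) + L1_norm (\<lambda>x. F x * g x)"
    using L1_add[OF absint_mult[OF g(5) f(6)] absint_mult[OF f(5) g(6)]] by (simp add: mult.commute)
  also have "\<dots> \<le> M' * L1_norm f + M * L1_norm g"
    by (intro add_mono L1_mult f g)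
  also have "\<dots> \<le> M' * V + M * V'"
    using f g by (intro add_mono mult_left_mono) auto
  finally show "L1_norm (\<lambda>x. f x * G x + F x * g x) \<le> V * M' + M * V'" by (simp add: mult.commute)
qed

lemma bv_minus_mean:
  assumes "periodic_bv F f M V"
  shows "periodic_bv (\<lambda>x. F x - integral {0..1} F) f V V"
  unfolding periodic_bv_def
proof (intro conjI ballI)
  note f = bvD[OF assms]
  show "antideriv (\<lambda>x. F x - integral {0..1} F) f"
    using antideriv_diff_fun[OF f(1) antideriv_const] by simp
  show "cmod (F x - integral {0..1} F) \<le> V" if "x \<in> {0..1}" for x
    using antideriv_minus_mean[OF f(1) that] f(4) by linarith
qed (use bvD[OF assms] in auto)

lemma intble_mult:
  fixes F f :: "real \<Rightarrow> complex"
  assumes "continuous_on {0..1} F" "f absolutely_integrable_on {0..1}"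
  shows "(\<lambda>x. f x * F x) integrable_on {0..1}"
  using absint_intble[OF absint_mult[OF assms]] by (simp add: mult.commute)

lemma norm_integral_mult_le:
  assumes "continuous_on {0..1} F" "f absolutely_integrable_on {0..1}" "\<And>x. x \<in> {0..1} \<Longrightarrow> cmod (F x) \<le> M"
  shows "cmod (integral {0..1} (\<lambda>x. f x * F x)) \<le> M * L1_norm f"
proof -
  have "cmod (integral {0..1} (\<lambda>x. F x * f x)) \<le> L1_norm (\<lambda>x. F x * f x)"
    by (rule integral_le_L1[OF absint_mult[OF assms(1,2)]])
  also have "\<dots> \<le> M * L1_norm f"
    by (rule L1_mult[OF assms])
  finally show ?thesis by (simp add: mult.commute)
qed

lemma norm_integral_le_sup:
  fixes F :: "real \<Rightarrow> complex"
  assumes "continuous_on {0..1} F" "\<And>x. x \<in> {0..1} \<Longrightarrow> cmod (F x) \<le> M"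
  shows "cmod (integral {0..1} F) \<le> M"
proof -
  have "cmod (integral {0..1} F) \<le> integral {0..1} (\<lambda>x::real. M)"
    using assms by (intro integral_norm_bound_integral integrable_continuous_real) auto
  then show ?thesis by simp
qed

text \<open>
The function \<open>g\<close> may be large; only its antiderivative enters, at the price of the variation of
\<open>F\<close>.
\<close>
lemma bv_by_parts_bound:
  assumes G: "antideriv G g" "G 1 = G 0" "\<And>x. x \<in> {0..1} \<Longrightarrow> cmod (G x) \<le> K" and F: "periodic_bv F f M V"
  shows "cmod (integral {0..1} (\<lambda>x. g x * F x)) \<le> K * V"
proof -
  have K0: "0 \<le> K" using order_trans[OF norm_ge_zero G(3)[of 0]] by simp
  have "integral {0..1} (\<lambda>x. g x * F x) = - integral {0..1} (\<lambda>x. f x * G x)"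
    using integration_by_parts_periodic[OF G(1) bvD(1)[OF F]] G(2) bvD(2)[OF F] by (simp add: mult.commute)
  then have "cmod (integral {0..1} (\<lambda>x. g x * F x)) \<le> K * L1_norm f"
    using norm_integral_mult_le[OF antideriv_continuous[OF G(1)] bvD(6)[OF F] G(3)] by simp
  also have "\<dots> \<le> K * V" using K0 bvD(4)[OF F] by (rule mult_left_mono[rotated])
  finally show ?thesis .
qed

section \<open>The potential at a fixed frequency\<close>

text \<open>
The data attached to a frequency \<open>k\<close> that is a multiple of \<open>\<pi>\<close>: \<open>e = e\<^sup>-\<^sup>2\<^sup>i\<^sup>k\<^sup>x\<close>, \<open>E = e\<^sup>2\<^sup>i\<^sup>k\<^sup>x\<close> and
\<open>h = 1/(2ik)\<close>.  \<open>P\<close> is the primitive of the potential with mean zero, \<open>c\<close> and \<open>d\<close> are the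
means of \<open>q e\<close> and \<open>q E\<close>, and \<open>w\<close> and \<open>v\<close> are the mean-zero primitives of what is left of \<open>q e\<close>
and \<open>q E\<close>.  The normalisation of these primitives to mean zero matters: another choice
would leave commutator terms of second order.  Everything that tends to zero is bounded by \<open>\<delta>\<close>.

Conjugation is replaced by the pairs \<open>(e, E)\<close>, \<open>(w, v)\<close>, \<open>(c, d)\<close>, so that the whole
situation is invariant under \<open>k \<mapsto> -k\<close>; each estimate proved for one amplitude then gives the
one for the other.
\<close>
locale oscillation =
  fixes q P w v e E :: "real \<Rightarrow> complex" and h c d :: complex and L \<delta> :: real
  assumes q: "q absolutely_integrable_on {0..1}"
    and P: "antideriv P q" "P 1 = P 0" "integral {0..1} P = 0" "\<And>x. x \<in> {0..1} \<Longrightarrow> cmod (P x) \<le> 2 * L"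
    and e: "antideriv e (\<lambda>x. - e x / h)" "e 1 = e 0" "\<And>x. x \<in> {0..1} \<Longrightarrow> cmod (e x) = 1"
    and E: "antideriv E (\<lambda>x. E x / h)" "E 1 = E 0" "\<And>x. x \<in> {0..1} \<Longrightarrow> cmod (E x) = 1"
    and eE: "\<And>x. x \<in> {0..1} \<Longrightarrow> e x * E x = 1"
    and w: "antideriv w (\<lambda>x. q x * e x - c)" "w 1 = w 0" "integral {0..1} w = 0" "\<And>x. x \<in> {0..1} \<Longrightarrow> cmod (w x) \<le> \<delta>"
    and v: "antideriv v (\<lambda>x. q x * E x - d)" "v 1 = v 0" "integral {0..1} v = 0" "\<And>x. x \<in> {0..1} \<Longrightarrow> cmod (v x) \<le> \<delta>"
    and L: "1 \<le> L" "L1_norm q \<le> L"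
    and h: "h \<noteq> 0" "cmod h \<le> \<delta>" and cd: "cmod c \<le> \<delta>" "cmod d \<le> \<delta>" and \<delta>: "\<delta> \<le> 1"
begin

lemma dual: "oscillation q P v w E e (- h) d c L \<delta>"
proof (unfold_locales, goal_cases)
  case 6 show ?case using E(1) by simp
next
  case 9 show ?case using e(1) by simp
next
  case (12 x) then show ?case using eE[of x] by (simp add: mult.commute)
next
  case 23 show ?case using h by simp
next
  case 24 show ?case using h by simp
qed (fact q P e E v w L cd \<delta>)+

lemma \<delta>0: "0 < \<delta>" using h by (metis norm_le_zero_iff order_less_le_trans linorder_not_le)

lemma bvP: "periodic_bv P q (2 * L) L"
  using P L by (auto simp: periodic_bv_def)

lemma bvw: "periodic_bv w (\<lambda>x. q x * e x - c) \<delta> (2 * L)"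
  unfolding periodic_bv_def
proof (intro conjI ballI)
  have qe: "(\<lambda>x. q x * e x) absolutely_integrable_on {0..1}"
    using absint_mult[OF antideriv_continuous[OF e(1)] q] by (simp add: mult.commute)
  have "L1_norm (\<lambda>x. q x * e x - c) \<le> L1_norm (\<lambda>x. q x * e x) + L1_norm (\<lambda>x. - c)"
    using L1_add[OF qe, of "\<lambda>x. - c"] by simp
  also have "L1_norm (\<lambda>x. q x * e x) \<le> 1 * L1_norm q"
    using L1_mult[OF antideriv_continuous[OF e(1)] q, of 1] e(3) by (simp add: mult.commute)
  also have "L1_norm (\<lambda>x. - c) = cmod c" by (simp add: L1_norm_def)
  finally show "L1_norm (\<lambda>x. q x * e x - c) \<le> 2 * L"
    using L cd \<delta> by linarith
qed (use w in auto)

text \<open>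
Since \<open>e = - h e'\<close>, integrating against \<open>e\<close> gains a factor \<open>h\<close>.
\<close>
lemma int_e:
  assumes F: "periodic_bv F f M V"
  shows "cmod (integral {0..1} (\<lambda>x. e x * F x)) \<le> cmod h * V"
proof (rule bv_by_parts_bound[OF _ _ _ F])
  show "antideriv (\<lambda>x. - h * e x) e"
    using antideriv_cong[OF antideriv_cmult[OF e(1), of "- h"]] h(1) by simp
qed (use e in \<open>auto simp: norm_mult\<close>)

text \<open>
Here \<open>q e = c + w'\<close>, and \<open>w\<close> is small.
\<close>
lemma int_qe_eq:
  assumes F: "antideriv F f" "F 1 = F 0"
  shows "integral {0..1} (\<lambda>x. q x * e x * F x) = c * integral {0..1} F - integral {0..1} (\<lambda>x. w x * f x)"
proof -
  have i: "(\<lambda>x. q x * e x * F x) integrable_on {0..1}"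
    using intble_mult[OF antideriv_continuous[OF antideriv_mult[OF e(1) F(1)]] q] by (simp add: mult.assoc)
  have i2: "(\<lambda>x. c * F x) integrable_on {0..1}"
    by (intro integrable_on_mult_right integrable_continuous_real antideriv_continuous[OF F(1)])
  have "integral {0..1} (\<lambda>x. (q x * e x - c) * F x) = - integral {0..1} (\<lambda>x. w x * f x)"
    by (rule integration_by_parts_periodic[OF w(1) F(1)]) (use w F in auto)
  moreover have "integral {0..1} (\<lambda>x. (q x * e x - c) * F x) = integral {0..1} (\<lambda>x. q x * e x * F x) - c * integral {0..1} F"
    using Henstock_Kurzweil_Integration.integral_diff[OF i i2] by (simp add: algebra_simps)
  ultimately show ?thesis by (simp add: algebra_simps)
qed

lemma int_qe:
  assumes F: "periodic_bv F f M V"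
  shows "cmod (integral {0..1} (\<lambda>x. q x * e x * F x) - c * integral {0..1} F) \<le> \<delta> * V"
proof -
  have "cmod (integral {0..1} (\<lambda>x. q x * e x * F x) - c * integral {0..1} F) = cmod (integral {0..1} (\<lambda>x. f x * w x))"
    using int_qe_eq[OF bvD(1,2)[OF F]] by (simp add: mult.commute)
  also have "\<dots> \<le> \<delta> * L1_norm f"
    by (intro norm_integral_mult_le bvD(5)[OF bvw] bvD(6)[OF F] w(4))
  also have "\<dots> \<le> \<delta> * V" using bvD(4)[OF F] \<delta>0 by simp
  finally show ?thesis .
qed

text \<open>
The coefficient of the square of the mean-zero primitive.  It will be the second-order correction to
\<^term>\<open>c\<close> in the off-diagonal entry.
\<close>
definition "S = integral {0..1} (\<lambda>x. (P x)\<^sup>2 * e x)"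

text \<open>
The coefficient of the second-order diagonal entry.  It does not depend on the spectral parameter,
so it shifts both eigenvalues by the same amount and drops out of the gap length.
\<close>
definition "T = integral {0..1} (\<lambda>x. q x * E x * w x)"

lemma int_qeP: "2 * h * integral {0..1} (\<lambda>x. q x * e x * P x) = S"
proof -
  have a2: "antideriv (\<lambda>x. P x * P x) (\<lambda>x. q x * P x + P x * q x)" by (rule antideriv_mult[OF P(1) P(1)])
  have "integral {0..1} (\<lambda>x. (q x * P x + P x * q x) * e x) = - integral {0..1} (\<lambda>x. P x * P x * (- e x / h))"
    by (rule integration_by_parts_periodic[OF a2 e(1)]) (use P e in auto)
  moreover have "(\<lambda>x. (q x * P x + P x * q x) * e x) = (\<lambda>x. 2 * (q x * e x * P x))"
    by (auto simp: algebra_simps)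
  moreover have "(\<lambda>x. P x * P x * (- e x / h)) = (\<lambda>x. (-1 / h) * ((P x)\<^sup>2 * e x))"
    by (auto simp: algebra_simps power2_eq_square)
  ultimately have "2 * integral {0..1} (\<lambda>x. q x * e x * P x) = S / h"
    unfolding S_def by (simp only: Henstock_Kurzweil_Integration.integral_mult_right) (simp add: divide_inverse mult.commute)
  then show ?thesis using h by (simp add: field_simps)
qed

lemma int_qw: "integral {0..1} (\<lambda>x. q x * w x) = - integral {0..1} (\<lambda>x. q x * e x * P x)"
proof -
  have "integral {0..1} (\<lambda>x. q x * w x) = - integral {0..1} (\<lambda>x. P x * (q x * e x - c))"
    by (rule integration_by_parts_periodic[OF P(1) w(1)]) (use P w in auto)
  moreover have "integral {0..1} (\<lambda>x. (q x * e x) * P x - c * P x)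
      = integral {0..1} (\<lambda>x. (q x * e x) * P x) - c * integral {0..1} P"
  proof (subst Henstock_Kurzweil_Integration.integral_diff)
    show "(\<lambda>x. q x * e x * P x) integrable_on {0..1}"
      using intble_mult[OF antideriv_continuous[OF antideriv_mult[OF e(1) P(1)]] q] by (simp add: mult.assoc)
    show "(\<lambda>x. c * P x) integrable_on {0..1}"
      by (intro integrable_on_mult_right integrable_continuous_real antideriv_continuous[OF P(1)])
  qed simp
  ultimately show ?thesis by (simp add: P algebra_simps)
qed

text \<open>
\<open>T\<close> is the integral of \<open>w v'\<close>, its dual that of \<open>v w'\<close>, and the sum is the integral of the
derivative of a periodic function.
\<close>
lemma T_dual: "oscillation.T q v e = - T"
proof -
  have iqEw: "(\<lambda>x. q x * E x * w x) integrable_on {0..1}"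
    using intble_mult[OF antideriv_continuous[OF antideriv_mult[OF E(1) w(1)]] q] by (simp add: mult.assoc)
  have iqev: "(\<lambda>x. q x * e x * v x) integrable_on {0..1}"
    using intble_mult[OF antideriv_continuous[OF antideriv_mult[OF e(1) v(1)]] q] by (simp add: mult.assoc)
  have iw: "(\<lambda>x. d * w x) integrable_on {0..1}" and iv: "(\<lambda>x. c * v x) integrable_on {0..1}"
    by (intro integrable_on_mult_right integrable_continuous_real antideriv_continuous[OF w(1)] antideriv_continuous[OF v(1)])+
  have "integral {0..1} (\<lambda>x. (q x * e x - c) * v x) = - integral {0..1} (\<lambda>x. w x * (q x * E x - d))"
    by (rule integration_by_parts_periodic[OF w(1) v(1)]) (use w v in auto)
  moreover have "integral {0..1} (\<lambda>x. (q x * e x - c) * v x) = integral {0..1} (\<lambda>x. q x * e x * v x) - c * integral {0..1} v"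
    using Henstock_Kurzweil_Integration.integral_diff[OF iqev iv] by (simp add: algebra_simps)
  moreover have "integral {0..1} (\<lambda>x. w x * (q x * E x - d)) = integral {0..1} (\<lambda>x. q x * E x * w x) - d * integral {0..1} w"
    using Henstock_Kurzweil_Integration.integral_diff[OF iqEw iw] by (simp add: algebra_simps)
  ultimately show ?thesis
    using w v by (simp add: T_def oscillation.T_def[OF dual])
qed

end

section \<open>The averaged equations for the amplitudes\<close>

text \<open>
The equation \<open>-y'' + q y = (k\<^sup>2 + \<epsilon>) y\<close> for \<open>y = a e\<^sup>i\<^sup>k\<^sup>x + b e\<^sup>-\<^sup>i\<^sup>k\<^sup>x\<close> after variation of
constants.  Both the periodic and the antiperiodic boundary conditions turn into periodicity of the
amplitudes \<open>a\<close> and \<open>b\<close>.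
\<close>
locale oscillation_solution = oscillation +
  fixes a b :: "real \<Rightarrow> complex" and \<epsilon> N :: real
  assumes a: "antideriv a (\<lambda>x. h * (q x - \<epsilon>) * (a x + e x * b x))" "a 1 = a 0" "\<And>x. x \<in> {0..1} \<Longrightarrow> cmod (a x) \<le> N"
    and b: "antideriv b (\<lambda>x. - h * (q x - \<epsilon>) * (E x * a x + b x))" "b 1 = b 0" "\<And>x. x \<in> {0..1} \<Longrightarrow> cmod (b x) \<le> N"
begin

lemma dual_solution: "oscillation_solution q P v w E e (- h) d c L \<delta> b a \<epsilon> N"
proof -
  interpret D: oscillation q P v w E e "- h" d c L \<delta> by (rule dual)
  show ?thesis
    by unfold_locales (use a b in \<open>auto simp: add.commute\<close>)
qed

text \<open>
A bound for the variation of both amplitudes; it is of order \<open>h\<close>, so the amplitudes are nearly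
constant.
\<close>
definition "U = 2 * cmod h * (L + \<bar>\<epsilon>\<bar>) * N"

lemma N0: "0 \<le> N" using order_trans[OF norm_ge_zero a(3)[of 0]] by simp

lemma bva: "periodic_bv a (\<lambda>x. h * (q x - \<epsilon>) * (a x + e x * b x)) N U"
  unfolding periodic_bv_def
proof (intro conjI ballI)
  have qe: "(\<lambda>x. q x - \<epsilon>) absolutely_integrable_on {0..1}"
    using absint_add[OF q, of "\<lambda>x. - \<epsilon>"] by simp
  have cont: "continuous_on {0..1} (\<lambda>x. h * (a x + e x * b x))"
    by (intro continuous_intros antideriv_continuous[OF a(1)] antideriv_continuous[OF b(1)] antideriv_continuous[OF e(1)])
  have "L1_norm (\<lambda>x. q x - \<epsilon>) \<le> L1_norm q + L1_norm (\<lambda>x. - complex_of_real \<epsilon>)"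
    using L1_add[OF q, of "\<lambda>x. - \<epsilon>"] by simp
  also have "L1_norm (\<lambda>x. - complex_of_real \<epsilon>) = \<bar>\<epsilon>\<bar>" by (simp add: L1_norm_def)
  finally have qe1: "L1_norm (\<lambda>x. q x - \<epsilon>) \<le> L + \<bar>\<epsilon>\<bar>" using L by linarith
  have "L1_norm (\<lambda>x. h * (a x + e x * b x) * (q x - \<epsilon>)) \<le> (cmod h * (2 * N)) * L1_norm (\<lambda>x. q x - \<epsilon>)"
  proof (rule L1_mult[OF cont qe])
    fix x :: real assume x: "x \<in> {0..1}"
    have "cmod (a x + e x * b x) \<le> cmod (a x) + cmod (b x)"
      using norm_triangle_ineq[of "a x" "e x * b x"] e(3)[OF x] by (simp add: norm_mult)
    also have "\<dots> \<le> 2 * N" using a(3)[OF x] b(3)[OF x] by simp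
    finally show "cmod (h * (a x + e x * b x)) \<le> cmod h * (2 * N)"
      by (simp add: norm_mult mult_left_mono)
  qed
  also have "\<dots> \<le> (cmod h * (2 * N)) * (L + \<bar>\<epsilon>\<bar>)"
    using qe1 N0 by (intro mult_left_mono) auto
  also have "(\<lambda>x. h * (a x + e x * b x) * (q x - \<epsilon>)) = (\<lambda>x. h * (q x - \<epsilon>) * (a x + e x * b x))"
    by (auto simp: mult_ac)
  finally show "L1_norm (\<lambda>x. h * (q x - \<epsilon>) * (a x + e x * b x)) \<le> U"
    by (simp add: U_def mult_ac)
qed (use a in auto)

lemma bvb: "periodic_bv b (\<lambda>x. - h * (q x - \<epsilon>) * (E x * a x + b x)) N U"
  using oscillation_solution.bva[OF dual_solution]
  by (simp add: U_def oscillation_solution.U_def[OF dual_solution] add.commute)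

text \<open>
Integrating a multiple of \<open>a'\<close> and inserting the differential equation: each factor \<open>a'\<close> or
\<open>b'\<close> is traded for a factor \<open>h\<close>.
\<close>
lemma expand_a:
  assumes G: "antideriv G g"
  shows "integral {0..1} (\<lambda>x. G x * (h * (q x - \<epsilon>) * (a x + e x * b x))) =
    h * (integral {0..1} (\<lambda>x. q x * (G x * a x)) - \<epsilon> * integral {0..1} (\<lambda>x. G x * a x)
       + integral {0..1} (\<lambda>x. q x * e x * (G x * b x)) - \<epsilon> * integral {0..1} (\<lambda>x. e x * (G x * b x)))"
proof -
  note ca = antideriv_continuous[OF a(1)] and cb = antideriv_continuous[OF b(1)]
    and ce = antideriv_continuous[OF e(1)] and cG = antideriv_continuous[OF G]
  have i1: "(\<lambda>x. q x * (G x * a x)) integrable_on {0..1}"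
    by (intro intble_mult q continuous_intros ca cG)
  have i2: "(\<lambda>x. \<epsilon> * (G x * a x)) integrable_on {0..1}"
    by (intro integrable_continuous_real continuous_intros ca cG)
  have i3: "(\<lambda>x. q x * (e x * (G x * b x))) integrable_on {0..1}"
    by (intro intble_mult q continuous_intros cb ce cG)
  have i4: "(\<lambda>x. \<epsilon> * (e x * (G x * b x))) integrable_on {0..1}"
    by (intro integrable_continuous_real continuous_intros cb ce cG)
  have "integral {0..1} (\<lambda>x. G x * (h * (q x - \<epsilon>) * (a x + e x * b x))) =
     integral {0..1} (\<lambda>x. h * (((q x * (G x * a x)) - \<epsilon> * (G x * a x)) + ((q x * (e x * (G x * b x))) - \<epsilon> * (e x * (G x * b x)))))"
    by (intro arg_cong2[where f=integral] refl ext) (simp add: algebra_simps)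
  also have "\<dots> = h * ((integral {0..1} (\<lambda>x. q x * (G x * a x)) - integral {0..1} (\<lambda>x. \<epsilon> * (G x * a x)))
      + (integral {0..1} (\<lambda>x. q x * (e x * (G x * b x))) - integral {0..1} (\<lambda>x. \<epsilon> * (e x * (G x * b x)))))"
    by (simp only: Henstock_Kurzweil_Integration.integral_mult_right
        Henstock_Kurzweil_Integration.integral_add[OF Henstock_Kurzweil_Integration.integrable_diff[OF i1 i2] Henstock_Kurzweil_Integration.integrable_diff[OF i3 i4]]
        Henstock_Kurzweil_Integration.integral_diff[OF i1 i2] Henstock_Kurzweil_Integration.integral_diff[OF i3 i4])
  finally show ?thesis by (simp add: mult.assoc)
qed

lemma expand_b:
  assumes G: "antideriv G g"
  shows "integral {0..1} (\<lambda>x. G x * (- h * (q x - \<epsilon>) * (E x * a x + b x))) =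
    - h * (integral {0..1} (\<lambda>x. q x * (G x * b x)) - \<epsilon> * integral {0..1} (\<lambda>x. G x * b x)
       + integral {0..1} (\<lambda>x. q x * E x * (G x * a x)) - \<epsilon> * integral {0..1} (\<lambda>x. E x * (G x * a x)))"
  using oscillation_solution.expand_a[OF dual_solution G] by (simp add: add.commute)

abbreviation "A \<equiv> integral {0..1} a"
abbreviation "B \<equiv> integral {0..1} b"

lemma collect_first_order:
  fixes x y z X Y a' b' :: complex
  assumes "x - a' + y - z = 0" "x = - X" "y = b' - Y"
  shows "a' - b' = - X - Y - z"
  using assms by algebra

text \<open>
The solvability condition \<open>\<integral> a' = 0\<close> of the periodic problem, with all oscillating terms
integrated by parts once.
\<close>
lemma first_order:
  "\<epsilon> * A - c * B = - integral {0..1} (\<lambda>x. P x * (h * (q x - \<epsilon>) * (a x + e x * b x)))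
      - integral {0..1} (\<lambda>x. w x * (- h * (q x - \<epsilon>) * (E x * a x + b x)))
      - \<epsilon> * integral {0..1} (\<lambda>x. e x * b x)"
  (is "_ = - ?X - ?Y - _")
proof -
  have "integral {0..1} (\<lambda>x. 1 * (h * (q x - \<epsilon>) * (a x + e x * b x))) = 0"
    using antideriv_integral[OF a(1)] a(2) by simp
  then have "integral {0..1} (\<lambda>x. q x * a x) - \<epsilon> * A + integral {0..1} (\<lambda>x. q x * e x * b x) - \<epsilon> * integral {0..1} (\<lambda>x. e x * b x) = 0"
    using expand_a[OF antideriv_const, of 1] h(1) by simp
  moreover have "integral {0..1} (\<lambda>x. q x * a x) = - integral {0..1} (\<lambda>x. P x * (h * (q x - \<epsilon>) * (a x + e x * b x)))"
    by (rule integration_by_parts_periodic[OF P(1) a(1)]) (use P a in auto)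
  moreover note int_qe_eq[OF b(1,2)]
  ultimately show ?thesis by (rule collect_first_order)
qed

lemma A_close: "x \<in> {0..1} \<Longrightarrow> cmod (a x - A) \<le> U"
  by (rule bvD(3)[OF bv_minus_mean[OF bva]])

lemma first_order_bound: "cmod (\<epsilon> * A - c * B) \<le> (2 * L + \<delta> + \<bar>\<epsilon>\<bar> * cmod h) * U"
proof -
  have 1: "cmod (integral {0..1} (\<lambda>x. P x * (h * (q x - \<epsilon>) * (a x + e x * b x)))) \<le> 2 * L * U"
    using order_trans[OF norm_integral_mult_le[OF bvD(5)[OF bvP] bvD(6)[OF bva] P(4)] mult_left_mono[OF bvD(4)[OF bva]]] L
    by (simp add: mult.commute)
  have 2: "cmod (integral {0..1} (\<lambda>x. w x * (- h * (q x - \<epsilon>) * (E x * a x + b x)))) \<le> \<delta> * U"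
    using order_trans[OF norm_integral_mult_le[OF bvD(5)[OF bvw] bvD(6)[OF bvb] w(4)] mult_left_mono[OF bvD(4)[OF bvb]]] \<delta>0
    by (simp add: mult.commute)
  have 3: "cmod (\<epsilon> * integral {0..1} (\<lambda>x. e x * b x)) \<le> \<bar>\<epsilon>\<bar> * (cmod h * U)"
    using int_e[OF bvb] by (simp add: norm_mult mult_left_mono)
  have "cmod (\<epsilon> * A - c * B) \<le> 2 * L * U + \<delta> * U + \<bar>\<epsilon>\<bar> * (cmod h * U)"
    unfolding first_order using 1 2 3
    by (intro order_trans[OF norm_triangle_ineq4] add_mono) (auto intro!: order_trans[OF norm_triangle_ineq4] add_mono)
  then show ?thesis by (simp add: algebra_simps)
qed

end

lemma collect_second_order:
  fixes h \<epsilon> A B S T X :: complex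
  assumes "\<epsilon> * A - c * B = - h * (Z2 - Z3 + Z4 - Z5) - (- h * (Z8 - Z9 + Z6 - Z7)) - t1"
    and "2 * h * X = S"
  shows "\<epsilon> * A - c * B + S * B - h * T * A
      = h * (- Z2 + Z3 - (Z4 - B * X) + Z5 + (Z8 + B * X) - Z9 + (Z6 - A * T) - Z7) - t1"
  using assms by algebra

lemma norm_sum8_le:
  fixes z1 z2 z3 z4 z5 z6 z7 z8 :: complex
  shows "cmod (- z1 + z2 - z3 + z4 + z5 - z6 + z7 - z8) \<le> cmod z1 + cmod z2 + cmod z3 + cmod z4 + cmod z5 + cmod z6 + cmod z7 + cmod z8"
  by (intro order_trans[OF norm_triangle_ineq4] order_trans[OF norm_triangle_ineq] add_mono order_refl) auto

context oscillation_solution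
begin

lemma B_close: "x \<in> {0..1} \<Longrightarrow> cmod (b x - B) \<le> U"
  by (rule bvD(3)[OF bv_minus_mean[OF bvb]])

lemma U0: "0 \<le> U" by (rule bvD(8)[OF bva])

lemma U_le: assumes "\<bar>\<epsilon>\<bar> \<le> \<delta>" shows "U \<le> 4 * cmod h * L * N" "U \<le> 4 * \<delta> * L * N" "U \<le> 4 * L * N"
proof -
  have "L + \<bar>\<epsilon>\<bar> \<le> 2 * L" using assms \<delta> L by linarith
  then have "2 * cmod h * N * (L + \<bar>\<epsilon>\<bar>) \<le> 2 * cmod h * N * (2 * L)"
    using N0 by (intro mult_left_mono) auto
  then show 1: "U \<le> 4 * cmod h * L * N" by (simp add: U_def algebra_simps)
  have "cmod h * (L * N) \<le> \<delta> * (L * N)" using h L N0 by (intro mult_right_mono) auto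
  with 1 show 2: "U \<le> 4 * \<delta> * L * N" by simp
  have "\<delta> * (L * N) \<le> 1 * (L * N)" using \<delta> L N0 by (intro mult_right_mono) auto
  with 2 show "U \<le> 4 * L * N" by simp
qed

text \<open>
An amplitude differs from its mean by at most \<open>U\<close>, so in a term that already contains a small factor
replacing it by its mean costs another factor \<open>U\<close>.
\<close>
lemma int_minus_mean:
  assumes "continuous_on {0..1} G" "g absolutely_integrable_on {0..1}"
  shows "integral {0..1} (\<lambda>x. g x * (G x * (b x - B))) = integral {0..1} (\<lambda>x. g x * (G x * b x)) - B * integral {0..1} (\<lambda>x. g x * G x)"
proof -
  have i: "(\<lambda>x. g x * (G x * b x)) integrable_on {0..1}"
    by (intro intble_mult assms continuous_intros antideriv_continuous[OF b(1)])
  have j: "(\<lambda>x. B * (g x * G x)) integrable_on {0..1}"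
    by (intro integrable_on_mult_right intble_mult assms)
  have "(\<lambda>x. g x * (G x * (b x - B))) = (\<lambda>x. g x * (G x * b x) - B * (g x * G x))"
    by (auto simp: algebra_simps)
  then show ?thesis
    by (simp only: Henstock_Kurzweil_Integration.integral_diff[OF i j] Henstock_Kurzweil_Integration.integral_mult_right)
qed

lemma int_Pb: "cmod (integral {0..1} (\<lambda>x. P x * b x)) \<le> 2 * L * U"
proof -
  have "integral {0..1} (\<lambda>x. P x * b x) = integral {0..1} (\<lambda>x. P x * (b x - B))"
    using int_minus_mean[OF continuous_on_const absolutely_integrable_continuous_real[OF antideriv_continuous[OF P(1)]], of 1] P(3)
    by simp
  also have "cmod \<dots> \<le> 2 * L * U"
    by (intro norm_integral_le_sup continuous_intros antideriv_continuous[OF b(1)] antideriv_continuous[OF P(1)])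
       (use P(4) B_close L in \<open>auto simp: norm_mult intro!: mult_mono\<close>)
  finally show ?thesis .
qed

lemma int_wb: "cmod (integral {0..1} (\<lambda>x. w x * b x)) \<le> \<delta> * U"
proof -
  have "integral {0..1} (\<lambda>x. w x * b x) = integral {0..1} (\<lambda>x. w x * (b x - B))"
    using int_minus_mean[OF continuous_on_const absolutely_integrable_continuous_real[OF antideriv_continuous[OF w(1)]], of 1] w(3)
    by simp
  also have "cmod \<dots> \<le> \<delta> * U"
    by (intro norm_integral_le_sup continuous_intros antideriv_continuous[OF b(1)] antideriv_continuous[OF w(1)])
       (use w(4) B_close \<delta>0 in \<open>auto simp: norm_mult intro!: mult_mono\<close>)
  finally show ?thesis .
qed

lemma int_qeP_b: "cmod (integral {0..1} (\<lambda>x. q x * e x * (P x * b x)) - B * integral {0..1} (\<lambda>x. q x * e x * P x)) \<le> 5 * \<delta> * L * U"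
proof -
  have qe: "(\<lambda>x. q x * e x) absolutely_integrable_on {0..1}"
    using absint_mult[OF antideriv_continuous[OF e(1)] q] by (simp add: mult.commute)
  note F = bv_mult[OF bvP bv_minus_mean[OF bvb]]
  have "cmod (c * integral {0..1} (\<lambda>x. P x * (b x - B))) \<le> \<delta> * (2 * L * U)"
    unfolding norm_mult
    by (intro mult_mono cd norm_integral_le_sup bvD(3)[OF F] bvD(5)[OF F]) (use \<delta>0 in auto)
  moreover have "cmod (integral {0..1} (\<lambda>x. q x * e x * (P x * (b x - B))) - c * integral {0..1} (\<lambda>x. P x * (b x - B))) \<le> \<delta> * (L * U + 2 * L * U)"
    by (rule int_qe[OF F])
  ultimately have "cmod (integral {0..1} (\<lambda>x. q x * e x * (P x * (b x - B)))) \<le> \<delta> * (L * U + 2 * L * U) + \<delta> * (2 * L * U)"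
    by (smt (verit) norm_triangle_sub)
  then show ?thesis
    unfolding int_minus_mean[OF antideriv_continuous[OF P(1)] qe] by (simp add: algebra_simps)
qed

lemma int_qw_b: "cmod (integral {0..1} (\<lambda>x. q x * (w x * b x)) + B * integral {0..1} (\<lambda>x. q x * e x * P x)) \<le> \<delta> * L * U"
proof -
  have "cmod (integral {0..1} (\<lambda>x. q x * (w x * (b x - B)))) \<le> (\<delta> * U) * L1_norm q"
    by (intro norm_integral_mult_le q continuous_intros antideriv_continuous[OF b(1)] antideriv_continuous[OF w(1)])
       (use w(4) B_close \<delta>0 in \<open>auto simp: norm_mult intro!: mult_mono\<close>)
  also have "\<dots> \<le> (\<delta> * U) * L"
    using L U0 \<delta>0 by (intro mult_left_mono) auto
  finally show ?thesis
    using int_minus_mean[OF antideriv_continuous[OF w(1)] q] int_qw by (simp add: mult_ac)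
qed

lemma int_qev_b: "cmod (integral {0..1} (\<lambda>x. q x * e x * (v x * b x)) - B * integral {0..1} (\<lambda>x. q x * e x * v x)) \<le> \<delta> * L * U"
proof -
  have qe: "(\<lambda>x. q x * e x) absolutely_integrable_on {0..1}"
    using absint_mult[OF antideriv_continuous[OF e(1)] q] by (simp add: mult.commute)
  have "cmod (integral {0..1} (\<lambda>x. q x * (e x * (v x * (b x - B))))) \<le> (\<delta> * U) * L1_norm q"
    by (intro norm_integral_mult_le q continuous_intros antideriv_continuous[OF b(1)] antideriv_continuous[OF v(1)] antideriv_continuous[OF e(1)])
       (use v(4) B_close \<delta>0 e(3) in \<open>auto simp: norm_mult intro!: mult_mono\<close>)
  also have "\<dots> \<le> (\<delta> * U) * L"
    using L U0 \<delta>0 by (intro mult_left_mono) auto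
  finally show ?thesis
    using int_minus_mean[OF antideriv_continuous[OF v(1)] qe] by (simp add: mult_ac)
qed

text \<open>
Here \<open>2 q P = (P\<^sup>2)'\<close> has no oscillating factor and no small factor, so a further integration by
parts, a further use of the differential equation, and a look at each of the four resulting terms
are necessary.
\<close>
lemma int_qPa:
  assumes \<epsilon>: "\<bar>\<epsilon>\<bar> \<le> \<delta>"
  shows "cmod (integral {0..1} (\<lambda>x. q x * (P x * a x))) \<le> 22 * (\<delta> * cmod h * L ^ 4 * N)"
proof -
  define Y1 where "Y1 = integral {0..1} (\<lambda>x. q x * ((P x * P x) * a x))"
  define Y2 where "Y2 = \<epsilon> * integral {0..1} (\<lambda>x. (P x * P x) * a x)"
  define Y3 where "Y3 = integral {0..1} (\<lambda>x. q x * e x * ((P x * P x) * b x))"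
  define Y4 where "Y4 = \<epsilon> * integral {0..1} (\<lambda>x. e x * ((P x * P x) * b x))"
  define W where "W = \<delta> * L ^ 4 * N"
  have W: "\<delta> * L ^ k * N \<le> W" if "k \<le> 4" for k
    unfolding W_def using that L \<delta>0 N0 by (intro mult_right_mono mult_left_mono power_increasing) auto
  note PP = bv_mult[OF bvP bvP]
  note PPP = bv_mult[OF PP bvP]
  have 1: "cmod Y1 \<le> 12 * W"
  proof -
    \<comment> \<open>No oscillating factor here: the smallness comes from \<open>3 P\<^sup>2 q = (P\<^sup>3)'\<close>, which moves the
       derivative onto the slowly varying \<^term>\<open>a\<close>.\<close>
    have "integral {0..1} (\<lambda>x. ((q x * P x + P x * q x) * P x + (P x * P x) * q x) * a x)
       = - integral {0..1} (\<lambda>x. (P x * P x * P x) * (h * (q x - \<epsilon>) * (a x + e x * b x)))"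
      by (rule integration_by_parts_periodic[OF bvD(1)[OF PPP] a(1)]) (use P a in auto)
    moreover have "(\<lambda>x. ((q x * P x + P x * q x) * P x + (P x * P x) * q x) * a x) = (\<lambda>x. 3 * (q x * ((P x * P x) * a x)))"
      by (auto simp: algebra_simps)
    ultimately have "3 * Y1 = - integral {0..1} (\<lambda>x. (h * (q x - \<epsilon>) * (a x + e x * b x)) * (P x * P x * P x))"
      by (simp add: Y1_def mult.commute)
    then have "cmod (3 * Y1) \<le> (2 * L * (2 * L) * (2 * L)) * L1_norm (\<lambda>x. h * (q x - \<epsilon>) * (a x + e x * b x))"
      using norm_integral_mult_le[OF bvD(5)[OF PPP] bvD(6)[OF bva] bvD(3)[OF PPP]] by simp
    also have "\<dots> \<le> (2 * L * (2 * L) * (2 * L)) * (4 * \<delta> * L * N)"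
      using bvD(4)[OF bva] U_le(2)[OF \<epsilon>] L by (intro mult_left_mono) auto
    also have "\<dots> = 32 * W" by (simp add: W_def power4_eq_xxxx)
    finally have "3 * cmod Y1 \<le> 32 * W" by (simp add: norm_mult)
    then show ?thesis using W[of 0] W[of 4] norm_ge_zero[of Y1] by linarith
  qed
  have 2: "cmod Y2 \<le> 4 * W"
  proof -
    note F = bv_mult[OF PP bva]
    have "cmod Y2 \<le> \<delta> * (2 * L * (2 * L) * N)"
      unfolding Y2_def norm_mult
      by (intro mult_mono norm_integral_le_sup bvD(3)[OF F] bvD(5)[OF F]) (use \<delta>0 \<epsilon> in auto)
    also have "\<dots> = 4 * (\<delta> * L ^ 2 * N)" by (simp add: power2_eq_square)
    finally show ?thesis using W[of 2] by linarith
  qed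
  have 4: "cmod Y4 \<le> 4 * W"
  proof -
    note F = bv_mult[OF PP bvb]
    have "cmod Y4 \<le> \<delta> * (2 * L * (2 * L) * N)"
      unfolding Y4_def norm_mult
      by (intro mult_mono norm_integral_le_sup continuous_intros bvD(5)[OF F] bvD(5)[OF bvP] antideriv_continuous[OF e(1)] bvD(5)[OF bvb])
         (use \<delta>0 \<epsilon> bvD(3)[OF F] e(3) in \<open>auto simp: norm_mult\<close>)
    also have "\<dots> = 4 * (\<delta> * L ^ 2 * N)" by (simp add: power2_eq_square)
    finally show ?thesis using W[of 2] by linarith
  qed
  have 3: "cmod Y3 \<le> 24 * W"
  proof -
    note F = bv_mult[OF PP bvb]
    have "cmod (c * integral {0..1} (\<lambda>x. P x * P x * b x)) \<le> \<delta> * (2 * L * (2 * L) * N)"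
      unfolding norm_mult
      by (intro mult_mono cd norm_integral_le_sup bvD(3)[OF F] bvD(5)[OF F]) (use \<delta>0 in auto)
    moreover have "cmod (Y3 - c * integral {0..1} (\<lambda>x. P x * P x * b x)) \<le> \<delta> * ((L * (2 * L) + 2 * L * L) * N + 2 * L * (2 * L) * U)"
      unfolding Y3_def by (rule int_qe[OF F])
    moreover have "\<delta> * (2 * L * (2 * L) * U) \<le> \<delta> * (2 * L * (2 * L) * (4 * L * N))"
      using L \<delta>0 U_le(3)[OF \<epsilon>] by (intro mult_left_mono) auto
    ultimately have "cmod Y3 \<le> 8 * (\<delta> * L ^ 2 * N) + 16 * (\<delta> * L ^ 3 * N)"
      using norm_triangle_sub[of Y3 "c * integral {0..1} (\<lambda>x. P x * P x * b x)"]
      by (simp add: power2_eq_square power3_eq_cube algebra_simps)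
    then show ?thesis using W[of 2] W[of 3] by linarith
  qed
  have "integral {0..1} (\<lambda>x. (q x * P x + P x * q x) * a x)
     = - integral {0..1} (\<lambda>x. (P x * P x) * (h * (q x - \<epsilon>) * (a x + e x * b x)))"
    by (rule integration_by_parts_periodic[OF bvD(1)[OF PP] a(1)]) (use P a in auto)
  also have "integral {0..1} (\<lambda>x. (P x * P x) * (h * (q x - \<epsilon>) * (a x + e x * b x))) = h * (Y1 - Y2 + Y3 - Y4)"
    unfolding Y1_def Y2_def Y3_def Y4_def by (rule expand_a[OF bvD(1)[OF PP]])
  also have "(\<lambda>x. (q x * P x + P x * q x) * a x) = (\<lambda>x. 2 * (q x * (P x * a x)))"
    by (auto simp: algebra_simps)
  finally have "2 * cmod (integral {0..1} (\<lambda>x. q x * (P x * a x))) = cmod h * cmod (Y1 - Y2 + Y3 - Y4)"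
  proof -
    assume "integral {0..1} (\<lambda>x. 2 * (q x * (P x * a x))) = - (h * (Y1 - Y2 + Y3 - Y4))"
    then have "cmod (2 * integral {0..1} (\<lambda>x. q x * (P x * a x))) = cmod (h * (Y1 - Y2 + Y3 - Y4))"
      by (simp only: Henstock_Kurzweil_Integration.integral_mult_right norm_minus_cancel)
    then show ?thesis by (simp only: norm_mult norm_numeral)
  qed
  also have "\<dots> \<le> cmod h * (44 * W)"
    using 1 2 3 4 norm_triangle_ineq4[of "Y1 - Y2 + Y3" Y4] norm_triangle_ineq[of "Y1 - Y2" Y3] norm_triangle_ineq4[of Y1 Y2]
    by (intro mult_left_mono) auto
  finally show ?thesis by (simp add: W_def algebra_simps)
qed

text \<open>
The heart of the proof: the means \<open>A\<close>, \<open>B\<close> of the amplitudes satisfy an algebraic equation up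
to an error of order \<open>\<delta> h\<^sup>2\<close>.  Together with its dual it says that \<open>(A, B)\<close> is almost an
eigenvector, for \<open>\<epsilon> - h T\<close>, of the matrix with zero diagonal and off-diagonal entries
\<open>c - S\<close> and its conjugate.
\<close>
theorem second_order:
  assumes \<epsilon>: "\<bar>\<epsilon>\<bar> \<le> \<delta>"
  shows "cmod (\<epsilon> * A - c * B + S * B - h * T * A) \<le> 81 * \<delta> * (cmod h)\<^sup>2 * L ^ 4 * N"
proof -
  interpret D: oscillation_solution q P v w E e "- h" d c L \<delta> b a \<epsilon> N by (rule dual_solution)
  have DU: "D.U = U" by (simp add: U_def D.U_def)
  define Z2 where "Z2 = integral {0..1} (\<lambda>x. q x * (P x * a x))"
  define Z3 where "Z3 = \<epsilon> * integral {0..1} (\<lambda>x. P x * a x)"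
  define Z4 where "Z4 = integral {0..1} (\<lambda>x. q x * e x * (P x * b x))"
  define Z5 where "Z5 = \<epsilon> * integral {0..1} (\<lambda>x. e x * (P x * b x))"
  define Z6 where "Z6 = integral {0..1} (\<lambda>x. q x * E x * (w x * a x))"
  define Z7 where "Z7 = \<epsilon> * integral {0..1} (\<lambda>x. E x * (w x * a x))"
  define Z8 where "Z8 = integral {0..1} (\<lambda>x. q x * (w x * b x))"
  define Z9 where "Z9 = \<epsilon> * integral {0..1} (\<lambda>x. w x * b x)"
  define t1 where "t1 = \<epsilon> * integral {0..1} (\<lambda>x. e x * b x)"
  define X where "X = integral {0..1} (\<lambda>x. q x * e x * P x)"
  define W where "W = \<delta> * cmod h * L ^ 4 * N"
  have W: "\<delta> * cmod h * L ^ k * N \<le> W" if "k \<le> 4" for k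
    unfolding W_def using that L \<delta>0 N0 by (intro mult_right_mono mult_left_mono power_increasing) auto
  have W0: "0 \<le> W" unfolding W_def using L \<delta>0 N0 by auto
  \<comment> \<open>The main parts of \<^term>\<open>Z4\<close>, \<^term>\<open>Z6\<close> and \<^term>\<open>Z8\<close> are extracted; they make up
     \<^term>\<open>S\<close> and \<^term>\<open>T\<close>, and each remaining summand is estimated separately.\<close>
  have eq: "\<epsilon> * A - c * B + S * B - h * T * A
      = h * (- Z2 + Z3 - (Z4 - B * X) + Z5 + (Z8 + B * X) - Z9 + (Z6 - A * T) - Z7) - t1"
  proof (rule collect_second_order)
    show "2 * h * X = S" unfolding X_def by (rule int_qeP)
    show "\<epsilon> * A - c * B = - h * (Z2 - Z3 + Z4 - Z5) - (- h * (Z8 - Z9 + Z6 - Z7)) - t1"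
      using first_order expand_a[OF P(1)] expand_b[OF w(1)]
      unfolding Z2_def Z3_def Z4_def Z5_def Z6_def Z7_def Z8_def Z9_def t1_def by simp
  qed
  have \<delta>U: "k * (\<delta> * L ^ j * U) \<le> 4 * k * W" if "0 \<le> k" "j \<le> 3" for k :: real and j
  proof -
    have "k * (\<delta> * L ^ j * U) \<le> k * (\<delta> * L ^ j * (4 * cmod h * L * N))"
      using that \<delta>0 L U_le(1)[OF \<epsilon>] by (intro mult_left_mono) auto
    also have "\<dots> = 4 * k * (\<delta> * cmod h * L ^ Suc j * N)" by (simp add: mult_ac)
    also have "\<dots> \<le> 4 * k * W" using that W[of "Suc j"] by (intro mult_left_mono) auto
    finally show ?thesis .
  qed
  have 2: "cmod Z2 \<le> 22 * W" unfolding Z2_def W_def by (rule int_qPa[OF \<epsilon>])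
  have 3: "cmod Z3 \<le> 8 * W"
  proof -
    have "cmod Z3 \<le> \<delta> * (2 * L * U)"
      unfolding Z3_def norm_mult using D.int_Pb \<epsilon> \<delta>0 by (intro mult_mono) (auto simp: DU)
    then show ?thesis using \<delta>U[of 2 1] by (simp add: mult_ac)
  qed
  have 4: "cmod (Z4 - B * X) \<le> 20 * W"
    using int_qeP_b \<delta>U[of 5 1] unfolding Z4_def X_def by (simp add: mult_ac)
  have 5: "cmod Z5 \<le> 9 * W"
  proof -
    have "cmod Z5 \<le> \<delta> * (cmod h * (L * N + 2 * L * U))"
      unfolding Z5_def norm_mult using int_e[OF bv_mult[OF bvP bvb]] \<epsilon> \<delta>0 by (intro mult_mono) auto
    also have "\<dots> \<le> \<delta> * (cmod h * (L * N + 2 * L * (4 * L * N)))"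
      using \<delta>0 L U_le(3)[OF \<epsilon>] by (intro mult_left_mono add_left_mono) auto
    also have "\<dots> = \<delta> * cmod h * L ^ 1 * N + 8 * (\<delta> * cmod h * L ^ 2 * N)"
      by (simp add: algebra_simps power2_eq_square)
    finally show ?thesis using W[of 1] W[of 2] by simp
  qed
  have 6: "cmod (Z6 - A * T) \<le> 4 * W"
    using D.int_qev_b \<delta>U[of 1 1] unfolding Z6_def T_def DU by (simp add: mult_ac)
  have 7: "cmod Z7 \<le> 6 * W"
  proof -
    have "cmod Z7 \<le> \<delta> * (cmod h * (2 * L * N + \<delta> * U))"
      unfolding Z7_def norm_mult using D.int_e[OF bv_mult[OF bvw bva]] \<epsilon> \<delta>0 by (intro mult_mono) auto
    also have "\<dots> \<le> \<delta> * (cmod h * (2 * L * N + 1 * (4 * L * N)))"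
      using \<delta>0 \<delta> L U_le(3)[OF \<epsilon>] U0 by (intro mult_left_mono add_left_mono mult_mono) auto
    also have "\<dots> = 6 * (\<delta> * cmod h * L ^ 1 * N)" by (simp add: algebra_simps)
    finally show ?thesis using W[of 1] by simp
  qed
  have 8: "cmod (Z8 + B * X) \<le> 4 * W"
    using int_qw_b \<delta>U[of 1 1] unfolding Z8_def X_def by (simp add: mult_ac)
  have 9: "cmod Z9 \<le> 4 * W"
  proof -
    have "cmod Z9 \<le> \<delta> * (\<delta> * U)"
      unfolding Z9_def norm_mult using int_wb \<epsilon> \<delta>0 by (intro mult_mono) auto
    also have "\<dots> \<le> \<delta> * (1 * U)"
      using \<delta>0 \<delta> U0 by (intro mult_left_mono mult_right_mono) auto
    finally show ?thesis using \<delta>U[of 1 0] by simp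
  qed
  have 1: "cmod t1 \<le> cmod h * (4 * W)"
  proof -
    have "cmod t1 \<le> \<delta> * (cmod h * U)"
      unfolding t1_def norm_mult using int_e[OF bvb] \<epsilon> \<delta>0 by (intro mult_mono) auto
    also have "\<dots> = cmod h * (1 * (\<delta> * L ^ 0 * U))" by simp
    also have "\<dots> \<le> cmod h * (4 * 1 * W)" using \<delta>U[of 1 0] by (intro mult_left_mono) auto
    finally show ?thesis by simp
  qed
  have "cmod (- Z2 + Z3 - (Z4 - B * X) + Z5 + (Z8 + B * X) - Z9 + (Z6 - A * T) - Z7) \<le> 77 * W"
    using norm_sum8_le[of Z2 Z3 "Z4 - B * X" Z5 "Z8 + B * X" Z9 "Z6 - A * T" Z7] 2 3 4 5 6 7 8 9 by linarith
  then have "cmod (h * (- Z2 + Z3 - (Z4 - B * X) + Z5 + (Z8 + B * X) - Z9 + (Z6 - A * T) - Z7)) \<le> cmod h * (77 * W)"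
    unfolding norm_mult by (intro mult_left_mono) auto
  then have "cmod (\<epsilon> * A - c * B + S * B - h * T * A) \<le> cmod h * (77 * W) + cmod h * (4 * W)"
    unfolding eq using 1 by (intro order_trans[OF norm_triangle_ineq4] add_mono)
  then show ?thesis by (simp add: W_def power2_eq_square mult_ac)
qed

end

section \<open>Splitting of a two-level system\<close>

text \<open>
The Hermitian matrix with zero diagonal and off-diagonal entry \<open>D\<close> has the eigenvalues \<open>\<plusminus>|D|\<close>.
If \<open>x\<close> is the modulus of the larger component of the vector and \<open>y\<close> that of the smaller one, then the two
rows bound \<open>|t| x\<close> by \<open>|D| y\<close> and \<open>|D| x\<close> by \<open>|t| y\<close> up to the error, and \<open>y\<close> may be
replaced by \<open>x\<close>.
\<close>
lemma two_level_eigenvalue: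
  fixes A B D :: complex and t \<rho> :: real
  assumes "1 / 2 \<le> cmod A + cmod B"
    and 1: "cmod (t * A - D * B) \<le> \<rho>" and 2: "cmod (t * B - cnj D * A) \<le> \<rho>"
  shows "\<bar>\<bar>t\<bar> - cmod D\<bar> \<le> 4 * \<rho>"
proof -
  have a1: "\<bar>t\<bar> * cmod A \<le> cmod D * cmod B + \<rho>" and a2: "cmod D * cmod B \<le> \<bar>t\<bar> * cmod A + \<rho>"
    using 1 norm_triangle_sub[of "t * A" "D * B"] norm_triangle_sub[of "D * B" "t * A"]
    by (auto simp: norm_mult norm_minus_commute)
  have b1: "\<bar>t\<bar> * cmod B \<le> cmod D * cmod A + \<rho>" and b2: "cmod D * cmod A \<le> \<bar>t\<bar> * cmod B + \<rho>"
    using 2 norm_triangle_sub[of "t * B" "cnj D * A"] norm_triangle_sub[of "cnj D * A" "t * B"]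
    by (auto simp: norm_mult norm_minus_commute)
  have *: "\<bar>\<bar>t\<bar> - cmod D\<bar> \<le> 4 * \<rho>"
    if "x \<ge> 1/4" "y \<le> x" "\<bar>t\<bar> * x \<le> cmod D * y + \<rho>" "cmod D * x \<le> \<bar>t\<bar> * y + \<rho>" for x y :: real
  proof -
    have "cmod D * y \<le> cmod D * x" "\<bar>t\<bar> * y \<le> \<bar>t\<bar> * x"
      using that by (auto intro: mult_left_mono)
    then have "\<bar>\<bar>t\<bar> - cmod D\<bar> * x \<le> \<rho>"
      using that by (auto simp: abs_if algebra_simps)
    moreover have "z * (1/4) \<le> z * x" if "0 \<le> z" for z
      using that \<open>x \<ge> 1/4\<close> by (intro mult_left_mono) auto
    ultimately have "\<bar>\<bar>t\<bar> - cmod D\<bar> * (1/4) \<le> \<rho>" by (meson abs_ge_zero order_trans)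
    then show ?thesis by simp
  qed
  show ?thesis
  proof (cases "cmod B \<le> cmod A")
    case True
    then show ?thesis using assms(1) a1 b2 by (intro *[of "cmod A" "cmod B"]) auto
  next
    case False
    then show ?thesis using assms(1) b1 a2 by (intro *[of "cmod B" "cmod A"]) auto
  qed
qed

lemma lagrange_identity:
  fixes A1 B1 A2 B2 :: complex
  shows "(cmod (A1 * cnj A2 + B1 * cnj B2))\<^sup>2 + (cmod (A1 * B2 - A2 * B1))\<^sup>2
      = ((cmod A1)\<^sup>2 + (cmod B1)\<^sup>2) * ((cmod A2)\<^sup>2 + (cmod B2)\<^sup>2)"
proof -
  have "complex_of_real ((cmod (A1 * cnj A2 + B1 * cnj B2))\<^sup>2 + (cmod (A1 * B2 - A2 * B1))\<^sup>2)
      = of_real (((cmod A1)\<^sup>2 + (cmod B1)\<^sup>2) * ((cmod A2)\<^sup>2 + (cmod B2)\<^sup>2))"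
    unfolding of_real_add of_real_mult complex_norm_square by (simp add: algebra_simps)
  then show ?thesis by (simp only: of_real_eq_iff)
qed

text \<open>
Two almost orthogonal approximate eigenvectors belong to the two different eigenvalues \<open>|D|\<close> and
\<open>-|D|\<close>, which therefore differ by \<open>2|D|\<close>.  The statement includes the case that \<open>D\<close> is smaller
than the error.
\<close>
lemma two_level_splitting:
  fixes A1 B1 A2 B2 D :: complex and t1 t2 \<rho> :: real
  assumes le1: "cmod A1 \<le> 1" "cmod A2 \<le> 1"
    and ge: "1 / 2 \<le> cmod A1 + cmod B1" "1 / 2 \<le> cmod A2 + cmod B2"
    and e1: "cmod (t1 * A1 - D * B1) \<le> \<rho>" "cmod (t1 * B1 - cnj D * A1) \<le> \<rho>"
    and e2: "cmod (t2 * A2 - D * B2) \<le> \<rho>" "cmod (t2 * B2 - cnj D * A2) \<le> \<rho>"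
    and orth: "cmod (A1 * cnj A2 + B1 * cnj B2) \<le> 1 / 16"
    and le: "t1 \<le> t2"
  shows "\<bar>t2 - t1 - 2 * cmod D\<bar> \<le> 208 * \<rho>"
proof -
  have \<rho>: "0 \<le> \<rho>" using e1(1) norm_ge_zero order_trans by blast
  have l1: "\<bar>\<bar>t1\<bar> - cmod D\<bar> \<le> 4 * \<rho>" and l2: "\<bar>\<bar>t2\<bar> - cmod D\<bar> \<le> 4 * \<rho>"
    using two_level_eigenvalue[OF ge(1) e1] two_level_eigenvalue[OF ge(2) e2] .
  have sq: "1 / 8 \<le> x\<^sup>2 + y\<^sup>2" if "1 / 2 \<le> x + y" for x y :: real
  proof -
    have "(1/2)\<^sup>2 \<le> (x + y)\<^sup>2" using that by (intro power_mono) auto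
    also have "\<dots> \<le> 2 * (x\<^sup>2 + y\<^sup>2)" using sum_squares_bound[of x y] by (simp add: power2_sum)
    finally show ?thesis by (simp add: power2_eq_square)
  qed
  have "(1/8) * (1/8) \<le> ((cmod A1)\<^sup>2 + (cmod B1)\<^sup>2) * ((cmod A2)\<^sup>2 + (cmod B2)\<^sup>2)"
    using sq[OF ge(1)] sq[OF ge(2)] by (intro mult_mono) auto
  moreover have "(cmod (A1 * cnj A2 + B1 * cnj B2))\<^sup>2 \<le> (1/16)\<^sup>2"
    using orth by (intro power_mono) auto
  ultimately have "(1/10)\<^sup>2 \<le> (cmod (A1 * B2 - A2 * B1))\<^sup>2"
    unfolding lagrange_identity[symmetric] by (simp add: power2_eq_square)
  then have det: "1/10 \<le> cmod (A1 * B2 - A2 * B1)" by (rule power2_le_imp_le) simp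
  \<comment> \<open>Two almost orthogonal vectors span a parallelogram of area bounded below, but if both
     eigenvalues had the same sign they would nearly coincide and so would the eigenvectors.
     Quantitatively: eliminate \<^term>\<open>D * B1\<close> and \<^term>\<open>D * B2\<close> from the determinant.\<close>
  have "D * (A1 * B2 - A2 * B1) = (t2 - t1) * (A1 * A2) + (A2 * (t1 * A1 - D * B1) - A1 * (t2 * A2 - D * B2))"
    by (simp add: algebra_simps)
  then have "cmod D * cmod (A1 * B2 - A2 * B1) \<le> cmod ((t2 - t1) * (A1 * A2)) + cmod (A2 * (t1 * A1 - D * B1) - A1 * (t2 * A2 - D * B2))"
    by (metis norm_mult norm_triangle_ineq)
  also have "cmod ((t2 - t1) * (A1 * A2)) \<le> (t2 - t1) * (1 * 1)"
    unfolding norm_mult using le1 le by (intro mult_mono) (auto simp flip: of_real_diff)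
  also have "cmod (A2 * (t1 * A1 - D * B1) - A1 * (t2 * A2 - D * B2)) \<le> 1 * \<rho> + 1 * \<rho>"
    using mult_mono[OF le1(2) e1(1)] mult_mono[OF le1(1) e2(1)]
    by (intro order_trans[OF norm_triangle_ineq4] add_mono) (auto simp: norm_mult)
  finally have "cmod D * cmod (A1 * B2 - A2 * B1) \<le> t2 - t1 + 2 * \<rho>" by simp
  moreover have "cmod D * (1/10) \<le> cmod D * cmod (A1 * B2 - A2 * B1)"
    using det by (intro mult_left_mono) auto
  ultimately have D: "cmod D \<le> 10 * (t2 - t1) + 20 * \<rho>" by simp
  show ?thesis
    using l1 l2 D \<rho> le by (cases "0 \<le> t1"; cases "0 \<le> t2") auto
qed

context oscillation_solution
begin

lemma mean_bound: "cmod A \<le> N" "cmod B \<le> N"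
  by (rule norm_integral_le_sup; (rule bvD(5)[OF bva] bvD(5)[OF bvb] | use a b in auto))+

lemma mean_lower_bound:
  assumes "x \<in> {0..1}" "N \<le> cmod (a x) + cmod (b x)"
  shows "N \<le> cmod A + cmod B + 2 * U"
  using A_close[OF assms(1)] B_close[OF assms(1)] assms(2) norm_triangle_sub[of "a x" A] norm_triangle_sub[of "b x" B]
  by linarith

text \<open>
The first-order equations alone suffice to improve the information that \<open>h \<epsilon>\<close> is small to a bound
by a multiple of \<open>\<delta>\<close>.  The constant 400 makes \<open>U\<close> so small that the means of a normalised solution cannot both
be small, and it lets the terms that contain \<open>\<epsilon>\<close> on the right be absorbed on the left.
\<close>
lemma spectral_shift_bound:
  assumes x: "x \<in> {0..1}" "1 \<le> cmod (a x) + cmod (b x)" and N: "N = 1"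
    and small: "400 * L * cmod h * (L + \<bar>\<epsilon>\<bar>) \<le> 1"
  shows "\<bar>\<epsilon>\<bar> \<le> 42 * L\<^sup>2 * \<delta>"
proof -
  interpret D: oscillation_solution q P v w E e "- h" d c L \<delta> b a \<epsilon> N by (rule dual_solution)
  have DU: "D.U = U" by (simp add: U_def D.U_def)
  define H where "H = cmod h"
  have H: "0 \<le> H" "H \<le> \<delta>" "H \<le> 1" using h \<delta> by (auto simp: H_def)
  have s: "400 * (L * (H * (L + \<bar>\<epsilon>\<bar>))) \<le> 1" using small by (simp add: H_def mult_ac)
  have s0: "0 \<le> H * (L + \<bar>\<epsilon>\<bar>)" using H L by auto
  have "1 * (H * (L + \<bar>\<epsilon>\<bar>)) \<le> L * (H * (L + \<bar>\<epsilon>\<bar>))" using L s0 by (intro mult_right_mono) auto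
  then have s1: "400 * (H * (L + \<bar>\<epsilon>\<bar>)) \<le> 1" using s by linarith
  have U: "U = 2 * (H * (L + \<bar>\<epsilon>\<bar>))" unfolding U_def by (simp add: N H_def)
  have AB: "1 / 2 \<le> cmod A + cmod B"
    using mean_lower_bound[of x] x N s1 U by simp
  have "cmod (\<epsilon> * A) \<le> cmod (c * B) + (2 * L + \<delta> + \<bar>\<epsilon>\<bar> * H) * U"
    using first_order_bound norm_triangle_sub[of "\<epsilon> * A" "c * B"] by (simp add: H_def)
  moreover have "cmod (\<epsilon> * B) \<le> cmod (d * A) + (2 * L + \<delta> + \<bar>\<epsilon>\<bar> * H) * U"
    using D.first_order_bound norm_triangle_sub[of "\<epsilon> * B" "d * A"] by (simp add: H_def DU)
  moreover have "cmod (c * B) \<le> \<delta> * 1" "cmod (d * A) \<le> \<delta> * 1"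
    unfolding norm_mult using mean_bound N cd \<delta>0 by (auto intro!: mult_mono simp del: mult_1_right)
  ultimately have 1: "\<bar>\<epsilon>\<bar> * (cmod A + cmod B) \<le> 2 * \<delta> + 2 * ((2 * L + \<delta> + \<bar>\<epsilon>\<bar> * H) * U)"
    by (simp add: norm_mult algebra_simps)
  have "(2 * L + \<delta> + \<bar>\<epsilon>\<bar> * H) * U \<le> (3 * L + \<bar>\<epsilon>\<bar> * H) * U"
    using \<delta> L U0 by (intro mult_right_mono) auto
  also have "\<dots> = 6 * L\<^sup>2 * H + 6 * ((L * H) * \<bar>\<epsilon>\<bar>) + 2 * ((H * (L + \<bar>\<epsilon>\<bar>)) * (\<bar>\<epsilon>\<bar> * H))"
    by (simp add: U algebra_simps power2_eq_square)
  also have "(L * H) * \<bar>\<epsilon>\<bar> \<le> 1/400 * \<bar>\<epsilon>\<bar>"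
  proof -
    have "1 * (L * H) \<le> L * (L * H)" using L H by (intro mult_right_mono) auto
    moreover have "0 \<le> L * (H * \<bar>\<epsilon>\<bar>)" using L H by simp
    ultimately have "400 * (L * H) \<le> 1"
      using s by (simp add: algebra_simps)
    then show ?thesis by (intro mult_right_mono) auto
  qed
  also have "(H * (L + \<bar>\<epsilon>\<bar>)) * (\<bar>\<epsilon>\<bar> * H) \<le> 1/400 * (\<bar>\<epsilon>\<bar> * 1)"
    using s1 H by (intro mult_mono) auto
  finally have 2: "(2 * L + \<delta> + \<bar>\<epsilon>\<bar> * H) * U \<le> 6 * L\<^sup>2 * H + 8/400 * \<bar>\<epsilon>\<bar>" by simp
  have "\<bar>\<epsilon>\<bar> * (1/2) \<le> \<bar>\<epsilon>\<bar> * (cmod A + cmod B)" using AB by (intro mult_left_mono) auto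
  with 1 2 have "\<bar>\<epsilon>\<bar> * (1/2) \<le> 2 * \<delta> + 12 * (L\<^sup>2 * H) + 16/400 * \<bar>\<epsilon>\<bar>" by simp
  moreover have "L\<^sup>2 * H \<le> L\<^sup>2 * \<delta>" using H by (intro mult_left_mono) auto
  moreover have "1 * \<delta> \<le> L\<^sup>2 * \<delta>" using L \<delta>0 by (intro mult_right_mono) auto
  ultimately show ?thesis by (simp add: mult.assoc)
qed

end

lemma L1_cnj: "L1_norm (\<lambda>x. cnj (f x)) = L1_norm f"
  by (simp add: L1_norm_def)

lemma bv_cnj: "periodic_bv F f M V \<Longrightarrow> periodic_bv (\<lambda>x. cnj (F x)) (\<lambda>x. cnj (f x)) M V"
  by (auto simp: periodic_bv_def L1_cnj intro: antideriv_cnj)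

lemma integral_cnj': "integral {0..1} (\<lambda>x. cnj (f x)) = cnj (integral {0..1} f)"
  by (simp add: integral_cnj)

locale real_oscillation = oscillation +
  assumes real: "\<And>x. cnj (q x) = q x" "\<And>x. cnj (P x) = P x" "\<And>x. cnj (e x) = E x" "\<And>x. cnj (w x) = v x"
    and cnj_cd: "cnj c = d" and cnj_h: "cnj h = - h"
begin

lemma S_dual: "oscillation.S P E = cnj S"
proof -
  have "cnj S = integral {0..1} (\<lambda>x. cnj ((P x)\<^sup>2 * e x))"
    unfolding S_def by (rule integral_cnj'[symmetric])
  then show ?thesis by (simp add: real oscillation.S_def[OF dual])
qed

text \<open>
With this \<open>h T\<close> is real, so that \<open>\<epsilon> - h T\<close> is an admissible approximate eigenvalue of a Hermitian
matrix.
\<close>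
lemma T_imaginary: "cnj T = - T"
proof -
  have "E x = cnj (e x)" for x by (simp add: real)
  then have "cnj (E x) = e x" for x by simp
  moreover have "cnj T = integral {0..1} (\<lambda>x. cnj (q x * E x * w x))"
    unfolding T_def by (rule integral_cnj'[symmetric])
  ultimately have "cnj T = oscillation.T q v e"
    by (simp add: real oscillation.T_def[OF dual])
  then show ?thesis using T_dual by simp
qed

text \<open>
The common shift of the two eigenvalues.
\<close>
definition "\<sigma> = Re (h * T)"

lemma \<sigma>: "of_real \<sigma> = h * T"
proof -
  have "cnj (h * T) = h * T" using T_imaginary cnj_h by simp
  then have "h * T \<in> \<real>" by (simp only: Reals_cnj_iff)
  then show ?thesis unfolding \<sigma>_def by (rule of_real_Re)
qed

text \<open>
Orthogonality of two eigenfunctions passes to the mean amplitudes: in the inner product of the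
eigenfunctions the mixed terms oscillate and the others are close to the products of the means.
\<close>
lemma pair_splitting:
  assumes sol1: "oscillation_solution q P w v e E h c d L \<delta> a1 b1 \<epsilon>1 1"
    and sol2: "oscillation_solution q P w v e E h c d L \<delta> a2 b2 \<epsilon>2 1"
    and x1: "x1 \<in> {0..1}" "1 \<le> cmod (a1 x1) + cmod (b1 x1)"
    and x2: "x2 \<in> {0..1}" "1 \<le> cmod (a2 x2) + cmod (b2 x2)"
    and \<epsilon>: "\<bar>\<epsilon>1\<bar> \<le> \<delta>" "\<bar>\<epsilon>2\<bar> \<le> \<delta>" "\<epsilon>1 \<le> \<epsilon>2"
    and small: "400 * L * cmod h \<le> 1"
    and orth: "integral {0..1} (\<lambda>x. a1 x * cnj (a2 x) + b1 x * cnj (b2 x) + E x * (a1 x * cnj (b2 x)) + e x * (b1 x * cnj (a2 x))) = 0"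
  shows "\<bar>\<epsilon>2 - \<epsilon>1 - 2 * cmod (c - S)\<bar> \<le> 208 * (81 * \<delta> * (cmod h)\<^sup>2 * L ^ 4)"
proof -
  interpret s1: oscillation_solution q P w v e E h c d L \<delta> a1 b1 \<epsilon>1 1 by (rule sol1)
  interpret s2: oscillation_solution q P w v e E h c d L \<delta> a2 b2 \<epsilon>2 1 by (rule sol2)
  interpret D: oscillation q P v w E e "- h" d c L \<delta> by (rule dual)
  interpret d1: oscillation_solution q P v w E e "- h" d c L \<delta> b1 a1 \<epsilon>1 1 by (rule s1.dual_solution)
  interpret d2: oscillation_solution q P v w E e "- h" d c L \<delta> b2 a2 \<epsilon>2 1 by (rule s2.dual_solution)
  have "4 * cmod h * L * 1 \<le> 1/100" using small by (simp add: algebra_simps)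
  then have U: "s1.U \<le> 1/100" "s2.U \<le> 1/100"
    using s1.U_le(1)[OF \<epsilon>(1)] s2.U_le(1)[OF \<epsilon>(2)] by linarith+
  have h1: "cmod h \<le> 1" using h \<delta> by linarith
  have eq1: "cmod (complex_of_real (\<epsilon> - \<sigma>) * A - (c - S) * B) \<le> r" if "cmod (\<epsilon> * A - c * B + S * B - h * T * A) \<le> r"
    for \<epsilon> r and A B :: complex
    using that \<sigma> by (simp add: algebra_simps)
  have eq2: "cmod (complex_of_real (\<epsilon> - \<sigma>) * B - cnj (c - S) * A) \<le> r" if "cmod (\<epsilon> * B - d * A + D.S * A - (- h) * D.T * B) \<le> r"
    for \<epsilon> r and A B :: complex
  proof -
    have "complex_of_real (\<epsilon> - \<sigma>) * B - cnj (c - S) * A = \<epsilon> * B - d * A + D.S * A - (- h) * D.T * B"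
      using \<sigma> cnj_cd S_dual T_dual by (simp add: algebra_simps)
    then show ?thesis using that by simp
  qed
  note c1 = antideriv_continuous[OF s1.a(1)] antideriv_continuous[OF s1.b(1)]
    and c2 = antideriv_continuous[OF s2.a(1)] antideriv_continuous[OF s2.b(1)]
    and ce = antideriv_continuous[OF e(1)] antideriv_continuous[OF E(1)]
  have mean: "cmod (integral {0..1} (\<lambda>x. f x * cnj (g x)) - integral {0..1} f * cnj (integral {0..1} g)) \<le> 1 / 100"
    if f: "periodic_bv f f' 1 V" and g: "periodic_bv g g' 1 s2.U" for f f' g g' V
  proof -
    have i: "(\<lambda>x. f x * cnj (g x)) integrable_on {0..1}"
      by (intro integrable_continuous_real continuous_intros bvD(5)[OF f] bvD(5)[OF g])
    have j: "(\<lambda>x. f x * cnj (integral {0..1} g)) integrable_on {0..1}"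
      by (intro integrable_continuous_real continuous_intros bvD(5)[OF f])
    have "integral {0..1} (\<lambda>x. f x * cnj (g x)) - integral {0..1} f * cnj (integral {0..1} g)
        = integral {0..1} (\<lambda>x. f x * cnj (g x) - f x * cnj (integral {0..1} g))"
      by (simp only: Henstock_Kurzweil_Integration.integral_diff[OF i j] Henstock_Kurzweil_Integration.integral_mult_left)
    also have "cmod \<dots> \<le> 1 * s2.U"
    proof (rule norm_integral_le_sup)
      show "continuous_on {0..1} (\<lambda>x. f x * cnj (g x) - f x * cnj (integral {0..1} g))"
        by (intro continuous_intros bvD(5)[OF f] bvD(5)[OF g])
      fix x :: real assume x: "x \<in> {0..1}"
      have "cmod (f x * cnj (g x) - f x * cnj (integral {0..1} g)) = cmod (f x) * cmod (g x - integral {0..1} g)"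
        by (metis complex_cnj_diff complex_mod_cnj norm_mult right_diff_distrib)
      also have "\<dots> \<le> 1 * s2.U"
        by (intro mult_mono bvD(3)[OF f x] bvD(3)[OF bv_minus_mean[OF g] x]) auto
      finally show "cmod (f x * cnj (g x) - f x * cnj (integral {0..1} g)) \<le> 1 * s2.U" .
    qed
    finally show ?thesis using U by simp
  qed
  have osc: "cmod h * (V * 1 + 1 * V') \<le> 1/50" if "V \<le> 1/100" "V' \<le> 1/100" "0 \<le> V" "0 \<le> V'" for V V'
  proof -
    have "cmod h * (V * 1 + 1 * V') \<le> 1 * (V * 1 + 1 * V')" using h1 that by (intro mult_right_mono) auto
    also have "\<dots> \<le> 1/50" using that by simp
    finally show ?thesis .
  qed
  have "cmod (integral {0..1} (\<lambda>x. E x * (a1 x * cnj (b2 x)))) \<le> cmod (- h) * (s1.U * 1 + 1 * s2.U)"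
    by (rule D.int_e[OF bv_mult[OF s1.bva bv_cnj[OF s2.bvb]]])
  then have 3: "cmod (integral {0..1} (\<lambda>x. E x * (a1 x * cnj (b2 x)))) \<le> 1/50"
    using osc[OF U s1.U0 s2.U0] by simp
  have "cmod (integral {0..1} (\<lambda>x. e x * (b1 x * cnj (a2 x)))) \<le> cmod h * (s1.U * 1 + 1 * s2.U)"
    by (rule int_e[OF bv_mult[OF s1.bvb bv_cnj[OF s2.bva]]])
  then have 4: "cmod (integral {0..1} (\<lambda>x. e x * (b1 x * cnj (a2 x)))) \<le> 1/50"
    using osc[OF U s1.U0 s2.U0] by simp
  have i1: "(\<lambda>x. a1 x * cnj (a2 x)) integrable_on {0..1}" "(\<lambda>x. b1 x * cnj (b2 x)) integrable_on {0..1}"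
    "(\<lambda>x. E x * (a1 x * cnj (b2 x))) integrable_on {0..1}" "(\<lambda>x. e x * (b1 x * cnj (a2 x))) integrable_on {0..1}"
    by (intro integrable_continuous_real continuous_intros c1 c2 ce)+
  have "integral {0..1} (\<lambda>x. a1 x * cnj (a2 x)) + integral {0..1} (\<lambda>x. b1 x * cnj (b2 x))
      + integral {0..1} (\<lambda>x. E x * (a1 x * cnj (b2 x))) + integral {0..1} (\<lambda>x. e x * (b1 x * cnj (a2 x))) = 0"
    using orth Henstock_Kurzweil_Integration.integral_add[OF i1(1,2)]
      Henstock_Kurzweil_Integration.integral_add[OF Henstock_Kurzweil_Integration.integrable_add[OF i1(1,2)] i1(3)]
      Henstock_Kurzweil_Integration.integral_add[OF Henstock_Kurzweil_Integration.integrable_add[OF Henstock_Kurzweil_Integration.integrable_add[OF i1(1,2)] i1(3)] i1(4)]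
    by simp
  moreover have tri: "cmod (A + B) \<le> 1/100 + 1/100 + 1/50 + 1/50"
    if "z1 + z2 + z3 + z4 = 0" "cmod (z1 - A) \<le> 1/100" "cmod (z2 - B) \<le> 1/100" "cmod z3 \<le> 1/50" "cmod z4 \<le> 1/50"
    for z1 z2 z3 z4 A B :: complex
  proof -
    have "A + B = - ((z1 - A) + (z2 - B) + z3 + z4)"
      using that(1) by (simp add: algebra_simps add_eq_0_iff)
    then have "cmod (A + B) = cmod ((z1 - A) + (z2 - B) + z3 + z4)" by (metis norm_minus_cancel)
    also have "\<dots> \<le> 1/100 + 1/100 + 1/50 + 1/50"
      using that by (intro order_trans[OF norm_triangle_ineq] add_mono)
    finally show ?thesis .
  qed
  ultimately have gram: "cmod (s1.A * cnj s2.A + s1.B * cnj s2.B) \<le> 1/16"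
    using tri[OF _ mean[OF s1.bva s2.bva] mean[OF s1.bvb s2.bvb] 3 4] by simp
  have "\<bar>(\<epsilon>2 - \<sigma>) - (\<epsilon>1 - \<sigma>) - 2 * cmod (c - S)\<bar> \<le> 208 * (81 * \<delta> * (cmod h)\<^sup>2 * L ^ 4)"
  proof (rule two_level_splitting[OF s1.mean_bound(1) s2.mean_bound(1) _ _ eq1 eq2 eq1 eq2 gram])
    show "1 / 2 \<le> cmod s1.A + cmod s1.B"
      using s1.mean_lower_bound[OF x1] U by linarith
    show "1 / 2 \<le> cmod s2.A + cmod s2.B"
      using s2.mean_lower_bound[OF x2] U by linarith
  qed (use s1.second_order[OF \<epsilon>(1)] s2.second_order[OF \<epsilon>(2)] d1.second_order[OF \<epsilon>(1)] d2.second_order[OF \<epsilon>(2)] \<epsilon>(3) in auto)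
  then show ?thesis by simp
qed

end

section \<open>Eigenfunctions and their amplitudes\<close>

text \<open>
The equation \<open>-y'' + q y = \<mu> y\<close> as a first-order system, so that the second derivative, which exists
almost everywhere only, is not mentioned.
\<close>
definition hill_solution :: "(real \<Rightarrow> real) \<Rightarrow> real \<Rightarrow> complex \<Rightarrow> (real \<Rightarrow> complex) \<Rightarrow> (real \<Rightarrow> complex) \<Rightarrow> bool" where
  "hill_solution q \<mu> s y y' \<longleftrightarrow> antideriv y y' \<and>
     antideriv y' (\<lambda>x. (of_real (q x) - of_real \<mu>) * y x) \<and> y 1 = s * y 0 \<and> y' 1 = s * y' 0"

text \<open>
The eigenvalue equation holds almost everywhere only, which does not change integrals.
\<close>
lemma eigenfunction_imp_hill_solution:
  assumes "y \<in> eigenspace (hill_operator q s) (of_real \<mu>)"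
  shows "\<exists>y'. hill_solution q \<mu> s y y'" "\<And>x. x \<notin> {0..1} \<Longrightarrow> y x = 0"
proof -
  from assms obtain y' y'' where
    0: "y \<in> L2_unit" and
    1: "\<forall>x\<in>{0..1}. (y has_vector_derivative y' x) (at x within {0..1})" and
    2: "y'' absolutely_integrable_on {0..1}" and
    3: "\<forall>x\<in>{0..1}. y' x = y' 0 + integral {0..x} y''" and
    4: "y 1 = s * y 0" "y' 1 = s * y' 0" and
    5: "AE x in lebesgue. x \<in> {0..1} \<longrightarrow> of_real \<mu> * y x = - y'' x + complex_of_real (q x) * y x"
    unfolding eigenspace_def hill_operator_def by blast
  show "y x = 0" if "x \<notin> {0..1}" for x using 0 that by (simp add: L2_unit_def)
  have y'': "antideriv y' y''" using 2 3 unfolding antideriv_def by blast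
  have y: "antideriv y y'"
    using 1 antideriv_continuous[OF y''] by (intro antideriv_C1) auto
  define N where "N = {x. \<not> (x \<in> {0..1} \<longrightarrow> of_real \<mu> * y x = - y'' x + complex_of_real (q x) * y x)}"
  have N: "negligible N"
    using 5 unfolding N_def negligible_iff_null_sets by (simp add: AE_iff_null_sets[symmetric] completion.AE_iff_null_sets)
  have N': "y'' x = (of_real (q x) - of_real \<mu>) * y x" if "x \<in> {0..1} - N" for x
    using that unfolding N_def by (auto simp: algebra_simps)
  have "antideriv y' (\<lambda>x. (of_real (q x) - of_real \<mu>) * y x)"
  proof (rule antiderivI)
    show "(\<lambda>x. (of_real (q x) - of_real \<mu>) * y x) absolutely_integrable_on {0..1}"
      by (rule absolutely_integrable_spike[OF 2 N]) (use N' in auto)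
    fix x :: real assume x: "0 \<le> x" "x \<le> 1"
    have "integral {0..x} (\<lambda>x. (of_real (q x) - of_real \<mu>) * y x) = integral {0..x} y''"
      by (rule integral_spike[OF N]) (use N' x in auto)
    then show "integral {0..x} (\<lambda>x. (of_real (q x) - of_real \<mu>) * y x) = y' x - y' 0"
      using antideriv_diff[OF y'', of 0 x] x by simp
  qed
  then show "\<exists>y'. hill_solution q \<mu> s y y'"
    using y 4 unfolding hill_solution_def by blast
qed

lemma hill_solution_diff_cmult:
  assumes "hill_solution q \<mu> s y1 y1'" "hill_solution q \<mu> s y2 y2'"
  shows "hill_solution q \<mu> s (\<lambda>x. y2 x - t * y1 x) (\<lambda>x. y2' x - t * y1' x)"
proof -
  have "antideriv (\<lambda>x. y2 x - t * y1 x) (\<lambda>x. y2' x - t * y1' x)"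
    using assms unfolding hill_solution_def by (intro antideriv_diff_fun antideriv_cmult) auto
  moreover have "antideriv (\<lambda>x. y2' x - t * y1' x)
     (\<lambda>x. (of_real (q x) - of_real \<mu>) * y2 x - t * ((of_real (q x) - of_real \<mu>) * y1 x))"
    using assms unfolding hill_solution_def by (intro antideriv_diff_fun antideriv_cmult) auto
  ultimately show ?thesis
    using assms unfolding hill_solution_def by (simp add: algebra_simps)
qed

text \<open>
The derivative of the Wronskian of \<open>y1\<close> and the conjugate of \<open>y2\<close> is \<open>\<mu>2 - \<mu>1\<close> times the product,
and the Wronskian is periodic because \<open>s\<close> has modulus one.
\<close>
lemma hill_solutions_orthogonal:
  assumes y1: "hill_solution q \<mu>1 s y1 y1'" and y2: "hill_solution q \<mu>2 s y2 y2'"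
    and "\<mu>1 \<noteq> \<mu>2" and s: "s * cnj s = 1"
  shows "integral {0..1} (\<lambda>x. y1 x * cnj (y2 x)) = 0"
proof -
  note a1 = y1[unfolded hill_solution_def] and a2 = y2[unfolded hill_solution_def]
  have "antideriv (\<lambda>x. y1' x * cnj (y2 x) - y1 x * cnj (y2' x))
    (\<lambda>x. ((of_real (q x) - of_real \<mu>1) * y1 x * cnj (y2 x) + y1' x * cnj (y2' x))
       - (y1' x * cnj (y2' x) + y1 x * cnj ((of_real (q x) - of_real \<mu>2) * y2 x)))"
    using a1 a2 by (intro antideriv_diff_fun antideriv_mult antideriv_cnj) auto
  then have "integral {0..1} (\<lambda>x. ((of_real (q x) - of_real \<mu>1) * y1 x * cnj (y2 x) + y1' x * cnj (y2' x))
       - (y1' x * cnj (y2' x) + y1 x * cnj ((of_real (q x) - of_real \<mu>2) * y2 x)))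
     = (y1' 1 * cnj (y2 1) - y1 1 * cnj (y2' 1)) - (y1' 0 * cnj (y2 0) - y1 0 * cnj (y2' 0))"
    by (rule antideriv_integral)
  also have "\<dots> = (s * cnj s - 1) * (y1' 0 * cnj (y2 0) - y1 0 * cnj (y2' 0))"
    using a1 a2 by (simp add: algebra_simps)
  also have "\<dots> = 0" using s by simp
  also have "(\<lambda>x. ((of_real (q x) - of_real \<mu>1) * y1 x * cnj (y2 x) + y1' x * cnj (y2' x))
       - (y1' x * cnj (y2' x) + y1 x * cnj ((of_real (q x) - of_real \<mu>2) * y2 x)))
     = (\<lambda>x. complex_of_real (\<mu>2 - \<mu>1) * (y1 x * cnj (y2 x)))"
    by (auto simp: algebra_simps)
  finally show ?thesis using assms(3)
    by (simp only: Henstock_Kurzweil_Integration.integral_mult_right mult_eq_0_iff of_real_eq_0_iff) simp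
qed

lemma integral_norm_square_pos:
  fixes y :: "real \<Rightarrow> complex"
  assumes "continuous_on {0..1} y" "x \<in> {0..1}" "y x \<noteq> 0"
  shows "integral {0..1} (\<lambda>x. y x * cnj (y x)) \<noteq> 0"
proof
  assume 0: "integral {0..1} (\<lambda>x. y x * cnj (y x)) = 0"
  have c: "continuous_on {0..1} (\<lambda>x. (cmod (y x))\<^sup>2)" by (intro continuous_intros assms)
  have "complex_of_real (integral {0..1} (\<lambda>x. (cmod (y x))\<^sup>2)) = integral {0..1} (\<lambda>x. y x * cnj (y x))"
    using integral_linear[OF integrable_continuous_real[OF c], of complex_of_real, OF bounded_linear_of_real]
    by (simp add: o_def complex_norm_square[symmetric])
  then have "integral {0..1} (\<lambda>x. (cmod (y x))\<^sup>2) = 0" using 0 by simp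
  then have "((\<lambda>x. (cmod (y x))\<^sup>2) has_integral 0) (cbox 0 1)"
    using integrable_continuous_real[OF c] by (simp add: has_integral_iff)
  then have "(cmod (y x))\<^sup>2 = 0"
    using c assms(2) by (intro has_integral_0_cbox_imp_0[of 0 1]) auto
  then show False using assms(3) by simp
qed

lemma antideriv_exp: "antideriv (\<lambda>x. exp (z * of_real x)) (\<lambda>x. z * exp (z * of_real x))"
proof (rule antideriv_C1)
  show "((\<lambda>x. exp (z * complex_of_real x)) has_vector_derivative z * exp (z * complex_of_real x)) (at x within {0..1})" for x
    by (auto intro!: derivative_eq_intros has_vector_derivative_real_field simp: mult_ac)
qed (intro continuous_intros)

text \<open>
For \<open>\<kappa> = ik\<close> and \<open>\<kappa> = -ik\<close> these are the coefficients \<open>a\<close> and \<open>b\<close> that variation of constants assigns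
to the exponentials \<open>e\<^sup>i\<^sup>k\<^sup>x\<close> and \<open>e\<^sup>-\<^sup>i\<^sup>k\<^sup>x\<close>.
\<close>
definition amplitude :: "complex \<Rightarrow> (real \<Rightarrow> complex) \<Rightarrow> (real \<Rightarrow> complex) \<Rightarrow> real \<Rightarrow> complex" where
  "amplitude \<kappa> y y' x = (y x + y' x / \<kappa>) / 2 * exp (- \<kappa> * of_real x)"

lemma amplitude_sum:
  "exp (\<kappa> * of_real x) * amplitude \<kappa> y y' x + exp (- \<kappa> * of_real x) * amplitude (- \<kappa>) y y' x = y x"
proof -
  have "exp (\<kappa> * complex_of_real x) * exp (- (\<kappa> * complex_of_real x)) = 1"
    by (simp flip: exp_add)
  then have *: "exp (\<kappa> * complex_of_real x) * (z * exp (- (\<kappa> * complex_of_real x))) = z"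
    "exp (- (\<kappa> * complex_of_real x)) * (z * exp (\<kappa> * complex_of_real x)) = z" for z
    by (simp_all add: mult_ac)
  show ?thesis by (simp add: amplitude_def * flip: add_divide_distrib)
qed

lemma amplitude_equation:
  assumes y: "hill_solution q \<mu> s y y'" and \<kappa>: "\<kappa> \<noteq> 0" "of_real \<mu> = of_real \<epsilon> - \<kappa>\<^sup>2"
  shows "antideriv (amplitude \<kappa> y y')
    (\<lambda>x. 1 / (2 * \<kappa>) * (of_real (q x) - of_real \<epsilon>) *
       (amplitude \<kappa> y y' x + exp (- (2 * \<kappa>) * of_real x) * amplitude (- \<kappa>) y y' x))"
proof -
  note a = y[unfolded hill_solution_def]
  have "antideriv (\<lambda>x. 1 / 2 * ((y x + 1 / \<kappa> * y' x) * exp (- \<kappa> * of_real x)))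
    (\<lambda>x. 1 / 2 * ((y' x + 1 / \<kappa> * ((of_real (q x) - of_real \<mu>) * y x)) * exp (- \<kappa> * of_real x)
        + (y x + 1 / \<kappa> * y' x) * (- \<kappa> * exp (- \<kappa> * of_real x))))"
    using a by (intro antideriv_cmult antideriv_mult antideriv_add antideriv_exp) auto
  then show ?thesis
  proof (rule antideriv_cong)
    fix x :: real
    show "1 / 2 * ((y x + 1 / \<kappa> * y' x) * exp (- \<kappa> * of_real x)) = amplitude \<kappa> y y' x"
      by (simp add: amplitude_def)
    have e: "exp (- (2 * \<kappa>) * of_real x) = exp (- \<kappa> * of_real x) * exp (- \<kappa> * of_real x)"
      by (simp add: mult.assoc flip: exp_add)
    have "amplitude \<kappa> y y' x + exp (- (2 * \<kappa>) * of_real x) * amplitude (- \<kappa>) y y' x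
        = exp (- \<kappa> * of_real x) * (exp (\<kappa> * of_real x) * amplitude \<kappa> y y' x + exp (- \<kappa> * of_real x) * amplitude (- \<kappa>) y y' x)"
      unfolding e distrib_left mult.assoc[symmetric] by (simp flip: exp_add)
    also have "\<dots> = exp (- \<kappa> * of_real x) * y x" by (simp only: amplitude_sum)
    finally have *: "amplitude \<kappa> y y' x + exp (- (2 * \<kappa>) * of_real x) * amplitude (- \<kappa>) y y' x = exp (- \<kappa> * of_real x) * y x" .
    show "1 / 2 * ((y' x + 1 / \<kappa> * ((of_real (q x) - of_real \<mu>) * y x)) * exp (- \<kappa> * of_real x)
        + (y x + 1 / \<kappa> * y' x) * (- \<kappa> * exp (- \<kappa> * of_real x)))
      = 1 / (2 * \<kappa>) * (of_real (q x) - of_real \<epsilon>) *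
       (amplitude \<kappa> y y' x + exp (- (2 * \<kappa>) * of_real x) * amplitude (- \<kappa>) y y' x)"
      unfolding * \<kappa>(2) using \<kappa>(1) by (simp add: field_simps power2_eq_square)
  qed
qed

lemma amplitude_periodic:
  assumes y: "hill_solution q \<mu> s y y'" and "s * exp (- \<kappa>) = 1"
  shows "amplitude \<kappa> y y' 1 = amplitude \<kappa> y y' 0"
proof -
  have "amplitude \<kappa> y y' 1 = (s * exp (- \<kappa>)) * ((y 0 + y' 0 / \<kappa>) / 2)"
    using y unfolding hill_solution_def by (simp add: amplitude_def algebra_simps add_divide_distrib)
  then show ?thesis using assms(2) by (simp add: amplitude_def)
qed

lemma antideriv_scale_equation:
  assumes "antideriv a (\<lambda>x. z * g x * (a x + e x * b x))"
  shows "antideriv (\<lambda>x. r * a x) (\<lambda>x. z * g x * (r * a x + e x * (r * b x)))"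
  using antideriv_cong[OF antideriv_cmult[OF assms, of r]] by (simp add: algebra_simps)

text \<open>
Dividing by the maximum of \<open>|a| + |b|\<close> normalises the amplitudes in the way the estimates need.
\<close>
lemma normalized_amplitudes:
  fixes k :: real
  assumes y: "hill_solution q (k\<^sup>2 + \<epsilon>) s y y'" and k: "k > 0"
    and s: "s * exp (\<i> * of_real k) = 1" "s * exp (- (\<i> * of_real k)) = 1"
    and nz: "x0 \<in> {0..1}" "y x0 \<noteq> 0"
  shows "\<exists>a b r x1. r \<noteq> 0 \<and> x1 \<in> {0..1} \<and> 1 \<le> cmod (a x1) + cmod (b x1) \<and>
     (\<forall>x\<in>{0..1}. cmod (a x) \<le> 1 \<and> cmod (b x) \<le> 1) \<and> a 1 = a 0 \<and> b 1 = b 0 \<and>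
     antideriv a (\<lambda>x. 1 / (2 * (\<i> * of_real k)) * (of_real (q x) - of_real \<epsilon>) * (a x + exp (- (2 * (\<i> * of_real k)) * of_real x) * b x)) \<and>
     antideriv b (\<lambda>x. - (1 / (2 * (\<i> * of_real k))) * (of_real (q x) - of_real \<epsilon>) * (exp (2 * (\<i> * of_real k) * of_real x) * a x + b x)) \<and>
     (\<forall>x. y x = r * (exp (\<i> * of_real k * of_real x) * a x + exp (- (\<i> * of_real k) * of_real x) * b x))"
proof -
  define \<kappa> where "\<kappa> = \<i> * complex_of_real k"
  have \<kappa>: "\<kappa> \<noteq> 0" "complex_of_real (k\<^sup>2 + \<epsilon>) = of_real \<epsilon> - \<kappa>\<^sup>2" "complex_of_real (k\<^sup>2 + \<epsilon>) = of_real \<epsilon> - (- \<kappa>)\<^sup>2"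
    using k by (auto simp: \<kappa>_def power_mult_distrib)
  define \<alpha> where "\<alpha> = amplitude \<kappa> y y'"
  define \<beta> where "\<beta> = amplitude (- \<kappa>) y y'"
  have \<alpha>: "antideriv \<alpha> (\<lambda>x. 1 / (2 * \<kappa>) * (of_real (q x) - of_real \<epsilon>) * (\<alpha> x + exp (- (2 * \<kappa>) * of_real x) * \<beta> x))"
    using amplitude_equation[OF y \<kappa>(1,2)] by (simp add: \<alpha>_def \<beta>_def)
  have \<beta>: "antideriv \<beta> (\<lambda>x. - (1 / (2 * \<kappa>)) * (of_real (q x) - of_real \<epsilon>) * (\<beta> x + exp (2 * \<kappa> * of_real x) * \<alpha> x))"
    using amplitude_equation[OF y, of "- \<kappa>" \<epsilon>] \<kappa> by (simp add: \<alpha>_def \<beta>_def)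
  have sum: "exp (\<kappa> * of_real x) * \<alpha> x + exp (- \<kappa> * of_real x) * \<beta> x = y x" for x
    unfolding \<alpha>_def \<beta>_def by (rule amplitude_sum)
  have per: "\<alpha> 1 = \<alpha> 0" "\<beta> 1 = \<beta> 0"
    unfolding \<alpha>_def \<beta>_def using s by (auto intro!: amplitude_periodic[OF y] simp: \<kappa>_def)
  have "continuous_on {0..1} (\<lambda>x. cmod (\<alpha> x) + cmod (\<beta> x))"
    by (intro continuous_intros antideriv_continuous[OF \<alpha>] antideriv_continuous[OF \<beta>])
  then obtain x1 where x1: "x1 \<in> {0..1}" "\<And>x. x \<in> {0..1} \<Longrightarrow> cmod (\<alpha> x) + cmod (\<beta> x) \<le> cmod (\<alpha> x1) + cmod (\<beta> x1)"
    using continuous_attains_sup[of "{0..1::real}" "\<lambda>x. cmod (\<alpha> x) + cmod (\<beta> x)"] by auto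
  define r where "r = cmod (\<alpha> x1) + cmod (\<beta> x1)"
  have "\<alpha> x0 \<noteq> 0 \<or> \<beta> x0 \<noteq> 0" using sum[of x0] nz(2) by auto
  then have "0 < cmod (\<alpha> x0) + cmod (\<beta> x0)" by (auto intro: add_pos_nonneg add_nonneg_pos)
  then have r: "r > 0" using x1(2)[OF nz(1)] by (simp add: r_def)
  define a where "a = (\<lambda>x. complex_of_real (1 / r) * \<alpha> x)"
  define b where "b = (\<lambda>x. complex_of_real (1 / r) * \<beta> x)"
  have "antideriv a (\<lambda>x. 1 / (2 * \<kappa>) * (of_real (q x) - of_real \<epsilon>) * (a x + exp (- (2 * \<kappa>) * of_real x) * b x))"
    unfolding a_def b_def by (rule antideriv_scale_equation[OF \<alpha>])
  moreover have "antideriv b (\<lambda>x. - (1 / (2 * \<kappa>)) * (of_real (q x) - of_real \<epsilon>) * (exp (2 * \<kappa> * of_real x) * a x + b x))"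
    using antideriv_scale_equation[OF \<beta>, of "complex_of_real (1 / r)"] by (simp add: a_def b_def add.commute)
  moreover have "y x = of_real r * (exp (\<kappa> * of_real x) * a x + exp (- \<kappa> * of_real x) * b x)" for x
    using r sum[of x] by (simp add: a_def b_def field_simps)
  moreover have "cmod (a x) \<le> 1 \<and> cmod (b x) \<le> 1" if "x \<in> {0..1}" for x
  proof -
    have "cmod (\<alpha> x) \<le> r" "cmod (\<beta> x) \<le> r"
      using x1(2)[OF that] norm_ge_zero[of "\<alpha> x"] norm_ge_zero[of "\<beta> x"] unfolding r_def by linarith+
    then show ?thesis using r by (simp add: a_def b_def norm_mult norm_divide)
  qed
  moreover have "1 \<le> cmod (a x1) + cmod (b x1)"
    using r by (simp add: a_def b_def norm_mult norm_divide flip: add_divide_distrib) (simp add: r_def)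
  moreover have "a 1 = a 0" "b 1 = b 0" using per by (auto simp: a_def b_def)
  ultimately show ?thesis
    using r x1(1) unfolding \<kappa>_def
    by (intro exI[of _ a] exI[of _ b] exI[of _ "of_real r"] exI[of _ x1]) auto
qed

section \<open>High frequencies\<close>

lemma set_integrable_of_real:
  fixes q :: "real \<Rightarrow> real"
  assumes "q absolutely_integrable_on {0..1}"
  shows "(\<lambda>x. complex_of_real (q x)) absolutely_integrable_on {0..1}"
  using absolutely_integrable_linear[OF assms, of complex_of_real, OF bounded_linear_of_real] by (simp add: o_def)

text \<open>
The periodic primitive with mean zero of \<open>f\<close> minus its mean.
\<close>
definition centered_primitive :: "(real \<Rightarrow> complex) \<Rightarrow> real \<Rightarrow> complex" where
  "centered_primitive f x =
     (integral {0..x} f - of_real x * integral {0..1} f)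
      - integral {0..1} (\<lambda>t. integral {0..t} f - of_real t * integral {0..1} f)"

lemma centered_primitive:
  assumes f: "f absolutely_integrable_on {0..1}"
  shows "antideriv (centered_primitive f) (\<lambda>x. f x - integral {0..1} f)"
    and "centered_primitive f 1 = centered_primitive f 0"
    and "integral {0..1} (centered_primitive f) = 0"
    and "(\<And>x. x \<in> {0..1} \<Longrightarrow> cmod (integral {0..x} f) \<le> \<eta>) \<Longrightarrow> x \<in> {0..1} \<Longrightarrow> cmod (centered_primitive f x) \<le> 4 * \<eta>"
proof -
  define g where "g = (\<lambda>x. integral {0..x} f - of_real x * integral {0..1} f)"
  have c: "centered_primitive f = (\<lambda>x. g x - integral {0..1} g)"
    by (auto simp: centered_primitive_def g_def)
  have 1: "antideriv (\<lambda>x. integral {0..x} f) f"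
    by (rule antiderivI[OF f]) auto
  have 2: "antideriv (\<lambda>x. of_real x * integral {0..1} f) (\<lambda>x. integral {0..1} f)"
    by (rule antideriv_C1) (auto intro!: derivative_eq_intros has_vector_derivative_real_field)
  have g: "antideriv g (\<lambda>x. f x - integral {0..1} f)"
    unfolding g_def by (rule antideriv_diff_fun[OF 1 2])
  show "antideriv (centered_primitive f) (\<lambda>x. f x - integral {0..1} f)"
    unfolding c using antideriv_diff_fun[OF g antideriv_const] by simp
  show "centered_primitive f 1 = centered_primitive f 0"
    by (simp add: c g_def)
  have gi: "g integrable_on {0..1}"
    by (intro integrable_continuous_real antideriv_continuous[OF g])
  show "integral {0..1} (centered_primitive f) = 0"
    unfolding c using Henstock_Kurzweil_Integration.integral_diff[OF gi integrable_const_ivl[of "integral {0..1} g"]] by simp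
  assume \<eta>: "\<And>x. x \<in> {0..1} \<Longrightarrow> cmod (integral {0..x} f) \<le> \<eta>" and x: "x \<in> {0..1}"
  have "cmod (g t) \<le> 2 * \<eta>" if t: "t \<in> {0..1}" for t
  proof -
    have "cmod (of_real t * integral {0..1} f) \<le> 1 * \<eta>"
      unfolding norm_mult using t \<eta>[of 1] by (intro mult_mono) auto
    then show ?thesis
      unfolding g_def using \<eta>[OF t] norm_triangle_ineq4[of "integral {0..t} f" "of_real t * integral {0..1} f"] by linarith
  qed
  moreover from this have "cmod (integral {0..1} g) \<le> 2 * \<eta>"
    by (intro norm_integral_le_sup antideriv_continuous[OF g])
  ultimately show "cmod (centered_primitive f x) \<le> 4 * \<eta>"
    unfolding c using x norm_triangle_ineq4[of "g x" "integral {0..1} g"] by force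
qed

lemma cnj_centered_primitive: "cnj (centered_primitive f x) = centered_primitive (\<lambda>t. cnj (f t)) x"
  by (simp add: centered_primitive_def integral_cnj)

definition exp_coeff :: "(real \<Rightarrow> complex) \<Rightarrow> real \<Rightarrow> complex" where
  "exp_coeff f k = integral {0..1} (\<lambda>x. f x * exp (- (2 * (\<i> * of_real k)) * of_real x))"

text \<open>
By the Riemann--Lebesgue lemma the smallness assumptions hold for every \<open>\<delta>\<close> as soon as the
frequency is large.  Here \<open>k\<close> is a multiple of \<open>\<pi>\<close>, which makes the exponentials periodic.
\<close>
lemma oscillation_exists:
  fixes q :: "real \<Rightarrow> real"
  assumes q: "q absolutely_integrable_on {0..1}" and m0: "integral {0..1} q = 0"
    and \<delta>: "0 < \<delta>" "\<delta> \<le> 1"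
  defines "qc \<equiv> \<lambda>x. complex_of_real (q x)"
  defines "L \<equiv> 1 + L1_norm qc"
  defines "P \<equiv> \<lambda>x. complex_of_real (primitive q x) - integral {0..1} (\<lambda>x. complex_of_real (primitive q x))"
  shows "\<exists>M. \<forall>m\<ge>M. m > 0 \<and> (\<forall>k. k = pi * real m \<longrightarrow> (\<exists>w v.
     real_oscillation qc P w v (\<lambda>x. exp (- (2 * (\<i> * of_real k)) * of_real x)) (\<lambda>x. exp (2 * (\<i> * of_real k) * of_real x))
       (1 / (2 * (\<i> * of_real k))) (exp_coeff qc k) (cnj (exp_coeff qc k)) L \<delta>))"
proof -
  obtain K where K: "K > 0" "\<And>k x. K \<le> k \<Longrightarrow> x \<in> {0..1} \<Longrightarrow>
     cmod (integral {0..x} (\<lambda>t. of_real (q t) * exp (- (2 * \<i> * of_real k * of_real t)))) \<le> \<delta> / 4"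
    using riemann_lebesgue_uniform[OF q, of "\<delta> / 4"] \<delta> by auto
  obtain M :: nat where M: "max K (1 / \<delta>) < real M" using reals_Archimedean2 by blast
  show ?thesis
  proof (intro exI[of _ M] allI impI conjI)
    fix m :: nat assume m: "M \<le> m"
    have mr: "max K (1 / \<delta>) < real m" using M m by linarith
    then have "0 < real m" using K(1) by linarith
    then show "0 < m" by simp
    fix k assume kdef: "k = pi * real m"
    have "1 * real m \<le> pi * real m" using pi_gt3 by (intro mult_right_mono) auto
    moreover have "K < real m" "1 / \<delta> < real m" using mr by auto
    ultimately have k: "K \<le> k" "1 / \<delta> \<le> k" "k > 0" using K(1) by (unfold kdef, linarith+)
    define \<kappa> where "\<kappa> = \<i> * complex_of_real k"
    define e where "e = (\<lambda>x::real. exp (- (2 * \<kappa>) * of_real x))"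
    define E where "E = (\<lambda>x::real. exp (2 * \<kappa> * of_real x))"
    define h where "h = 1 / (2 * \<kappa>)"
    define w where "w = centered_primitive (\<lambda>x. qc x * e x)"
    define v where "v = centered_primitive (\<lambda>x. qc x * E x)"
    define c where "c = exp_coeff qc k"
    have ceq: "c = integral {0..1} (\<lambda>x. qc x * e x)" by (simp add: c_def exp_coeff_def e_def \<kappa>_def)
    have \<kappa>0: "\<kappa> \<noteq> 0" "cnj \<kappa> = - \<kappa>" using k by (auto simp: \<kappa>_def)
    have eE: "cnj (e x) = E x" "e x * E x = 1" for x
      using \<kappa>0 by (auto simp: e_def E_def exp_cnj simp flip: exp_add)
    have dceq: "cnj c = integral {0..1} (\<lambda>x. qc x * E x)"
      unfolding ceq integral_cnj by (simp add: eE qc_def)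
    have n1: "cmod (e x) = 1" "cmod (E x) = 1" for x
      by (auto simp: e_def E_def \<kappa>_def)
    have "exp (2 * \<kappa>) = 1"
      by (subst exp_eq_1) (auto simp: \<kappa>_def kdef intro!: exI[of _ "int m"])
    then have per: "e 1 = e 0" "E 1 = E 0" by (auto simp: e_def E_def exp_minus)
    have ae: "antideriv e (\<lambda>x. - e x / h)" and aE: "antideriv E (\<lambda>x. E x / h)"
      using antideriv_exp[of "- (2 * \<kappa>)"] antideriv_exp[of "2 * \<kappa>"] by (auto simp: e_def E_def h_def mult_ac)
    have qa: "qc absolutely_integrable_on {0..1}"
      unfolding qc_def by (rule set_integrable_of_real[OF q])
    have qe: "(\<lambda>x. qc x * e x) absolutely_integrable_on {0..1}" "(\<lambda>x. qc x * E x) absolutely_integrable_on {0..1}"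
      using absint_mult[OF antideriv_continuous[OF ae] qa] absint_mult[OF antideriv_continuous[OF aE] qa]
      by (simp_all add: mult.commute)
    have smalle: "cmod (integral {0..x} (\<lambda>x. qc x * e x)) \<le> \<delta> / 4" if "x \<in> {0..1}" for x
      using K(2)[OF k(1) that] by (simp add: qc_def e_def \<kappa>_def mult.assoc)
    have "cnj (integral {0..x} (\<lambda>x. qc x * e x)) = integral {0..x} (\<lambda>x. qc x * E x)" for x
      unfolding integral_cnj by (simp add: eE qc_def)
    then have smallE: "cmod (integral {0..x} (\<lambda>x. qc x * E x)) \<le> \<delta> / 4" if "x \<in> {0..1}" for x
      using smalle[OF that] by (metis complex_mod_cnj)
    have Pq: "antideriv (\<lambda>x. complex_of_real (primitive q x)) qc"
    proof (rule antiderivI[OF qa])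
      fix x :: real assume x: "0 \<le> x" "x \<le> 1"
      show "integral {0..x} qc = complex_of_real (primitive q x) - complex_of_real (primitive q 0)"
        using integral_linear[OF absint_sub_intble(1)[OF q, of 0 x], of complex_of_real, OF _ _ bounded_linear_of_real] x
        by (simp add: primitive_def o_def qc_def)
    qed
    have P: "antideriv P qc" unfolding P_def using antideriv_diff_fun[OF Pq antideriv_const] by simp
    have cP: "cmod (P x) \<le> L1_norm qc" if "x \<in> {0..1}" for x
      unfolding P_def by (rule antideriv_minus_mean[OF Pq that])
    have P0: "integral {0..1} P = 0"
      unfolding P_def using Henstock_Kurzweil_Integration.integral_diff[OF integrable_continuous_real[OF antideriv_continuous[OF Pq]] integrable_const_ivl[of "integral {0..1} (\<lambda>x. complex_of_real (primitive q x))"]]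
      by simp
    have Preal: "cnj (P x) = P x" for x by (simp add: P_def integral_cnj)
    have h: "h \<noteq> 0" "cnj h = - h" using \<kappa>0 by (auto simp: h_def)
    have "cmod h = 1 / (2 * k)" using k by (simp add: h_def \<kappa>_def norm_divide norm_mult)
    also have "\<dots> \<le> \<delta>" using k \<delta> by (simp add: field_simps)
    finally have hd: "cmod h \<le> \<delta>" .
    have L10: "0 \<le> L1_norm qc" by (rule L1_nonneg[OF qa])
    have "oscillation qc P w v e E h c (cnj c) L \<delta>"
    proof
      show "qc absolutely_integrable_on {0..1}" by fact
      show "antideriv P qc" by fact
      show "P 1 = P 0" using m0 by (simp add: P_def primitive_def)
      show "integral {0..1} P = 0" by fact
      show "cmod (P x) \<le> 2 * L" if "x \<in> {0..1}" for x using cP[OF that] L10 by (simp add: L_def)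
      show "antideriv e (\<lambda>x. - e x / h)" "e 1 = e 0" "antideriv E (\<lambda>x. E x / h)" "E 1 = E 0" by fact+
      show "antideriv w (\<lambda>x. qc x * e x - c)" "w 1 = w 0" "integral {0..1} w = 0"
        unfolding w_def ceq using centered_primitive[OF qe(1)] by auto
      show "cmod (w x) \<le> \<delta>" if "x \<in> {0..1}" for x
        using centered_primitive(4)[OF qe(1) smalle that] by (simp add: w_def)
      show "antideriv v (\<lambda>x. qc x * E x - cnj c)" "v 1 = v 0" "integral {0..1} v = 0"
        unfolding v_def dceq using centered_primitive[OF qe(2)] by auto
      show "cmod (v x) \<le> \<delta>" if "x \<in> {0..1}" for x
        using centered_primitive(4)[OF qe(2) smallE that] by (simp add: v_def)
      show "1 \<le> L" "L1_norm qc \<le> L" using L10 by (auto simp: L_def)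
      show "cmod c \<le> \<delta>" using smalle[of 1] \<delta> by (simp add: ceq)
      then show "cmod (cnj c) \<le> \<delta>" by simp
    qed (use n1 eE h hd \<delta> in auto)
    moreover have "cnj (w x) = v x" for x
      unfolding w_def v_def cnj_centered_primitive by (simp add: eE qc_def)
    ultimately have "real_oscillation qc P w v e E h c (cnj c) L \<delta>"
      using eE Preal h by (simp add: real_oscillation_def real_oscillation_axioms_def qc_def)
    then show "\<exists>w v. real_oscillation qc P w v (\<lambda>x. exp (- (2 * (\<i> * of_real k)) * of_real x)) (\<lambda>x. exp (2 * (\<i> * of_real k) * of_real x))
       (1 / (2 * (\<i> * of_real k))) (exp_coeff qc k) (cnj (exp_coeff qc k)) L \<delta>"
      unfolding e_def E_def h_def c_def \<kappa>_def by blast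
  qed
qed

definition orthogonal_pair :: "(real \<Rightarrow> real) \<Rightarrow> complex \<Rightarrow> real \<Rightarrow> real \<Rightarrow> bool" where
  "orthogonal_pair q s l1 l2 \<longleftrightarrow> (\<exists>y1 y1' y2 y2'. hill_solution q l1 s y1 y1' \<and> hill_solution q l2 s y2 y2' \<and>
     (\<exists>x\<in>{0..1}. y1 x \<noteq> 0) \<and> (\<exists>x\<in>{0..1}. y2 x \<noteq> 0) \<and> integral {0..1} (\<lambda>x. y1 x * cnj (y2 x)) = 0)"

lemma oscillation_solutionI:
  assumes "oscillation q P w v e E h c d L \<delta>"
    and "antideriv a (\<lambda>x. h * (q x - of_real \<epsilon>) * (a x + e x * b x))"
    "antideriv b (\<lambda>x. - h * (q x - of_real \<epsilon>) * (E x * a x + b x))"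
    "a 1 = a 0" "b 1 = b 0" "\<forall>x\<in>{0..1}. cmod (a x) \<le> N \<and> cmod (b x) \<le> N"
  shows "oscillation_solution q P w v e E h c d L \<delta> a b \<epsilon> N"
  using assms unfolding oscillation_solution_def oscillation_solution_axioms_def by blast

text \<open>
Two scales occur: the solutions are first placed in the situation with the small \<open>\<delta>\<close>, where
their shifts turn out to be at most \<open>\<delta>'\<close>, and then treated in the situation with \<open>\<delta>'\<close>, which
bounds the shifts as well.
\<close>
lemma gap_estimate:
  fixes q :: "real \<Rightarrow> real" and k \<epsilon>1 \<epsilon>2 :: real
  defines "qc \<equiv> \<lambda>x. complex_of_real (q x)"
  defines "\<kappa> \<equiv> \<i> * complex_of_real k"
  defines "e \<equiv> (\<lambda>x. exp (- (2 * \<kappa>) * complex_of_real x))" and "E \<equiv> (\<lambda>x. exp (2 * \<kappa> * complex_of_real x))"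
    and "h \<equiv> 1 / (2 * \<kappa>)"
  assumes osc: "real_oscillation qc P w v e E h c d L \<delta>" and osc': "real_oscillation qc P w' v' e E h c d L \<delta>'"
    and \<delta>: "42 * L\<^sup>2 * \<delta> \<le> \<delta>'" and k: "k > 0"
    and s: "s * exp \<kappa> = 1" "s * exp (- \<kappa>) = 1"
    and small: "400 * L * cmod h * (L + \<bar>\<epsilon>1\<bar>) \<le> 1" "400 * L * cmod h * (L + \<bar>\<epsilon>2\<bar>) \<le> 1"
    and le: "\<epsilon>1 \<le> \<epsilon>2"
    and pair: "orthogonal_pair q s (k\<^sup>2 + \<epsilon>1) (k\<^sup>2 + \<epsilon>2)"
  shows "\<bar>\<epsilon>2 - \<epsilon>1 - 2 * cmod (c - integral {0..1} (\<lambda>x. (P x)\<^sup>2 * e x))\<bar> \<le> 16848 * L ^ 4 * (cmod h)\<^sup>2 * \<delta>'"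
proof -
  interpret O: real_oscillation qc P w v e E h c d L \<delta> by (rule osc)
  interpret O': real_oscillation qc P w' v' e E h c d L \<delta>' by (rule osc')
  from pair obtain y1 y1' y2 y2' z1 z2 where y1: "hill_solution q (k\<^sup>2 + \<epsilon>1) s y1 y1'" and y2: "hill_solution q (k\<^sup>2 + \<epsilon>2) s y2 y2'"
    and z: "z1 \<in> {0..1}" "y1 z1 \<noteq> 0" "z2 \<in> {0..1}" "y2 z2 \<noteq> 0" and orth: "integral {0..1} (\<lambda>x. y1 x * cnj (y2 x)) = 0"
    unfolding orthogonal_pair_def by blast
  obtain a1 b1 r1 x1 where 1: "r1 \<noteq> 0" "x1 \<in> {0..1}" "1 \<le> cmod (a1 x1) + cmod (b1 x1)"
     "\<forall>x\<in>{0..1}. cmod (a1 x) \<le> 1 \<and> cmod (b1 x) \<le> 1" "a1 1 = a1 0" "b1 1 = b1 0"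
     "antideriv a1 (\<lambda>x. h * (qc x - of_real \<epsilon>1) * (a1 x + e x * b1 x))"
     "antideriv b1 (\<lambda>x. - h * (qc x - of_real \<epsilon>1) * (E x * a1 x + b1 x))"
     "\<And>x. y1 x = r1 * (exp (\<kappa> * of_real x) * a1 x + exp (- \<kappa> * of_real x) * b1 x)"
    using normalized_amplitudes[OF y1 k s[unfolded \<kappa>_def] z(1,2)] unfolding \<kappa>_def h_def e_def E_def qc_def by auto
  obtain a2 b2 r2 x2 where 2: "r2 \<noteq> 0" "x2 \<in> {0..1}" "1 \<le> cmod (a2 x2) + cmod (b2 x2)"
     "\<forall>x\<in>{0..1}. cmod (a2 x) \<le> 1 \<and> cmod (b2 x) \<le> 1" "a2 1 = a2 0" "b2 1 = b2 0"
     "antideriv a2 (\<lambda>x. h * (qc x - of_real \<epsilon>2) * (a2 x + e x * b2 x))"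
     "antideriv b2 (\<lambda>x. - h * (qc x - of_real \<epsilon>2) * (E x * a2 x + b2 x))"
     "\<And>x. y2 x = r2 * (exp (\<kappa> * of_real x) * a2 x + exp (- \<kappa> * of_real x) * b2 x)"
    using normalized_amplitudes[OF y2 k s[unfolded \<kappa>_def] z(3,4)] unfolding \<kappa>_def h_def e_def E_def qc_def by auto
  interpret s1: oscillation_solution qc P w v e E h c d L \<delta> a1 b1 \<epsilon>1 1
    by (rule oscillation_solutionI[OF O.oscillation_axioms 1(7,8,5,6,4)])
  interpret s2: oscillation_solution qc P w v e E h c d L \<delta> a2 b2 \<epsilon>2 1
    by (rule oscillation_solutionI[OF O.oscillation_axioms 2(7,8,5,6,4)])
  have \<epsilon>: "\<bar>\<epsilon>1\<bar> \<le> \<delta>'" "\<bar>\<epsilon>2\<bar> \<le> \<delta>'"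
    using s1.spectral_shift_bound[OF 1(2,3) refl small(1)] s2.spectral_shift_bound[OF 2(2,3) refl small(2)] \<delta> by linarith+
  have "400 * L * cmod h * 1 \<le> 400 * L * cmod h * (L + \<bar>\<epsilon>1\<bar>)"
    using O.L by (intro mult_left_mono) auto
  then have small': "400 * L * cmod h \<le> 1" using small(1) by simp
  have expand: "y1 x * cnj (y2 x) = r1 * cnj r2 * (a1 x * cnj (a2 x) + b1 x * cnj (b2 x) + E x * (a1 x * cnj (b2 x)) + e x * (b1 x * cnj (a2 x)))" for x
  proof -
    define g where "g = exp (\<kappa> * of_real x)"
    define G where "G = exp (- \<kappa> * of_real x)"
    have "cnj \<kappa> = - \<kappa>" by (simp add: \<kappa>_def)
    then have g: "cnj g = G" "cnj G = g" "g * G = 1" "E x = g * g" "e x = G * G"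
      by (auto simp: g_def G_def E_def e_def exp_cnj algebra_simps simp flip: exp_add)
    have y: "y1 x = r1 * (g * a1 x + G * b1 x)" "cnj (y2 x) = cnj r2 * (G * cnj (a2 x) + g * cnj (b2 x))"
      unfolding 1(9) 2(9) g_def[symmetric] G_def[symmetric] complex_cnj_mult complex_cnj_add g(1,2) by simp_all
    have "(g * A1 + G * B1) * (G * A2 + g * B2) = A1 * A2 + B1 * B2 + (g * g) * (A1 * B2) + (G * G) * (B1 * A2)"
      for A1 B1 A2 B2 using g(3) by algebra
    from this[of "a1 x" "b1 x" "cnj (a2 x)" "cnj (b2 x)"] show ?thesis
      unfolding y g(4,5) by (simp only: mult_ac)
  qed
  have "integral {0..1} (\<lambda>x. a1 x * cnj (a2 x) + b1 x * cnj (b2 x) + E x * (a1 x * cnj (b2 x)) + e x * (b1 x * cnj (a2 x))) = 0"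
    using orth 1(1) 2(1) unfolding expand
    by (simp only: Henstock_Kurzweil_Integration.integral_mult_right mult_eq_0_iff complex_cnj_zero_iff) simp
  from O'.pair_splitting[OF _ _ 1(2,3) 2(2,3) \<epsilon> le small' this]
    oscillation_solutionI[OF O'.oscillation_axioms 1(7,8,5,6,4)]
    oscillation_solutionI[OF O'.oscillation_axioms 2(7,8,5,6,4)]
  show ?thesis by (simp add: O'.S_def mult_ac)
qed

context oscillation
begin

text \<open>
\<open>S\<close> is \<open>o(1/k)\<close>; this is why the first-order formula holds without correction.
\<close>
lemma S_bound: "cmod S \<le> 2 * cmod h * \<delta> * L"
proof -
  have "cmod (integral {0..1} (\<lambda>x. q x * e x * P x)) \<le> \<delta> * L"
    using int_qe[OF bvP] P(3) by simp
  then have "2 * cmod h * cmod (integral {0..1} (\<lambda>x. q x * e x * P x)) \<le> 2 * cmod h * (\<delta> * L)"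
    by (intro mult_left_mono) auto
  then show ?thesis
    using arg_cong[OF int_qeP, of cmod] by (simp add: norm_mult mult.assoc)
qed

text \<open>
Passing from the mean-zero primitive \<open>P = Q - z\<close> to \<open>Q\<close> produces the summand with \<open>2 z\<close>; the one with
\<open>z\<^sup>2\<close> vanishes as \<open>e\<close> has mean zero.
\<close>
lemma int_square_minus_const:
  assumes Q: "continuous_on {0..1} Q" "\<And>x. x \<in> {0..1} \<Longrightarrow> P x = Q x - z"
  shows "S = integral {0..1} (\<lambda>x. (Q x)\<^sup>2 * e x) - 2 * z * integral {0..1} (\<lambda>x. Q x * e x)"
proof -
  note ce = antideriv_continuous[OF e(1)]
  have "integral {0..1} (\<lambda>x. (- 1 / h) * e x) = 0"
    using antideriv_integral[OF e(1)] e(2) by simp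
  then have e0: "integral {0..1} e = 0"
    using h by (simp only: Henstock_Kurzweil_Integration.integral_mult_right) simp
  have i: "(\<lambda>x. (Q x)\<^sup>2 * e x) integrable_on {0..1}" "(\<lambda>x. (2 * z) * (Q x * e x)) integrable_on {0..1}" "(\<lambda>x. z\<^sup>2 * e x) integrable_on {0..1}"
    by (intro integrable_continuous_real continuous_intros Q(1) ce)+
  have "S = integral {0..1} (\<lambda>x. (Q x)\<^sup>2 * e x - (2 * z) * (Q x * e x) + z\<^sup>2 * e x)"
    unfolding S_def by (intro Henstock_Kurzweil_Integration.integral_cong) (simp add: Q(2) power2_eq_square algebra_simps)
  also have "\<dots> = integral {0..1} (\<lambda>x. (Q x)\<^sup>2 * e x) - 2 * z * integral {0..1} (\<lambda>x. Q x * e x) + z\<^sup>2 * integral {0..1} e"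
    by (simp only: Henstock_Kurzweil_Integration.integral_add[OF Henstock_Kurzweil_Integration.integrable_diff[OF i(1,2)] i(3)]
      Henstock_Kurzweil_Integration.integral_diff[OF i(1,2)] Henstock_Kurzweil_Integration.integral_mult_right)
  finally show ?thesis using e0 by simp
qed

end

definition second_order_coeff :: "(real \<Rightarrow> real) \<Rightarrow> int \<Rightarrow> complex" where
  "second_order_coeff q m = fourier_coeff q m - fourier_coeff (primitive_sq q) m
     + 2 * fourier_coeff (primitive q) 0 * fourier_coeff (primitive q) m"

lemma fourier_coeff_eq:
  "fourier_coeff f (int m) = integral {0..1} (\<lambda>x. of_real (f x) * exp (- (2 * (\<i> * of_real (pi * real m))) * of_real x))"
  unfolding fourier_coeff_def by (simp add: mult_ac)

text \<open>
The gap formulas at frequency \<open>\<pi> m\<close> for all large \<open>m\<close>; even \<open>m\<close> belong to the periodic and odd \<open>m\<close> to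
the antiperiodic problem.  A priori only \<open>l = k\<^sup>2 + O(k\<^sup>1\<^sup>/\<^sup>2)\<close> is known, which is enough since it makes
\<open>h \<epsilon>\<close> tend to zero.
\<close>
lemma gap_asymptotics_uniform:
  fixes q :: "real \<Rightarrow> real"
  assumes q: "q absolutely_integrable_on {0..1}" and m0: "integral {0..1} q = 0" and \<eta>: "\<eta> > 0"
  shows "\<exists>M. \<forall>m\<ge>M. \<forall>l1 l2. l1 \<le> l2 \<longrightarrow> \<bar>l1 - (pi * real m)\<^sup>2\<bar> \<le> C * sqrt (real m) \<longrightarrow>
     \<bar>l2 - (pi * real m)\<^sup>2\<bar> \<le> C * sqrt (real m) \<longrightarrow> orthogonal_pair q ((-1) ^ m) l1 l2 \<longrightarrow>
     \<bar>l2 - l1 - 2 * cmod (second_order_coeff q (int m))\<bar> \<le> \<eta> / (real m)\<^sup>2 \<and>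
     \<bar>l2 - l1 - 2 * cmod (fourier_coeff q (int m))\<bar> \<le> \<eta> / real m"
proof -
  define qc where "qc = (\<lambda>x. complex_of_real (q x))"
  define L where "L = 1 + L1_norm qc"
  define Qc where "Qc = (\<lambda>x. complex_of_real (primitive q x))"
  define P where "P = (\<lambda>x. Qc x - integral {0..1} Qc)"
  have L: "1 \<le> L" using L1_nonneg[OF set_integrable_of_real[OF q]] by (simp add: L_def qc_def)
  \<comment> \<open>The estimate of the gap needs the bound \<^term>\<open>\<delta>'\<close> also for the shifts \<^term>\<open>l - k\<^sup>2\<close>, and
     these are controlled only by a multiple of the bound for the oscillating quantities; hence
     the potential is examined at the finer scale \<^term>\<open>\<delta>\<close> too.  The constant
     $16852 = 16848 + 4$ pays for the second-order term as well.\<close>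
  define \<delta>' where "\<delta>' = min 1 (\<eta> / (16852 * L ^ 4))"
  define \<delta> where "\<delta> = \<delta>' / (42 * L\<^sup>2)"
  have \<delta>': "0 < \<delta>'" "\<delta>' \<le> 1" "\<delta>' \<le> \<eta> / (16852 * L ^ 4)" using \<eta> L by (auto simp: \<delta>'_def)
  have \<delta>'\<eta>: "16852 * L ^ 4 * \<delta>' \<le> \<eta>" using \<delta>'(3) L by (simp add: field_simps)
  have L2: "1 \<le> L\<^sup>2" using L by simp
  have \<delta>: "0 < \<delta>" "\<delta> \<le> \<delta>'" "42 * L\<^sup>2 * \<delta> = \<delta>'"
  proof -
    show "0 < \<delta>" using \<delta>' L by (simp add: \<delta>_def)
    show *: "42 * L\<^sup>2 * \<delta> = \<delta>'" using L by (simp add: \<delta>_def)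
    have "1 * \<delta> \<le> (42 * L\<^sup>2) * \<delta>" using \<open>0 < \<delta>\<close> L2 by (intro mult_right_mono) auto
    then show "\<delta> \<le> \<delta>'" using * by simp
  qed
  obtain M1 where M1: "\<forall>m\<ge>M1. m > 0 \<and> (\<forall>k. k = pi * real m \<longrightarrow> (\<exists>w v.
     real_oscillation qc P w v (\<lambda>x. exp (- (2 * (\<i> * of_real k)) * of_real x)) (\<lambda>x. exp (2 * (\<i> * of_real k) * of_real x))
       (1 / (2 * (\<i> * of_real k))) (exp_coeff qc k) (cnj (exp_coeff qc k)) L \<delta>))"
    using oscillation_exists[OF q m0 \<delta>(1) order_trans[OF \<delta>(2) \<delta>'(2)]] unfolding qc_def L_def P_def Qc_def by blast
  obtain M2 where M2: "\<forall>m\<ge>M2. m > 0 \<and> (\<forall>k. k = pi * real m \<longrightarrow> (\<exists>w v.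
     real_oscillation qc P w v (\<lambda>x. exp (- (2 * (\<i> * of_real k)) * of_real x)) (\<lambda>x. exp (2 * (\<i> * of_real k) * of_real x))
       (1 / (2 * (\<i> * of_real k))) (exp_coeff qc k) (cnj (exp_coeff qc k)) L \<delta>'))"
    using oscillation_exists[OF q m0 \<delta>'(1,2)] unfolding qc_def L_def P_def Qc_def by blast
  define B where "B = 400 * L * (L + \<bar>C\<bar>)"
  obtain M3 :: nat where M3: "B\<^sup>2 < real M3" using reals_Archimedean2 by blast
  show ?thesis
  proof (intro exI[of _ "max M1 (max M2 M3)"] allI impI)
    fix m l1 l2
    assume m: "max M1 (max M2 M3) \<le> m" and le: "l1 \<le> l2"
      and C1: "\<bar>l1 - (pi * real m)\<^sup>2\<bar> \<le> C * sqrt (real m)" and C2: "\<bar>l2 - (pi * real m)\<^sup>2\<bar> \<le> C * sqrt (real m)"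
      and pair: "orthogonal_pair q ((-1) ^ m) l1 l2"
    have M1m: "M1 \<le> m" and M2m: "M2 \<le> m" using m by auto
    have mpos: "1 \<le> real m" using M1 m by (simp add: Suc_leI)
    define k where "k = pi * real m"
    have mk: "real m \<le> k" using mult_right_mono[of 1 pi "real m"] pi_gt3 by (simp add: k_def)
    have k: "k > 0" using mpos mk by linarith
    define \<kappa> where "\<kappa> = \<i> * complex_of_real k"
    define e where "e = (\<lambda>x. exp (- (2 * \<kappa>) * complex_of_real x))"
    define E where "E = (\<lambda>x. exp (2 * \<kappa> * complex_of_real x))"
    define h where "h = 1 / (2 * \<kappa>)"
    define c where "c = exp_coeff qc k"
    obtain w v where osc: "real_oscillation qc P w v e E h c (cnj c) L \<delta>"
      using M1 M1m k_def unfolding e_def E_def h_def c_def \<kappa>_def by blast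
    obtain w' v' where osc': "real_oscillation qc P w' v' e E h c (cnj c) L \<delta>'"
      using M2 M2m k_def unfolding e_def E_def h_def c_def \<kappa>_def by blast
    interpret O: real_oscillation qc P w v e E h c "cnj c" L \<delta> by (rule osc)
    have nh: "cmod h = 1 / (2 * k)" using k by (simp add: h_def \<kappa>_def norm_divide norm_mult)
    have h: "cmod h \<le> 1 / real m"
      unfolding nh using mk mpos by (intro divide_left_mono) auto
    have h2: "(cmod h)\<^sup>2 \<le> 1 / (real m)\<^sup>2"
      using power_mono[OF h, of 2] by (simp add: power_divide)
    define \<epsilon>1 where "\<epsilon>1 = l1 - k\<^sup>2"
    define \<epsilon>2 where "\<epsilon>2 = l2 - k\<^sup>2"
    have small: "400 * L * cmod h * (L + \<bar>\<epsilon>\<bar>) \<le> 1" if "\<bar>\<epsilon>\<bar> \<le> C * sqrt (real m)" for \<epsilon>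
    proof -
      have s1: "1 \<le> sqrt (real m)" using mpos by simp
      have "L * 1 \<le> L * sqrt (real m)" using L s1 by (intro mult_left_mono) auto
      moreover have "C * sqrt (real m) \<le> \<bar>C\<bar> * sqrt (real m)" by (intro mult_right_mono) auto
      ultimately have "L + \<bar>\<epsilon>\<bar> \<le> (L + \<bar>C\<bar>) * sqrt (real m)" using that by (simp add: algebra_simps)
      then have "400 * L * cmod h * (L + \<bar>\<epsilon>\<bar>) \<le> 400 * L * (1 / real m) * ((L + \<bar>C\<bar>) * sqrt (real m))"
        using L h by (intro mult_mono) auto
      also have "\<dots> = B * sqrt (real m) / real m" by (simp add: B_def)
      also have "B * sqrt (real m) \<le> sqrt (real m) * sqrt (real m)"
      proof (intro mult_right_mono)
        have "B\<^sup>2 \<le> real m" using M3 m by simp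
        then show "B \<le> sqrt (real m)" by (rule real_le_rsqrt)
      qed auto
      finally show ?thesis using mpos by (simp add: divide_right_mono field_simps)
    qed
    have "exp \<kappa> = (-1) ^ m"
    proof -
      have "\<kappa> = of_nat m * (\<i> * of_real pi)" by (simp add: \<kappa>_def k_def)
      then have "exp \<kappa> = exp (\<i> * of_real pi) ^ m" by (simp only: exp_of_nat_mult)
      then show ?thesis by simp
    qed
    then have s: "(-1) ^ m * exp \<kappa> = 1" "(-1) ^ m * exp (- \<kappa>) = 1"
      by (simp_all add: exp_minus flip: power_mult_distrib power_inverse)
    have "\<bar>\<epsilon>2 - \<epsilon>1 - 2 * cmod (c - integral {0..1} (\<lambda>x. (P x)\<^sup>2 * e x))\<bar> \<le> 16848 * L ^ 4 * (cmod h)\<^sup>2 * \<delta>'"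
      unfolding qc_def e_def E_def h_def \<kappa>_def
    proof (rule gap_estimate)
      show "real_oscillation (\<lambda>x. complex_of_real (q x)) P w v (\<lambda>x. exp (- (2 * (\<i> * complex_of_real k)) * complex_of_real x))
          (\<lambda>x. exp (2 * (\<i> * complex_of_real k) * complex_of_real x)) (1 / (2 * (\<i> * complex_of_real k))) c (cnj c) L \<delta>"
        using osc unfolding qc_def e_def E_def h_def \<kappa>_def .
      show "real_oscillation (\<lambda>x. complex_of_real (q x)) P w' v' (\<lambda>x. exp (- (2 * (\<i> * complex_of_real k)) * complex_of_real x))
          (\<lambda>x. exp (2 * (\<i> * complex_of_real k) * complex_of_real x)) (1 / (2 * (\<i> * complex_of_real k))) c (cnj c) L \<delta>'"
        using osc' unfolding qc_def e_def E_def h_def \<kappa>_def .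
      show "orthogonal_pair q ((-1) ^ m) (k\<^sup>2 + \<epsilon>1) (k\<^sup>2 + \<epsilon>2)" using pair by (simp add: \<epsilon>1_def \<epsilon>2_def)
    qed (use k \<delta> s[unfolded \<kappa>_def] small[of \<epsilon>1, unfolded h_def \<kappa>_def] small[of \<epsilon>2, unfolded h_def \<kappa>_def] C1 C2 le in \<open>auto simp: \<epsilon>1_def \<epsilon>2_def k_def\<close>)
    then have main: "\<bar>l2 - l1 - 2 * cmod (c - O.S)\<bar> \<le> 16848 * L ^ 4 * (cmod h)\<^sup>2 * \<delta>'"
      by (simp add: \<epsilon>1_def \<epsilon>2_def O.S_def)
    have L4: "0 \<le> L ^ 4 * \<delta>'" using L \<delta>' by simp
    have cont: "continuous_on {0..1} Qc"
      using continuous_on_add[OF antideriv_continuous[OF O.P(1)] continuous_on_const, of "integral {0..1} Qc"]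
      by (simp add: P_def)
    have "O.S = integral {0..1} (\<lambda>x. (Qc x)\<^sup>2 * e x) - 2 * integral {0..1} Qc * integral {0..1} (\<lambda>x. Qc x * e x)"
      by (rule O.int_square_minus_const[OF cont]) (simp add: P_def)
    moreover have "fourier_coeff (primitive_sq q) (int m) = integral {0..1} (\<lambda>x. (Qc x)\<^sup>2 * e x)"
      unfolding fourier_coeff_eq by (simp add: primitive_sq_def Qc_def e_def \<kappa>_def k_def)
    moreover have "fourier_coeff (primitive q) (int m) = integral {0..1} (\<lambda>x. Qc x * e x)"
      unfolding fourier_coeff_eq by (simp add: Qc_def e_def \<kappa>_def k_def)
    moreover have "fourier_coeff (primitive q) 0 = integral {0..1} Qc"
      by (simp add: fourier_coeff_def Qc_def)
    moreover have c: "fourier_coeff q (int m) = c"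
      unfolding fourier_coeff_eq by (simp add: c_def exp_coeff_def qc_def k_def)
    ultimately have D: "second_order_coeff q (int m) = c - O.S"
      by (simp add: second_order_coeff_def)
    have "16848 * L ^ 4 * (cmod h)\<^sup>2 * \<delta>' = (16848 * (L ^ 4 * \<delta>')) * (cmod h)\<^sup>2" by simp
    also have "\<dots> \<le> (16848 * (L ^ 4 * \<delta>')) * (1 / (real m)\<^sup>2)"
      using h2 L4 by (intro mult_left_mono) auto
    finally have m2: "16848 * L ^ 4 * (cmod h)\<^sup>2 * \<delta>' \<le> 16848 * (L ^ 4 * \<delta>') / (real m)\<^sup>2" by simp
    also have "\<dots> \<le> \<eta> / (real m)\<^sup>2" using \<delta>'\<eta> L4 by (intro divide_right_mono) auto
    finally have 1: "\<bar>l2 - l1 - 2 * cmod (second_order_coeff q (int m))\<bar> \<le> \<eta> / (real m)\<^sup>2"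
      using main unfolding D by linarith
    have "16848 * (L ^ 4 * \<delta>') / (real m)\<^sup>2 \<le> 16848 * (L ^ 4 * \<delta>') / real m"
      using mpos L4 by (intro divide_left_mono) (auto simp: power2_eq_square)
    then have b1: "\<bar>l2 - l1 - 2 * cmod (c - O.S)\<bar> \<le> 16848 * (L ^ 4 * \<delta>') / real m"
      using main m2 by linarith
    have "cmod O.S \<le> 2 * cmod h * (\<delta> * L)" using O.S_bound by simp
    also have "\<dots> \<le> 2 * (1 / real m) * (\<delta>' * L ^ 4)"
      using h \<delta> L power_increasing[of 1 4 L] by (intro mult_mono) auto
    finally have b2: "cmod O.S \<le> 2 * (L ^ 4 * \<delta>') / real m" by (simp add: mult_ac)
    have triangle: "\<bar>x - 2 * cmod c\<bar> \<le> r + 2 * r'" if "\<bar>x - 2 * cmod (c - O.S)\<bar> \<le> r" "cmod O.S \<le> r'" for x r r'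
      using that norm_triangle_ineq3[of "c - O.S" c] by simp
    have "\<bar>l2 - l1 - 2 * cmod c\<bar> \<le> 16848 * (L ^ 4 * \<delta>') / real m + 2 * (2 * (L ^ 4 * \<delta>') / real m)"
      using b1 b2 by (rule triangle)
    also have "\<dots> = (16852 * L ^ 4 * \<delta>') / real m" by (simp add: field_simps)
    also have "\<dots> \<le> \<eta> / real m" using \<delta>'\<eta> by (intro divide_right_mono) auto
    finally show "\<bar>l2 - l1 - 2 * cmod (second_order_coeff q (int m))\<bar> \<le> \<eta> / (real m)\<^sup>2 \<and>
       \<bar>l2 - l1 - 2 * cmod (fourier_coeff q (int m))\<bar> \<le> \<eta> / real m"
      using 1 c by simp
  qed
qed

text \<open>
For a double eigenvalue the pair comes from Gram--Schmidt, for two simple ones orthogonality is automatic.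
Treating both cases as one makes a separate discussion of closed gaps unnecessary.
\<close>
lemma eigenfunctions_orthogonal_pair:
  assumes s: "s * cnj s = 1"
    and one: "0 < multiplicity_of_eigenvalue (hill_operator q s) (of_real l1)" "0 < multiplicity_of_eigenvalue (hill_operator q s) (of_real l2)"
    and two: "l1 = l2 \<Longrightarrow> 2 \<le> multiplicity_of_eigenvalue (hill_operator q s) (of_real l1)"
  shows "orthogonal_pair q s l1 l2"
proof -
  interpret V: vector_space "\<lambda>(c::complex) (f::real \<Rightarrow> complex) x. c * f x"
    by (rule vector_space_complex_functions)
  have ex: "\<exists>y\<in>eigenspace (hill_operator q s) (of_real l). y \<noteq> 0"
    if "0 < multiplicity_of_eigenvalue (hill_operator q s) (of_real l)" for l
  proof (rule ccontr)
    assume "\<not> ?thesis"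
    then have "eigenspace (hill_operator q s) (of_real l) \<subseteq> V.span {}" by auto
    from V.dim_le_card[OF this] show False using that by (simp add: multiplicity_of_eigenvalue_def)
  qed
  have nz: "\<exists>x\<in>{0..1}. y x \<noteq> 0" if "\<And>x. x \<notin> {0..1} \<Longrightarrow> y x = 0" "y \<noteq> 0" for y :: "real \<Rightarrow> complex"
    using that by (auto simp: fun_eq_iff) (metis atLeastAtMost_iff)
  obtain y1 where y1: "y1 \<in> eigenspace (hill_operator q s) (of_real l1)" "y1 \<noteq> 0" using ex[OF one(1)] by blast
  obtain y1' where s1: "hill_solution q l1 s y1 y1'" using eigenfunction_imp_hill_solution(1)[OF y1(1)] by blast
  have n1: "\<exists>x\<in>{0..1}. y1 x \<noteq> 0" using nz[OF eigenfunction_imp_hill_solution(2)[OF y1(1)] y1(2)] by blast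
  show ?thesis
  proof (cases "l1 = l2")
    case False
    obtain y2 where y2: "y2 \<in> eigenspace (hill_operator q s) (of_real l2)" "y2 \<noteq> 0" using ex[OF one(2)] by blast
    obtain y2' where s2: "hill_solution q l2 s y2 y2'" using eigenfunction_imp_hill_solution(1)[OF y2(1)] by blast
    have n2: "\<exists>x\<in>{0..1}. y2 x \<noteq> 0" using nz[OF eigenfunction_imp_hill_solution(2)[OF y2(1)] y2(2)] by blast
    show ?thesis
      unfolding orthogonal_pair_def using s1 s2 n1 n2 hill_solutions_orthogonal[OF s1 s2 False s] by blast
  next
    case True
    have "\<not> eigenspace (hill_operator q s) (of_real l1) \<subseteq> V.span {y1}"
    proof
      assume "eigenspace (hill_operator q s) (of_real l1) \<subseteq> V.span {y1}"
      from V.dim_le_card[OF this] show False using two[OF True] by (simp add: multiplicity_of_eigenvalue_def)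
    qed
    then obtain y2 where y2: "y2 \<in> eigenspace (hill_operator q s) (of_real l1)" "y2 \<notin> V.span {y1}" by blast
    obtain y2' where s2: "hill_solution q l1 s y2 y2'" using eigenfunction_imp_hill_solution(1)[OF y2(1)] by blast
    have c1: "continuous_on {0..1} y1" and c2: "continuous_on {0..1} y2"
      using s1 s2 unfolding hill_solution_def by (auto intro: antideriv_continuous)
    obtain x1 where "x1 \<in> {0..1}" "y1 x1 \<noteq> 0" using n1 by blast
    then have I0: "integral {0..1} (\<lambda>x. y1 x * cnj (y1 x)) \<noteq> 0" by (rule integral_norm_square_pos[OF c1])
    \<comment> \<open>Gram-Schmidt inside the two-dimensional eigenspace\<close>
    define t where "t = cnj (integral {0..1} (\<lambda>x. y1 x * cnj (y2 x)) / integral {0..1} (\<lambda>x. y1 x * cnj (y1 x)))"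
    define y3 where "y3 = (\<lambda>x. y2 x - t * y1 x)"
    have s3: "hill_solution q l1 s y3 (\<lambda>x. y2' x - t * y1' x)"
      unfolding y3_def by (rule hill_solution_diff_cmult[OF s1 s2])
    have "y3 \<noteq> 0"
    proof
      assume "y3 = 0"
      then have "y2 = (\<lambda>x. t * y1 x)" by (auto simp: y3_def fun_eq_iff)
      moreover have "(\<lambda>x. t * y1 x) \<in> V.span {y1}" by (intro V.span_scale V.span_base) auto
      ultimately show False using y2(2) by simp
    qed
    moreover have "y3 x = 0" if "x \<notin> {0..1}" for x
      using eigenfunction_imp_hill_solution(2)[OF y1(1) that] eigenfunction_imp_hill_solution(2)[OF y2(1) that] by (simp add: y3_def)
    ultimately have n3: "\<exists>x\<in>{0..1}. y3 x \<noteq> 0" by (intro nz)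
    have i: "(\<lambda>x. y1 x * cnj (y2 x)) integrable_on {0..1}" "(\<lambda>x. cnj t * (y1 x * cnj (y1 x))) integrable_on {0..1}"
      by (intro integrable_continuous_real continuous_intros c1 c2)+
    have "(\<lambda>x. y1 x * cnj (y3 x)) = (\<lambda>x. y1 x * cnj (y2 x) - cnj t * (y1 x * cnj (y1 x)))"
      by (auto simp: y3_def algebra_simps)
    then have "integral {0..1} (\<lambda>x. y1 x * cnj (y3 x))
        = integral {0..1} (\<lambda>x. y1 x * cnj (y2 x)) - cnj t * integral {0..1} (\<lambda>x. y1 x * cnj (y1 x))"
      by (simp only: Henstock_Kurzweil_Integration.integral_diff[OF i] Henstock_Kurzweil_Integration.integral_mult_right)
    also have "\<dots> = 0" using I0 by (simp add: t_def)
    finally show ?thesis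
      unfolding orthogonal_pair_def using s1 s3 n1 n3 True by blast
  qed
qed

text \<open>
The counting hypothesis yields eigenvalues of the right multiplicity once the counted sets are known to
be finite, which holds since the listed numbers tend to infinity.
\<close>
lemma large_eigenvalues_orthogonal_pairs:
  assumes lam: "large_eigenvalues (hill_operator q s) c lam" and s: "s * cnj s = 1"
    and c: "\<And>n. (real n)\<^sup>2 \<le> c n"
  shows "\<exists>N. \<forall>n\<ge>N. lam n 1 \<le> lam n 2 \<and> orthogonal_pair q s (lam n 1) (lam n 2)"
proof -
  obtain N R where NR: "\<And>n. n \<ge> N \<Longrightarrow> R < lam n 1 \<and> lam n 1 \<le> lam n 2"
    and mult: "\<And>z. R < cmod z \<Longrightarrow> multiplicity_of_eigenvalue (hill_operator q s) z =
                 card {(n, j). N \<le> n \<and> j \<in> {1, 2} \<and> complex_of_real (lam n j) = z}"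
    and O: "\<And>j. j \<in> {1, 2} \<Longrightarrow> (\<lambda>n. lam n j - c n) \<in> O(\<lambda>n. sqrt (real n))"
    using lam unfolding large_eigenvalues_def by blast
  have large: "\<exists>n0. \<forall>n\<ge>n0. X < lam n j" if j: "j \<in> {1, 2}" for X :: real and j
  proof -
    obtain K where "\<forall>\<^sub>F n in sequentially. norm (lam n j - c n) \<le> K * norm (sqrt (real n))"
      using landau_o.bigE[OF O[OF j]] by blast
    then obtain n1 where n1: "\<And>n. n \<ge> n1 \<Longrightarrow> \<bar>lam n j - c n\<bar> \<le> K * sqrt (real n)"
      unfolding eventually_sequentially by auto
    obtain n2 :: nat where n2: "\<bar>K\<bar> + 1 + \<bar>X\<bar> < real n2" using reals_Archimedean2 by blast
    show ?thesis
    proof (intro exI[of _ "max n1 n2"] allI impI)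
      fix n assume n: "max n1 n2 \<le> n"
      have rn: "\<bar>K\<bar> + 1 + \<bar>X\<bar> < real n" using n n2 by simp
      have "1 \<le> real n" using rn by linarith
      then have "sqrt (real n) * 1 \<le> sqrt (real n) * sqrt (real n)" by (intro mult_left_mono) auto
      then have sq: "sqrt (real n) \<le> real n" by simp
      have "K * sqrt (real n) \<le> \<bar>K\<bar> * real n" using sq by (intro mult_mono) auto
      then have "real n * real n - \<bar>K\<bar> * real n \<le> lam n j"
        using n1[of n] c[of n] n by (simp add: power2_eq_square abs_le_iff)
      moreover have "1 * real n \<le> (real n - \<bar>K\<bar>) * real n" using rn by (intro mult_right_mono) auto
      ultimately show "X < lam n j" using rn by (simp add: algebra_simps)
    qed
  qed
  have fin: "finite {(n, j). N \<le> n \<and> j \<in> {1, 2} \<and> complex_of_real (lam n j) = of_real X}" for X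
  proof -
    obtain n1 where n1: "\<forall>n\<ge>n1. X < lam n 1" using large[of 1 X] by auto
    obtain n2 where n2: "\<forall>n\<ge>n2. X < lam n 2" using large[of 2 X] by auto
    have "{(n, j). N \<le> n \<and> j \<in> {1, 2} \<and> complex_of_real (lam n j) = of_real X} \<subseteq> {..max n1 n2} \<times> {1, 2}"
    proof
      fix x assume "x \<in> {(n, j). N \<le> n \<and> j \<in> {1, 2} \<and> complex_of_real (lam n j) = of_real X}"
      then obtain n j where x: "x = (n, j)" "j \<in> {1, 2}" "lam n j = X" by auto
      then have "\<not> (n1 \<le> n \<and> n2 \<le> n)" using n1 n2 by fastforce
      then show "x \<in> {..max n1 n2} \<times> {1, 2}" using x by auto
    qed
    then show ?thesis by (rule finite_subset) auto
  qed
  show ?thesis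
  proof (intro exI[of _ N] allI impI conjI)
    fix n assume n: "N \<le> n"
    show le: "lam n 1 \<le> lam n 2" using NR[OF n] by blast
    have R: "R < cmod (of_real (lam n 1))" "R < cmod (of_real (lam n 2))" using NR[OF n] by auto
    have pos: "0 < multiplicity_of_eigenvalue (hill_operator q s) (of_real (lam n j))" if j: "j \<in> {1, 2}" for j
    proof -
      have Rj: "R < cmod (of_real (lam n j))" using R j by auto
      moreover have "(n, j) \<in> {(n', j'). N \<le> n' \<and> j' \<in> {1, 2} \<and> complex_of_real (lam n' j') = of_real (lam n j)}"
        using n j by auto
      ultimately show ?thesis unfolding mult[OF Rj] using fin by (subst card_gt_0_iff) blast
    qed
    show "orthogonal_pair q s (lam n 1) (lam n 2)"
    proof (rule eigenfunctions_orthogonal_pair[OF s pos pos])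
      assume eq: "lam n 1 = lam n 2"
      have "{(n, 1), (n, 2)} \<subseteq> {(n', j'). N \<le> n' \<and> j' \<in> {1, 2} \<and> complex_of_real (lam n' j') = of_real (lam n 1)}"
        using n eq by auto
      from card_mono[OF fin this] show "2 \<le> multiplicity_of_eigenvalue (hill_operator q s) (of_real (lam n 1))"
        unfolding mult[OF R(1)] by simp
    qed auto
  qed
qed

section \<open>Gap lengths\<close>

lemma gap_length: "lam n 1 \<le> lam n 2 \<Longrightarrow> measure lborel (gap lam n) = lam n 2 - lam n 1"
  by (simp add: gap_def)

lemma gap_asymptotics:
  fixes q :: "real \<Rightarrow> real" and M :: "nat \<Rightarrow> nat"
  assumes q: "q absolutely_integrable_on {0..1}" and m0: "integral {0..1} q = 0"
    and s: "\<And>n. (-1) ^ M n = s" and M: "\<And>n. n \<le> M n"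
    and lam: "large_eigenvalues (hill_operator q s) (\<lambda>n. (pi * real (M n))\<^sup>2) lam"
  shows "(\<lambda>n. measure lborel (gap lam n) - 2 * cmod (fourier_coeff q (int (M n)))) \<in> o(\<lambda>n. 1 / real n)"
    and "(\<lambda>n. measure lborel (gap lam n) - 2 * cmod (second_order_coeff q (int (M n)))) \<in> o(\<lambda>n. 1 / (real n)\<^sup>2)"
proof -
  have ss: "s * cnj s = 1" by (simp add: s[of 0, symmetric] flip: power_mult_distrib)
  have "(real n)\<^sup>2 \<le> (pi * real (M n))\<^sup>2" for n
  proof (rule power_mono)
    have "1 * real n \<le> pi * real (M n)" using M[of n] pi_gt3 by (intro mult_mono) auto
    then show "real n \<le> pi * real (M n)" by simp
  qed auto
  from large_eigenvalues_orthogonal_pairs[OF lam ss this] obtain N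
    where N: "\<And>n. N \<le> n \<Longrightarrow> lam n 1 \<le> lam n 2 \<and> orthogonal_pair q s (lam n 1) (lam n 2)" by blast
  have O: "\<exists>K n0. \<forall>n\<ge>n0. \<bar>lam n j - (pi * real (M n))\<^sup>2\<bar> \<le> K * sqrt (real (M n))" if j: "j \<in> {1, 2}" for j
  proof -
    have "(\<lambda>n. lam n j - (pi * real (M n))\<^sup>2) \<in> O(\<lambda>n. sqrt (real n))"
      using lam j unfolding large_eigenvalues_def by blast
    then obtain K where K: "K > 0" "\<forall>\<^sub>F n in sequentially. norm (lam n j - (pi * real (M n))\<^sup>2) \<le> K * norm (sqrt (real n))"
      using landau_o.bigE by blast
    then obtain n0 where n0: "\<And>n. n \<ge> n0 \<Longrightarrow> \<bar>lam n j - (pi * real (M n))\<^sup>2\<bar> \<le> K * sqrt (real n)"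
      unfolding eventually_sequentially by auto
    have "K * sqrt (real n) \<le> K * sqrt (real (M n))" for n using K(1) M[of n] by (intro mult_left_mono) auto
    then show ?thesis using n0 by (meson order_trans)
  qed
  obtain K1 n1 where 1: "\<And>n. n \<ge> n1 \<Longrightarrow> \<bar>lam n 1 - (pi * real (M n))\<^sup>2\<bar> \<le> K1 * sqrt (real (M n))" using O[of 1] by auto
  obtain K2 n2 where 2: "\<And>n. n \<ge> n2 \<Longrightarrow> \<bar>lam n 2 - (pi * real (M n))\<^sup>2\<bar> \<le> K2 * sqrt (real (M n))" using O[of 2] by auto
  have K: "K1 * sqrt (real (M n)) \<le> max K1 K2 * sqrt (real (M n))" "K2 * sqrt (real (M n)) \<le> max K1 K2 * sqrt (real (M n))" for n
    by (intro mult_right_mono; simp)+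
  have ev: "\<forall>\<^sub>F n in sequentially.
      \<bar>measure lborel (gap lam n) - 2 * cmod (second_order_coeff q (int (M n)))\<bar> \<le> \<eta> / (real n)\<^sup>2 \<and>
      \<bar>measure lborel (gap lam n) - 2 * cmod (fourier_coeff q (int (M n)))\<bar> \<le> \<eta> / real n" if \<eta>: "\<eta> > 0" for \<eta>
  proof -
    obtain M0 where M0: "\<And>m l1 l2. m \<ge> M0 \<Longrightarrow> l1 \<le> l2 \<Longrightarrow> \<bar>l1 - (pi * real m)\<^sup>2\<bar> \<le> max K1 K2 * sqrt (real m) \<Longrightarrow>
      \<bar>l2 - (pi * real m)\<^sup>2\<bar> \<le> max K1 K2 * sqrt (real m) \<Longrightarrow> orthogonal_pair q ((-1) ^ m) l1 l2 \<Longrightarrow>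
      \<bar>l2 - l1 - 2 * cmod (second_order_coeff q (int m))\<bar> \<le> \<eta> / (real m)\<^sup>2 \<and>
      \<bar>l2 - l1 - 2 * cmod (fourier_coeff q (int m))\<bar> \<le> \<eta> / real m"
      using gap_asymptotics_uniform[OF q m0 \<eta>] by blast
    show ?thesis
    proof (rule eventually_mono[OF eventually_ge_at_top[of "Max {1, M0, N, n1, n2}"]])
      fix n assume "Max {1, M0, N, n1, n2} \<le> n"
      then have n: "1 \<le> n" "M0 \<le> n" "N \<le> n" "n1 \<le> n" "n2 \<le> n" by auto
      have "\<bar>lam n 2 - lam n 1 - 2 * cmod (second_order_coeff q (int (M n)))\<bar> \<le> \<eta> / (real (M n))\<^sup>2 \<and>
        \<bar>lam n 2 - lam n 1 - 2 * cmod (fourier_coeff q (int (M n)))\<bar> \<le> \<eta> / real (M n)"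
      proof (rule M0)
        show "M0 \<le> M n" using n(2) M[of n] by linarith
        show "lam n 1 \<le> lam n 2" "orthogonal_pair q ((- 1) ^ M n) (lam n 1) (lam n 2)" using N[OF n(3)] s by auto
      qed (use 1[OF n(4)] 2[OF n(5)] K[of n] in linarith)+
      moreover have "\<eta> / (real (M n))\<^sup>2 \<le> \<eta> / (real n)\<^sup>2" "\<eta> / real (M n) \<le> \<eta> / real n"
        using n(1) M[of n] \<eta> by (auto intro!: divide_left_mono power_mono)
      ultimately show "\<bar>measure lborel (gap lam n) - 2 * cmod (second_order_coeff q (int (M n)))\<bar> \<le> \<eta> / (real n)\<^sup>2 \<and>
        \<bar>measure lborel (gap lam n) - 2 * cmod (fourier_coeff q (int (M n)))\<bar> \<le> \<eta> / real n"
        using N[OF n(3)] by (auto simp: gap_length)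
    qed
  qed
  show "(\<lambda>n. measure lborel (gap lam n) - 2 * cmod (fourier_coeff q (int (M n)))) \<in> o(\<lambda>n. 1 / real n)"
    by (rule landau_o.smallI, rule eventually_mono[OF ev]) auto
  show "(\<lambda>n. measure lborel (gap lam n) - 2 * cmod (second_order_coeff q (int (M n)))) \<in> o(\<lambda>n. 1 / (real n)\<^sup>2)"
    by (rule landau_o.smallI, rule eventually_mono[OF ev]) auto
qed

theorem theorem8:
  fixes q :: "real \<Rightarrow> real" and lam mu :: "nat \<Rightarrow> nat \<Rightarrow> real"
  assumes periodic: "\<And>x. q (x + 1) = q x"
    and integrable: "q absolutely_integrable_on {0..1}"
    and mean_zero: "integral {0..1} q = 0"
    and lam: "large_eigenvalues (periodic_operator q) (\<lambda>n. (2 * pi * real n)\<^sup>2) lam"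
    and mu: "large_eigenvalues (antiperiodic_operator q) (\<lambda>n. (2 * pi * real n + pi)\<^sup>2) mu"
  shows "let qc = fourier_coeff q;
             Q = fourier_coeff (primitive q);
             S = fourier_coeff (primitive_sq q)
         in (\<lambda>n. measure lborel (gap lam n) - 2 * cmod (qc (2 * int n))) \<in> o(\<lambda>n. 1 / real n) \<and>
            (\<lambda>n. measure lborel (gap lam n)
                  - 2 * cmod (qc (2 * int n) - S (2 * int n) + 2 * Q 0 * Q (2 * int n)))
              \<in> o(\<lambda>n. 1 / (real n)\<^sup>2) \<and>
            (\<lambda>n. measure lborel (gap mu n) - 2 * cmod (qc (2 * int n + 1))) \<in> o(\<lambda>n. 1 / real n) \<and>
            (\<lambda>n. measure lborel (gap mu n)
                  - 2 * cmod (qc (2 * int n + 1) - S (2 * int n + 1) + 2 * Q 0 * Q (2 * int n + 1)))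
              \<in> o(\<lambda>n. 1 / (real n)\<^sup>2)"
proof -
  have "(\<lambda>n. (2 * pi * real n)\<^sup>2) = (\<lambda>n. (pi * real (2 * n))\<^sup>2)" by (auto simp: mult_ac)
  note even = gap_asymptotics[OF integrable mean_zero, of "\<lambda>n. 2 * n", OF _ _ lam[unfolded this]]
  have "(\<lambda>n. (2 * pi * real n + pi)\<^sup>2) = (\<lambda>n. (pi * real (2 * n + 1))\<^sup>2)" by (auto simp: algebra_simps)
  note odd = gap_asymptotics[OF integrable mean_zero, of "\<lambda>n. 2 * n + 1", OF _ _ mu[unfolded this]]
  show ?thesis
    using even odd by (simp add: second_order_coeff_def Let_def add.commute)
qed

end
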